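(* Let $q,r$ be constants. Any $n$-variable instance of $(q,r)$-CSP-with-Wildcard can be solved (an assignment of minimum total cost can be found) in time $\left((q+1)^r-1\right)^{n/r}\cdot n^{\mathcal{O}(1)}$.
   Context: Let $\times$ be a special symbol. For a set $X$, let $\mathcal{F}_q(X)$ be the set of all functions $f:X\to[q]\cup\{\times\}$, and $\|f\|=|f^{-1}(\times)|$. For $f,f'\in\mathcal{F}_q(X)$ write $f'\preceq f$ if for all $x\in X$ either $f(x)=f'(x)$ or $f(x)=\times$. An instance of $(q,r)$-CSP-with-Wildcard is a triple $(\mathcal{V},\mathcal{C},\mathrm{cost})$ where $\mathcal{V}$ is a finite set of variables with domain $[q]\cup\{\times\}$, $\mathcal{C}$ is a multiset of subsets of $\mathcal{V}$ each of size at most $r$, and $\mathrm{cost}$ assigns to each pair $(C,f)$ with $C\in\mathcal{C}$, $f\in\mathcal{F}_q(C)$ a non-negative integer, satisfying the wildcard property: for all $C\in\mathcal{C}$ and $f,f'\in\mathcal{F}_q(C)$ with $f'\preceq f$, $\mathrm{cost}(C,f)\le\mathrm{cost}(C,f')$. The task is to find $\varphi:\mathcal{V}\to[q]\cup\{\times\}$ minimizing $\|\varphi\|+\sum_{C\in\mathcal{C}}\mathrm{cost}(C,\varphi|_C)$. *)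

theory Defs
  imports Complex_Main "HOL-Library.Multiset" "HOL-Library.FuncSet"
begin

section \<open>CSP with wildcard\<close>

text \<open>The wildcard symbol is \<^term>\<open>None\<close>; the value $i \in [q]$ is \<open>Some i\<close>. Functions on a set
  \<open>X\<close> are extensional, so that they are determined by their values on \<open>X\<close>.\<close>

definition wvalues :: "nat \<Rightarrow> nat option set" where
  "wvalues q = insert None (Some ` {1..q})"

definition wfuns :: "nat \<Rightarrow> nat set \<Rightarrow> (nat \<Rightarrow> nat option) set" where
  "wfuns q X = (X \<rightarrow>\<^sub>E wvalues q)"

definition wnorm :: "nat set \<Rightarrow> (nat \<Rightarrow> nat option) \<Rightarrow> nat" where
  "wnorm X f = card {x \<in> X. f x = None}"

definition wle :: "nat set \<Rightarrow> (nat \<Rightarrow> nat option) \<Rightarrow> (nat \<Rightarrow> nat option) \<Rightarrow> bool" where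
  "wle X f' f \<longleftrightarrow> (\<forall>x\<in>X. f x = f' x \<or> f x = None)"

record wcsp =
  Vars :: "nat set"
  Constraints :: "nat set multiset"
  Cost :: "nat set \<Rightarrow> (nat \<Rightarrow> nat option) \<Rightarrow> nat"

definition wcsp_instance :: "nat \<Rightarrow> nat \<Rightarrow> wcsp \<Rightarrow> bool" where
  "wcsp_instance q r I \<longleftrightarrow>
     finite (Vars I) \<and>
     (\<forall>C \<in># Constraints I. C \<subseteq> Vars I \<and> card C \<le> r) \<and>
     (\<forall>C \<in># Constraints I. \<forall>f \<in> wfuns q C. \<forall>f' \<in> wfuns q C.
        wle C f' f \<longrightarrow> Cost I C f \<le> Cost I C f')"

definition total_cost :: "wcsp \<Rightarrow> (nat \<Rightarrow> nat option) \<Rightarrow> nat" where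
  "total_cost I \<phi> =
     wnorm (Vars I) \<phi> + (\<Sum>C \<in># Constraints I. Cost I C (restrict \<phi> C))"

definition optimal :: "nat \<Rightarrow> wcsp \<Rightarrow> (nat \<Rightarrow> nat option) \<Rightarrow> bool" where
  "optimal q I \<phi> \<longleftrightarrow>
     \<phi> \<in> wfuns q (Vars I) \<and> (\<forall>\<psi> \<in> wfuns q (Vars I). total_cost I \<phi> \<le> total_cost I \<psi>)"

section \<open>Word RAM\<close>

text \<open>A random access machine with registers and an indirectly addressed memory, programmed with
  structured control flow. The parameter \<open>W\<close> is the word bound ($2^w$ for word length $w$): every
  number computed must be below \<open>W\<close>. An expression that overflows has no value, and a program that
  evaluates it has no execution. Each node of an expression and each command costs one time unit.\<close>

datatype arith = Plus | Monus | Times | Quot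

fun arith_fun :: "arith \<Rightarrow> nat \<Rightarrow> nat \<Rightarrow> nat" where
  "arith_fun Plus a b = a + b"
| "arith_fun Monus a b = a - b"
| "arith_fun Times a b = a * b"
| "arith_fun Quot a b = a div b"

datatype expr = Num nat | Reg nat | Mem expr | Op arith expr expr

datatype prog =
    Skip
  | Assign nat expr
  | Store expr expr
  | Seq prog prog
  | Cond expr prog prog
  | While expr prog

record ram =
  regs :: "nat \<Rightarrow> nat"
  mem :: "nat \<Rightarrow> nat"

definition word :: "nat \<Rightarrow> nat \<Rightarrow> nat option" where
  "word W k = (if k < W then Some k else None)"

fun eval :: "nat \<Rightarrow> ram \<Rightarrow> expr \<Rightarrow> nat option" where
  "eval W s (Num k) = word W k"
| "eval W s (Reg x) = word W (regs s x)"
| "eval W s (Mem e) = Option.bind (eval W s e) (\<lambda>a. word W (mem s a))"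
| "eval W s (Op f e1 e2) =
     Option.bind (eval W s e1) (\<lambda>a. Option.bind (eval W s e2) (\<lambda>b. word W (arith_fun f a b)))"

fun etime :: "expr \<Rightarrow> nat" where
  "etime (Num k) = 1"
| "etime (Reg x) = 1"
| "etime (Mem e) = 1 + etime e"
| "etime (Op f e1 e2) = 1 + etime e1 + etime e2"

text \<open>\<open>exec W p s t s'\<close>: with word bound \<open>W\<close>, program \<open>p\<close> started in \<open>s\<close> halts in \<open>s'\<close> after
  exactly \<open>t\<close> time units. Tests succeed on nonzero values.\<close>

inductive exec :: "nat \<Rightarrow> prog \<Rightarrow> ram \<Rightarrow> nat \<Rightarrow> ram \<Rightarrow> bool" for W :: nat where
  Skip: "exec W Skip s 1 s"
| Assign: "eval W s e = Some v \<Longrightarrow>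
    exec W (Assign x e) s (1 + etime e) (s\<lparr>regs := (regs s)(x := v)\<rparr>)"
| Store: "eval W s e1 = Some a \<Longrightarrow> eval W s e2 = Some v \<Longrightarrow>
    exec W (Store e1 e2) s (1 + etime e1 + etime e2) (s\<lparr>mem := (mem s)(a := v)\<rparr>)"
| Seq: "exec W p1 s t1 s' \<Longrightarrow> exec W p2 s' t2 s'' \<Longrightarrow>
    exec W (Seq p1 p2) s (1 + t1 + t2) s''"
| CondTrue: "eval W s e = Some v \<Longrightarrow> v \<noteq> 0 \<Longrightarrow> exec W p1 s t s' \<Longrightarrow>
    exec W (Cond e p1 p2) s (1 + etime e + t) s'"
| CondFalse: "eval W s e = Some 0 \<Longrightarrow> exec W p2 s t s' \<Longrightarrow>
    exec W (Cond e p1 p2) s (1 + etime e + t) s'"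
| WhileFalse: "eval W s e = Some 0 \<Longrightarrow>
    exec W (While e p) s (1 + etime e) s"
| WhileTrue: "eval W s e = Some v \<Longrightarrow> v \<noteq> 0 \<Longrightarrow> exec W p s t1 s' \<Longrightarrow>
    exec W (While e p) s' t2 s'' \<Longrightarrow>
    exec W (While e p) s (1 + etime e + t1 + t2) s''"

inductive_cases exec_SkipE: "exec W Skip s t s'"
inductive_cases exec_AssignE: "exec W (Assign x e) s t s'"
inductive_cases exec_StoreE: "exec W (Store e1 e2) s t s'"
inductive_cases exec_SeqE: "exec W (Seq p1 p2) s t s'"
inductive_cases exec_CondE: "exec W (Cond e p1 p2) s t s'"
inductive_cases exec_WhileE: "exec W (While e p) s t s'"

lemma exec_deterministic:
  "exec W p s t s1 \<Longrightarrow> exec W p s u s2 \<Longrightarrow> t = u \<and> s1 = s2"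
proof (induction arbitrary: u s2 rule: exec.induct)
  case (Skip s) then show ?case by (auto elim: exec_SkipE)
next
  case (Assign s e v x) then show ?case by (auto elim!: exec_AssignE)
next
  case (Store s e1 a e2 v) then show ?case by (auto elim!: exec_StoreE)
next
  case (Seq p1 s t1 s' p2 t2 s'')
  obtain u1 r u2 where "u = Suc (u1 + u2)" "exec W p1 s u1 r" "exec W p2 r u2 s2"
    using Seq.prems by (rule exec_SeqE)
  then show ?case using Seq.IH(1)[of u1 r] Seq.IH(2)[of u2 s2] by simp
next
  case (CondTrue s e v p1 t s' p2)
  from CondTrue.prems obtain u1 where "u = Suc (etime e + u1)" "exec W p1 s u1 s2"
    by (rule exec_CondE) (use CondTrue.hyps in simp_all)
  then show ?case using CondTrue.IH[of u1 s2] by simp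
next
  case (CondFalse s e p2 t s' p1)
  from CondFalse.prems obtain u1 where "u = Suc (etime e + u1)" "exec W p2 s u1 s2"
    by (rule exec_CondE) (use CondFalse.hyps in simp_all)
  then show ?case using CondFalse.IH[of u1 s2] by simp
next
  case (WhileFalse s e p)
  from WhileFalse.prems show ?case by (rule exec_WhileE) (use WhileFalse.hyps in simp_all)
next
  case (WhileTrue s e v p t1 s' t2 s'')
  from WhileTrue.prems obtain u1 r u2 where
    "u = Suc (etime e + u1 + u2)" "exec W p s u1 r" "exec W (While e p) r u2 s2"
    by (rule exec_WhileE) (use WhileTrue.hyps in simp_all)
  then show ?case using WhileTrue.IH(1)[of u1 r] WhileTrue.IH(2)[of u2 s2] by simp
qed

section \<open>Input and output\<close>

text \<open>Lexicographic enumeration of the functions on the variables of a list, with the wildcard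
  as first value.\<close>

fun assignments :: "nat \<Rightarrow> nat list \<Rightarrow> (nat \<Rightarrow> nat option) list" where
  "assignments q [] = [\<lambda>_. undefined]"
| "assignments q (x # xs) =
     concat (map (\<lambda>a. map (\<lambda>f. f(x := a)) (assignments q xs)) (None # map Some [1..<Suc q]))"

lemma set_assignments: "distinct xs \<Longrightarrow> set (assignments q xs) = wfuns q (set xs)"
proof (induction xs)
  case Nil then show ?case by (simp add: wfuns_def)
next
  case (Cons x xs)
  have v: "set (None # map Some [1..<Suc q]) = wvalues q"
    by (auto simp: wvalues_def)
  have "set (assignments q (x # xs)) =
        (\<Union>a \<in> wvalues q. (\<lambda>f. f(x := a)) ` wfuns q (set xs))"
    using Cons by (simp only: assignments.simps set_concat set_map v[symmetric]) auto
  also have "\<dots> = wfuns q (set (x # xs))"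
    by (simp add: wfuns_def PiE_insert_eq) (force simp: image_iff)
  finally show ?case .
qed

text \<open>An instance is written as a list of words, given an enumeration \<open>vs\<close> of its variables and
  an enumeration \<open>cs\<close> of its distinct constraints. As the cost depends only on the set \<open>C\<close>, equal
  constraints are listed once, together with their multiplicity; thus the input consists of
  $n^{O(1)}$ words for fixed \<open>q\<close> and \<open>r\<close>, however large the multiplicities and costs are.\<close>

definition encode_constraint :: "nat \<Rightarrow> wcsp \<Rightarrow> nat list \<Rightarrow> nat set \<Rightarrow> nat list" where
  "encode_constraint q I vs C =
     (let ys = filter (\<lambda>v. v \<in> C) vs
      in [length ys, count (Constraints I) C] @ ys @ map (Cost I C) (assignments q ys))"

definition encode :: "nat \<Rightarrow> wcsp \<Rightarrow> nat list \<Rightarrow> nat set list \<Rightarrow> nat list" where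
  "encode q I vs cs =
     [length vs, length cs] @ vs @ concat (map (encode_constraint q I vs) cs)"

definition input_encoding :: "nat \<Rightarrow> wcsp \<Rightarrow> nat list \<Rightarrow> nat list \<Rightarrow> bool" where
  "input_encoding q I vs xs \<longleftrightarrow>
     distinct vs \<and> set vs = Vars I \<and>
     (\<exists>cs. distinct cs \<and> set cs = set_mset (Constraints I) \<and> xs = encode q I vs cs)"

definition initial :: "nat list \<Rightarrow> ram" where
  "initial xs = \<lparr>regs = (\<lambda>_. 0), mem = (\<lambda>i. if i < length xs then xs ! i else 0)\<rparr>"

text \<open>The word length is $O(n + \log M)$, where \<open>M\<close> is the largest input number, so that
  input numbers, and addresses into a memory of size $2^{O(n)}$, fit into a word.\<close>

definition word_bound :: "nat \<Rightarrow> nat \<Rightarrow> nat list \<Rightarrow> nat" where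
  "word_bound k n xs = (2 ^ n * (Max (set xs) + 2)) ^ k"

text \<open>On halting, cell \<open>i\<close> holds the value of the \<open>i\<close>-th variable, with 0 for the wildcard.\<close>

definition output_represents :: "nat list \<Rightarrow> ram \<Rightarrow> (nat \<Rightarrow> nat option) \<Rightarrow> bool" where
  "output_represents vs s \<phi> \<longleftrightarrow>
     (\<forall>i < length vs. mem s i = (case \<phi> (vs ! i) of None \<Rightarrow> 0 | Some a \<Rightarrow> a))"

definition solves_wcsp_in_time :: "prog \<Rightarrow> nat \<Rightarrow> nat \<Rightarrow> nat \<Rightarrow> (nat \<Rightarrow> real) \<Rightarrow> bool" where
  "solves_wcsp_in_time p k q r T \<longleftrightarrow>
     (\<forall>I vs xs. wcsp_instance q r I \<and> input_encoding q I vs xs \<longrightarrow>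
        (\<exists>t s \<phi>. exec (word_bound k (card (Vars I)) xs) p (initial xs) t s \<and>
                 real t \<le> T (card (Vars I)) \<and>
                 optimal q I \<phi> \<and> output_represents vs s \<phi>))"

end

theory Submission imports Defs begin

text \<open>Fix some variables and look at a constraint \<open>C\<close>. Enumerate the assignments of \<open>C\<close> that agree with
  the fixed values in the order of the cost table, in which the wildcard comes first. If their costs
  are not all equal, let \<open>f\<close> be the first one whose cost differs from that of the very first one.
  Turning some non-wildcard value of \<open>f\<close> on a free variable into a wildcard gives an earlier
  assignment, so by the wildcard property and by integrality this lowers the cost by at least 1,
  which pays for the wildcard. Hence \<open>f\<close> can be discarded, and branching on the \<open>u\<close> free variables of
  \<open>C\<close> yields at most \<open>(q + 1)\<^sup>u - 1\<close> children. If all constraints have constant cost, giving every free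
  variable the value 1 is optimal. The depth-first search that results visits at most
  \<open>b\<^sup>n (n + 1)\<close> nodes for \<open>b = ((q + 1)\<^sup>r - 1)\<^bsup>1/r\<^esup>\<close>, and it is carried out by a word RAM program
  with polynomial overhead per node and polynomially many memory cells.\<close>

section \<open>Cost tables\<close>

text \<open>Discarding \<open>f\<close> may lose optimal assignments, but never all of them: its
  wildcard version changes only a free variable, so it still extends the node, and on
  \<open>C\<close> it differs from \<open>f\<close>, so it lies below a kept child. Soundness is
  therefore stated for whole nodes: each assignment is matched or beaten by the best leaf or by some
  extension of a node on the stack. Taking the first differing assignment has two advantages. All
  earlier costs are known to be equal, so one pass with constant state finds it, without comparing
  pairs of assignments. And the wildcard version, being earlier, has that known cost. The factor
  \<open>n + 1\<close> is there because a branching may have a single child: for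
  \<open>q = r = 1\<close> the base is 1, and a bound on the number of leaves says nothing about the
  length of a path. Two obstacles shape the machine part. Costs and multiplicities are unbounded, so
  time is counted through the at most \<open>(n + 1)^r\<close> distinct constraints. And an overflow
  destroys the execution, so each evaluated expression carries the obligation to stay below the word
  bound; numbers built from the input do so through the largest input number.\<close>

definition cell_value :: "nat option \<Rightarrow> nat" where
  "cell_value a = (case a of None \<Rightarrow> 0 | Some x \<Rightarrow> x)"

lemma cell_value_simps [simp]: "cell_value None = 0" "cell_value (Some x) = x"
  by (simp_all add: cell_value_def)

lemma cell_value_le: "a \<in> wvalues q \<Longrightarrow> cell_value a \<le> q"
  by (auto simp: wvalues_def)

lemma decode_wvalues: "b \<le> q \<Longrightarrow> (if b = 0 then None else Some b) \<in> wvalues q"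
  by (auto simp: wvalues_def)

lemma card_wvalues: "card (wvalues q) = q + 1"
  by (simp add: wvalues_def card_insert_if card_image)

lemma nth_concat_uniform:
  "(\<And>y. length (g y) = k) \<Longrightarrow> e < length L * k \<Longrightarrow>
     concat (map g L) ! e = g (L ! (e div k)) ! (e mod k)"
proof (induction L arbitrary: e)
  case Nil
  then show ?case by simp
next
  case (Cons y L)
  have k: "k > 0" using Cons.prems(2) by (cases k) auto
  show ?case
  proof (cases "e < k")
    case True
    then show ?thesis using Cons.prems by (simp add: nth_append)
  next
    case False
    then have "concat (map g (y # L)) ! e = concat (map g L) ! (e - k)"
      using Cons.prems by (simp add: nth_append)
    also have "\<dots> = g (L ! ((e - k) div k)) ! ((e - k) mod k)"
      using Cons.prems False by (intro Cons.IH) auto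
    finally show ?thesis using False k by (simp add: le_div_geq le_mod_geq)
  qed
qed

lemma length_assignments: "length (assignments q xs) = (q + 1) ^ length xs"
  by (induction xs) (simp_all add: length_concat comp_def sum_list_triv)

lemma nth_assignments_Cons:
  assumes "e < (q + 1) ^ Suc (length xs)"
  shows "assignments q (x # xs) ! e =
    (assignments q xs ! (e mod (q + 1) ^ length xs))
      (x := (let d = e div (q + 1) ^ length xs in if d = 0 then None else Some d))"
proof -
  let ?k = "(q + 1) ^ length xs"
  let ?L = "None # map Some [1..<Suc q]"
  have "e div ?k < Suc q"
    using assms by (simp add: less_mult_imp_div_less)
  then have L: "?L ! (e div ?k) = (let d = e div ?k in if d = 0 then None else Some d)"
    by (cases "e div ?k") (auto simp: Let_def nth_append)
  have "assignments q (x # xs) ! e =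
      map (\<lambda>f. f(x := ?L ! (e div ?k))) (assignments q xs) ! (e mod ?k)"
    unfolding assignments.simps
    using assms
    by (subst nth_concat_uniform[where k = ?k]) (simp_all add: length_assignments del: upt_Suc)
  also have "\<dots> = (assignments q xs ! (e mod ?k)) (x := ?L ! (e div ?k))"
    by (simp add: length_assignments)
  finally show ?thesis by (simp only: L)
qed

text \<open>The enumeration is lexicographic with the wildcard as digit 0, so a position written in
  base \<open>q + 1\<close> spells out the assignment, the first variable being the most significant
  digit. This lets a program recover an assignment from its position by repeated division.\<close>

lemma cell_value_nth_assignments:
  assumes "distinct xs" "i < length xs" "e < (q + 1) ^ length xs"
  shows "cell_value ((assignments q xs ! e) (xs ! i)) = e div (q + 1) ^ (length xs - 1 - i) mod (q + 1)"
  using assms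
proof (induction xs arbitrary: e i)
  case Nil
  then show ?case by simp
next
  case (Cons x xs)
  let ?b = "q + 1" let ?k = "?b ^ length xs"
  note nth = nth_assignments_Cons[of e q xs x]
  have e: "e < ?b ^ Suc (length xs)" using Cons.prems by simp
  show ?case
  proof (cases i)
    case 0
    have "e div ?k < ?b" using e by (simp add: less_mult_imp_div_less)
    then show ?thesis using nth[OF e] 0 by (simp add: Let_def)
  next
    case (Suc i')
    let ?t = "length xs - 1 - i'"
    have i': "i' < length xs" "xs ! i' \<noteq> x" using Suc Cons.prems by auto
    \<comment> \<open>The block length \<open>?k\<close> is a multiple of
      \<open>?b ^ ?t * ?b\<close>, so reducing modulo \<open>?k\<close> removes the leading digit
      and leaves the wanted one alone.\<close>
    have k: "?k = ?b ^ ?t * (?b * ?b ^ i')"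
    proof -
      have "length xs = ?t + Suc i'" using i' by simp
      then have "?k = ?b ^ (?t + Suc i')" by metis
      then show ?thesis by (simp only: power_add power_Suc)
    qed
    have "cell_value ((assignments q (x # xs) ! e) ((x # xs) ! i)) = (e mod ?k) div ?b ^ ?t mod ?b"
      using nth[OF e] Suc i' Cons.prems by (simp add: Cons.IH)
    also have "\<dots> = e div ?b ^ ?t mod (?b * ?b ^ i') mod ?b"
      unfolding k mod_mult2_eq by simp
    also have "\<dots> = e div ?b ^ ?t mod ?b"
      by (rule mod_mod_cancel) (rule dvd_triv_left)
    finally show ?thesis using Suc by simp
  qed
qed

text \<open>A numeral grows with each of its digits. Hence replacing a value by the wildcard never
  leads to a later position, and using the bound both ways shows that positions are determined by
  their assignments.\<close>

lemma nth_assignments_mono: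
  assumes "distinct xs" "e < (q + 1) ^ length xs" "e' < (q + 1) ^ length xs"
    and "\<And>v. v \<in> set xs \<Longrightarrow> cell_value ((assignments q xs ! e) v) \<le> cell_value ((assignments q xs ! e') v)"
  shows "e \<le> e'"
  using assms
proof (induction xs arbitrary: e e')
  case Nil
  then show ?case by simp
next
  case (Cons x xs)
  let ?k = "(q + 1) ^ length xs"
  have e: "e < (q + 1) ^ Suc (length xs)" "e' < (q + 1) ^ Suc (length xs)"
    using Cons.prems by simp_all
  note nth = nth_assignments_Cons[OF e(1), of x] nth_assignments_Cons[OF e(2), of x]
  have "e mod ?k \<le> e' mod ?k"
  proof (rule Cons.IH)
    fix v assume v: "v \<in> set xs"
    then have "v \<noteq> x" using Cons.prems(1) by auto
    then show "cell_value ((assignments q xs ! (e mod ?k)) v) \<le> cell_value ((assignments q xs ! (e' mod ?k)) v)"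
      using Cons.prems(4)[of v] v unfolding nth by simp
  qed (use Cons.prems in auto)
  moreover have "e div ?k \<le> e' div ?k"
    using Cons.prems(4)[of x] unfolding nth by (simp add: Let_def split: if_splits)
  ultimately have "e div ?k * ?k + e mod ?k \<le> e' div ?k * ?k + e' mod ?k"
    by (intro add_mono mult_right_mono) auto
  then show ?case by (simp only: div_mult_mod_eq)
qed

text \<open>Links the objective, a sum over a multiset, to the input format, which lists distinct
  constraints with multiplicities.\<close>

lemma sum_mset_eq_sum_count:
  fixes f :: "'a \<Rightarrow> nat"
  shows "(\<Sum>x\<in>#M. f x) = (\<Sum>x\<in>set_mset M. count M x * f x)"
proof (induction M)
  case empty
  then show ?case by simp
next
  case (add y M)
  have "(\<Sum>x\<in>set_mset (add_mset y M). count (add_mset y M) x * f x) =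
        (\<Sum>x\<in>set_mset (add_mset y M). count M x * f x + (if x = y then f x else 0))"
    by (intro sum.cong) (auto simp: algebra_simps)
  also have "\<dots> = (\<Sum>x\<in>set_mset (add_mset y M). count M x * f x) + f y"
    by (subst sum.distrib) (simp add: sum.delta)
  also have "(\<Sum>x\<in>set_mset (add_mset y M). count M x * f x) = (\<Sum>x\<in>set_mset M. count M x * f x)"
    by (intro sum.mono_neutral_right) (auto simp: not_in_iff)
  finally show ?case using add by simp
qed

section \<open>Branching\<close>

locale wcsp_input =
  fixes q r :: nat and I :: wcsp and vs :: "nat list" and cs :: "nat set list"
  assumes q_pos: "q \<ge> 1" and inst: "wcsp_instance q r I"
    and distinct_vs: "distinct vs" and set_vs: "set vs = Vars I"
    and distinct_cs: "distinct cs" and set_cs: "set cs = set_mset (Constraints I)"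
begin

text \<open>A node of the search tree is a map from variables to numbers, where 0 is the wildcard and
  \<open>q + 1\<close> marks a free variable. The assignments of a constraint are referred to by their positions
  in the cost table.\<close>

definition scope :: "nat set \<Rightarrow> nat list" where
  "scope C = filter (\<lambda>v. v \<in> C) vs"

definition size_of :: "nat set \<Rightarrow> nat" where
  "size_of C = (q + 1) ^ length (scope C)"

definition entry :: "nat set \<Rightarrow> nat \<Rightarrow> nat \<Rightarrow> nat option" where
  "entry C e = assignments q (scope C) ! e"

definition consistent :: "(nat \<Rightarrow> nat) \<Rightarrow> nat set \<Rightarrow> nat \<Rightarrow> bool" where
  "consistent a C e \<longleftrightarrow> (\<forall>v\<in>C. a v = q + 1 \<or> a v = cell_value (entry C e v))"

definition refine :: "(nat \<Rightarrow> nat) \<Rightarrow> nat set \<Rightarrow> nat \<Rightarrow> nat \<Rightarrow> nat" where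
  "refine a C e = (\<lambda>v. if v \<in> C then cell_value (entry C e v) else a v)"

definition valid :: "(nat \<Rightarrow> nat) \<Rightarrow> bool" where
  "valid a \<longleftrightarrow> (\<forall>v\<in>Vars I. a v \<le> q + 1)"

definition free :: "(nat \<Rightarrow> nat) \<Rightarrow> nat set" where
  "free a = {v \<in> Vars I. a v = q + 1}"

definition extends :: "(nat \<Rightarrow> nat) \<Rightarrow> (nat \<Rightarrow> nat option) \<Rightarrow> bool" where
  "extends a \<phi> \<longleftrightarrow> (\<forall>v\<in>Vars I. a v = q + 1 \<or> a v = cell_value (\<phi> v))"

text \<open>The components of a scan result are one more than the cost of the first consistent entry (0 if
  there is none yet), whether an entry has been discarded, and the children.\<close>

fun scan_step :: "(nat \<Rightarrow> nat) \<Rightarrow> nat set \<Rightarrow> nat \<Rightarrow> nat \<times> bool \<times> (nat \<Rightarrow> nat) list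
    \<Rightarrow> nat \<times> bool \<times> (nat \<Rightarrow> nat) list" where
  "scan_step a C e (c0, fd, ks) =
     (if consistent a C e then
        if c0 \<noteq> 0 \<and> \<not> fd \<and> Suc (Cost I C (entry C e)) \<noteq> c0 then (c0, True, ks)
        else (if c0 = 0 then Suc (Cost I C (entry C e)) else c0, fd, ks @ [refine a C e])
      else (c0, fd, ks))"

primrec scan :: "(nat \<Rightarrow> nat) \<Rightarrow> nat set \<Rightarrow> nat \<Rightarrow> nat \<times> bool \<times> (nat \<Rightarrow> nat) list" where
  "scan a C 0 = (0, False, [])"
| "scan a C (Suc e) = scan_step a C e (scan a C e)"

text \<open>The first constraint of non-constant cost supplies the children and stops the search.
  Until then \<open>acc\<close> gathers the constant costs, weighted by multiplicity, so a leaf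
  needs no second pass; \<open>c0 - 1\<close> undoes the shift by one in scan results.\<close>

fun expand_step :: "(nat \<Rightarrow> nat) \<Rightarrow> nat set \<Rightarrow> nat \<times> bool \<times> (nat \<Rightarrow> nat) list
    \<Rightarrow> nat \<times> bool \<times> (nat \<Rightarrow> nat) list" where
  "expand_step a C (acc, fd, ks) =
     (if fd then (acc, fd, ks)
      else case scan a C (size_of C) of (c0, fd', ks') \<Rightarrow>
        if fd' then (acc, True, ks')
        else (acc + count (Constraints I) C * (c0 - 1), False, []))"

primrec expand :: "(nat \<Rightarrow> nat) \<Rightarrow> nat \<Rightarrow> nat \<times> bool \<times> (nat \<Rightarrow> nat) list" where
  "expand a 0 = (0, False, [])"
| "expand a (Suc j) = expand_step a (cs ! j) (expand a j)"

section \<open>Elementary facts on instances and table positions\<close>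

lemma finite_Vars [simp]: "finite (Vars I)"
  using inst by (simp add: wcsp_instance_def)

lemma constraint_subset: "C \<in># Constraints I \<Longrightarrow> C \<subseteq> Vars I"
  using inst by (simp add: wcsp_instance_def)

lemma constraint_card: "C \<in># Constraints I \<Longrightarrow> card C \<le> r"
  using inst by (simp add: wcsp_instance_def)

lemma constraint_mono:
  "C \<in># Constraints I \<Longrightarrow> f \<in> wfuns q C \<Longrightarrow> f' \<in> wfuns q C \<Longrightarrow> wle C f' f \<Longrightarrow> Cost I C f \<le> Cost I C f'"
  using inst by (simp add: wcsp_instance_def)

lemma distinct_scope [simp]: "distinct (scope C)"
  using distinct_vs by (simp add: scope_def)

lemma set_scope: "C \<in># Constraints I \<Longrightarrow> set (scope C) = C"
  using constraint_subset[of C] by (auto simp: scope_def set_vs)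

lemma length_scope: "C \<in># Constraints I \<Longrightarrow> length (scope C) = card C"
  using distinct_card[OF distinct_scope, of C] by (simp add: set_scope)

lemma length_scope_le: "C \<in># Constraints I \<Longrightarrow> length (scope C) \<le> r"
  by (simp add: length_scope constraint_card)

lemma entry_in_wfuns: "C \<in># Constraints I \<Longrightarrow> e < size_of C \<Longrightarrow> entry C e \<in> wfuns q C"
  using set_assignments[OF distinct_scope, of q C] nth_mem[of e "assignments q (scope C)"]
  by (simp add: entry_def size_of_def length_assignments set_scope)

lemma entry_surj:
  assumes "C \<in># Constraints I" "f \<in> wfuns q C"
  obtains e where "e < size_of C" "entry C e = f"
proof -
  have "f \<in> set (assignments q (scope C))"
    using assms by (simp add: set_assignments set_scope)
  then show ?thesis
    using that by (auto simp: in_set_conv_nth length_assignments entry_def size_of_def)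
qed

lemma entry_mono:
  assumes "C \<in># Constraints I" "e < size_of C" "e' < size_of C"
    and "\<And>v. v \<in> C \<Longrightarrow> cell_value (entry C e v) \<le> cell_value (entry C e' v)"
  shows "e \<le> e'"
  using nth_assignments_mono[OF distinct_scope, of e q C e'] assms
  by (simp add: set_scope entry_def size_of_def)

section \<open>Scanning the cost table of one constraint\<close>

lemma entry_inj:
  assumes "C \<in># Constraints I" "e < size_of C" "e' < size_of C" "entry C e = entry C e'"
  shows "e = e'"
  using entry_mono[OF assms(1-3)] entry_mono[OF assms(1,3,2)] assms(4) by simp

lemma entry_cell_value_le:
  assumes "C \<in># Constraints I" "e < size_of C" "v \<in> C"
  shows "entry C e v \<in> wvalues q" "cell_value (entry C e v) \<le> q"
  using entry_in_wfuns[OF assms(1,2)] assms(3) cell_value_le by (auto simp: wfuns_def)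

text \<open>At most one entry is ever discarded, because after the first discard costs are no longer
  compared. The two facts kept about the discarded \<open>x\<close> are those needed to justify it:
  some consistent entry \<open>e1\<close> precedes it, and all consistent entries before it share
  the cost \<open>c0 - 1\<close>.\<close>

lemma scan_invariant:
  fixes a C e
  defines "L \<equiv> filter (consistent a C) [0..<e]"
  shows "case scan a C e of (c0, fd, ks) \<Rightarrow>
    (c0 = 0 \<longleftrightarrow> L = []) \<and>
    (\<not> fd \<longrightarrow> ks = map (refine a C) L \<and> (\<forall>e'\<in>set L. Suc (Cost I C (entry C e')) = c0)) \<and>
    (fd \<longrightarrow> (\<exists>x\<in>set L. ks = map (refine a C) (filter (\<lambda>e'. e' \<noteq> x) L) \<and>
       Suc (Cost I C (entry C x)) \<noteq> c0 \<and>
       (\<exists>e1\<in>set L. e1 < x) \<and>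
       (\<forall>e'\<in>set L. e' < x \<longrightarrow> Suc (Cost I C (entry C e')) = c0)))"
  unfolding L_def
proof (induction e)
  case 0
  then show ?case by simp
next
  case (Suc e)
  obtain c0 fd ks where s: "scan a C e = (c0, fd, ks)" by (cases "scan a C e") auto
  let ?L = "filter (consistent a C) [0..<e]"
  have lt: "\<forall>e'\<in>set ?L. e' < e" by auto
  note IH = Suc[unfolded s prod.case]
  show ?case
  proof (cases "consistent a C e")
    case False
    then show ?thesis using IH by (simp add: s)
  next
    case c: True
    show ?thesis
    proof (cases "c0 \<noteq> 0 \<and> \<not> fd \<and> Suc (Cost I C (entry C e)) \<noteq> c0")
      case True
      then have "?L \<noteq> []" using IH by auto
      then obtain e1 where e1: "e1 \<in> set ?L" by (cases ?L) auto
      have "filter (\<lambda>e'. e' \<noteq> e) ?L = ?L" by (rule filter_True) auto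
      have "\<exists>x\<in>set (?L @ [e]). ks = map (refine a C) (filter (\<lambda>e'. e' \<noteq> x) (?L @ [e])) \<and>
          Suc (Cost I C (entry C x)) \<noteq> c0 \<and> (\<exists>e1\<in>set (?L @ [e]). e1 < x) \<and>
          (\<forall>e'\<in>set (?L @ [e]). e' < x \<longrightarrow> Suc (Cost I C (entry C e')) = c0)"
      proof (rule bexI[of _ e], intro conjI)
        show "ks = map (refine a C) (filter (\<lambda>e'. e' \<noteq> e) (?L @ [e]))"
          using True IH \<open>filter (\<lambda>e'. e' \<noteq> e) ?L = ?L\<close> by simp
        show "\<exists>e1\<in>set (?L @ [e]). e1 < e"
        proof (rule bexI[of _ e1])
          show "e1 < e" using e1 lt by blast
          show "e1 \<in> set (?L @ [e])" using e1 by simp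
        qed
        have "\<forall>e'\<in>set ?L. Suc (Cost I C (entry C e')) = c0" using True IH by blast
        then show "\<forall>e'\<in>set (?L @ [e]). e' < e \<longrightarrow> Suc (Cost I C (entry C e')) = c0" by simp
      qed (use True in simp_all)
      then show ?thesis
        using True c by (simp add: s)
    next
      case f: False
      show ?thesis
      proof (cases fd)
        case True
        from IH True obtain x where x: "x\<in>set ?L" "ks = map (refine a C) (filter (\<lambda>e'. e' \<noteq> x) ?L)"
          "Suc (Cost I C (entry C x)) \<noteq> c0" "\<exists>e1\<in>set ?L. e1 < x"
          "\<forall>e'\<in>set ?L. e' < x \<longrightarrow> Suc (Cost I C (entry C e')) = c0"
          by blast
        have "x < e" "c0 \<noteq> 0" using x(1) IH by auto
        have "\<exists>x\<in>set (?L @ [e]). ks @ [refine a C e] = map (refine a C) (filter (\<lambda>e'. e' \<noteq> x) (?L @ [e])) \<and>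
          Suc (Cost I C (entry C x)) \<noteq> c0 \<and> (\<exists>e1\<in>set (?L @ [e]). e1 < x) \<and>
          (\<forall>e'\<in>set (?L @ [e]). e' < x \<longrightarrow> Suc (Cost I C (entry C e')) = c0)"
        proof (rule bexI[of _ x], intro conjI)
          show "\<exists>e1\<in>set (?L @ [e]). e1 < x" using x(4) by (simp add: bex_Un)
        qed (use x \<open>x < e\<close> in simp_all)
        then show ?thesis using True c \<open>c0 \<noteq> 0\<close> by (simp add: s)
      next
        case False
        then show ?thesis using f c IH by (auto simp: s)
      qed
    qed
  qed
qed

lemma scan_trivial:
  assumes C: "C \<in># Constraints I" and "valid a"
    and s: "scan a C (size_of C) = (c0, False, ks)" and f: "f \<in> wfuns q C"
    and ext: "\<And>v. v \<in> C \<Longrightarrow> a v = q + 1 \<or> a v = cell_value (f v)"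
  shows "Suc (Cost I C f) = c0"
proof -
  obtain e where e: "e < size_of C" "entry C e = f" using entry_surj[OF C f] .
  then have "e \<in> set (filter (consistent a C) [0..<size_of C])"
    using ext by (auto simp: consistent_def)
  then show ?thesis using scan_invariant[of a C "size_of C"] e unfolding s by auto
qed

lemma scan_branch:
  assumes C: "C \<in># Constraints I" and "valid a"
    and s: "scan a C (size_of C) = (c0, True, ks)"
  obtains x v where "x < size_of C" "consistent a C x"
    "ks = map (refine a C) (filter (\<lambda>e. consistent a C e \<and> e \<noteq> x) [0..<size_of C])"
    "v \<in> C" "a v = q + 1" "Cost I C ((entry C x)(v := None)) < Cost I C (entry C x)"
proof -
  let ?L = "filter (consistent a C) [0..<size_of C]"
  from scan_invariant[of a C "size_of C"] obtain x e1 where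
    x: "x \<in> set ?L" "ks = map (refine a C) (filter (\<lambda>e'. e' \<noteq> x) ?L)"
    and cx: "Suc (Cost I C (entry C x)) \<noteq> c0" and e1: "e1 \<in> set ?L" "e1 < x"
    and min: "\<And>e'. e' \<in> set ?L \<Longrightarrow> e' < x \<Longrightarrow> Suc (Cost I C (entry C e')) = c0"
    unfolding s by auto
  have xs: "x < size_of C" "consistent a C x" and e1s: "e1 < size_of C" "consistent a C e1"
    using x e1 by auto
  have "\<exists>v\<in>C. a v = q + 1 \<and> entry C x v \<noteq> None"
  proof (rule ccontr)
    assume no: "\<not> ?thesis"
    \<comment> \<open>On fixed variables both entries agree. If \<open>x\<close> had wildcards on
      all free ones, it would be pointwise minimal among the consistent entries and could not come
      after \<open>e1\<close>.\<close>
    have "x \<le> e1"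
    proof (rule entry_mono[OF C xs(1) e1s(1)])
      fix v assume "v \<in> C"
      then show "cell_value (entry C x v) \<le> cell_value (entry C e1 v)"
        using no xs(2) e1s(2) unfolding consistent_def by (metis cell_value_simps(1) le0 order_refl)
    qed
    then show False using e1 by simp
  qed
  then obtain v where v: "v \<in> C" "a v = q + 1" "entry C x v \<noteq> None" by blast
  let ?f = "entry C x" let ?g = "?f(v := None)"
  have fw: "?f \<in> wfuns q C" using entry_in_wfuns[OF C xs(1)] .
  then have gw: "?g \<in> wfuns q C"
    using v(1) by (auto simp: wfuns_def wvalues_def PiE_iff extensional_def)
  then obtain e where e: "e < size_of C" "entry C e = ?g" using entry_surj[OF C] by metis
  \<comment> \<open>The wildcard is coded by 0, so \<open>?g\<close> lies pointwise below
    \<open>?f\<close>.\<close>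
  have "e \<le> x" by (rule entry_mono[OF C e(1) xs(1)]) (simp add: e)
  moreover have "e \<noteq> x" using e(2) v(3) by (metis fun_upd_same)
  moreover have "e \<in> set ?L" using e xs v by (auto simp: consistent_def)
  ultimately have "Suc (Cost I C ?g) = c0" using min[of e] e by simp
  moreover have "Cost I C ?g \<le> Cost I C ?f"
    by (rule constraint_mono[OF C gw fw]) (simp add: wle_def)
  ultimately have "Cost I C ?g < Cost I C ?f" using cx by linarith
  then show ?thesis using that[OF xs _ v(1,2)] x(2) by (simp add: conj_commute)
qed

text \<open>Decoding positions is a bijection onto a product of value sets in which a free variable
  contributes \<open>q + 1\<close> and a fixed one contributes 1. Only the free part of
  \<open>C\<close> therefore matters for the number of children.\<close>

lemma card_consistent:
  assumes C: "C \<in># Constraints I" and a: "valid a"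
  shows "card {e. e < size_of C \<and> consistent a C e} = (q + 1) ^ card (free a \<inter> C)"
proof -
  let ?S = "\<lambda>v. if a v = q + 1 then wvalues q else {b \<in> wvalues q. cell_value b = a v}"
  have fin: "finite C" using C constraint_subset finite_subset[OF _ finite_Vars] by blast
  have "bij_betw (entry C) {e. e < size_of C \<and> consistent a C e} (Pi\<^sub>E C ?S)"
    unfolding bij_betw_def
  proof
    show "inj_on (entry C) {e. e < size_of C \<and> consistent a C e}"
      using entry_inj[OF C] by (auto intro: inj_onI)
    show "entry C ` {e. e < size_of C \<and> consistent a C e} = Pi\<^sub>E C ?S"
    proof
      show "entry C ` {e. e < size_of C \<and> consistent a C e} \<subseteq> Pi\<^sub>E C ?S"
      proof (clarify)
        fix e assume e: "e < size_of C" "consistent a C e"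
        show "entry C e \<in> Pi\<^sub>E C ?S"
          using entry_in_wfuns[OF C e(1)] e(2) by (auto simp: wfuns_def PiE_iff consistent_def)
      qed
      show "Pi\<^sub>E C ?S \<subseteq> entry C ` {e. e < size_of C \<and> consistent a C e}"
      proof
        fix f assume f: "f \<in> Pi\<^sub>E C ?S"
        then have "f \<in> wfuns q C" by (auto simp: wfuns_def PiE_iff split: if_splits)
        then obtain e where "e < size_of C" "entry C e = f" using entry_surj[OF C] by metis
        moreover from this f have "consistent a C e"
          by (auto simp: consistent_def PiE_iff split: if_splits)
        ultimately show "f \<in> entry C ` {e. e < size_of C \<and> consistent a C e}" by blast
      qed
    qed
  qed
  then have "card {e. e < size_of C \<and> consistent a C e} = card (Pi\<^sub>E C ?S)"
    by (rule bij_betw_same_card)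
  also have "\<dots> = (\<Prod>v\<in>C. card (?S v))" by (rule card_PiE[OF fin])
  also have "\<dots> = (\<Prod>v\<in>C. if v \<in> free a then q + 1 else 1)"
  proof (rule prod.cong[OF refl])
    fix v assume v: "v \<in> C"
    then have vV: "v \<in> Vars I" using constraint_subset[OF C] by auto
    show "card (?S v) = (if v \<in> free a then q + 1 else 1)"
    proof (cases "a v = q + 1")
      case True
      then show ?thesis using vV by (simp add: free_def card_wvalues)
    next
      case False
      then have "a v \<le> q" using a vV by (auto simp: valid_def)
      \<comment> \<open>Proper values start at 1, so \<open>cell_value\<close> is injective on
        \<open>wvalues q\<close> and a fixed number has exactly one preimage.\<close>
      then have "{b \<in> wvalues q. cell_value b = a v} = {if a v = 0 then None else Some (a v)}"
        by (auto simp: wvalues_def)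
      then show ?thesis using False by (simp add: free_def)
    qed
  qed
  also have "\<dots> = (q + 1) ^ card (free a \<inter> C)"
    using fin by (simp add: prod.If_cases Int_commute)
  finally show ?thesis .
qed

lemma finite_free [simp]: "finite (free a)"
  by (simp add: free_def)

section \<open>The children of a node\<close>

lemma refine_valid:
  assumes "C \<in># Constraints I" "e < size_of C" "valid a"
  shows "valid (refine a C e)"
  using assms entry_cell_value_le(2)[OF assms(1,2)] by (fastforce simp: valid_def refine_def)

lemma free_refine:
  assumes "C \<in># Constraints I" "e < size_of C"
  shows "free (refine a C e) = free a - C"
proof -
  have "cell_value (entry C e v) \<noteq> q + 1" if "v \<in> C" for v
    using entry_cell_value_le(2)[OF assms that] by simp
  then show ?thesis by (auto simp: free_def refine_def)
qed

text \<open>The norm rises by at most 1, which the strict decrease of an integer cost at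
  \<open>C\<close> makes up for. No other constraint becomes more expensive, by the wildcard
  property.\<close>

lemma total_cost_wildcard_le:
  assumes C: "C \<in># Constraints I" and \<phi>: "\<phi> \<in> wfuns q (Vars I)" and v: "v \<in> C"
    and less: "Cost I C ((restrict \<phi> C)(v := None)) < Cost I C (restrict \<phi> C)"
  shows "total_cost I (\<phi>(v := None)) \<le> total_cost I \<phi>"
proof -
  let ?\<psi> = "\<phi>(v := None)"
  \<comment> \<open>Only one copy of \<open>C\<close> is split off. Its further copies stay in
    \<open>M\<close>, where it is enough that costs do not increase.\<close>
  obtain M where M: "Constraints I = add_mset C M" using C by (metis multi_member_split)
  have \<psi>: "?\<psi> \<in> wfuns q (Vars I)"
    using \<phi> v constraint_subset[OF C] by (auto simp: wfuns_def wvalues_def PiE_iff extensional_def)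
  have "(\<Sum>C\<in>#M. Cost I C (restrict ?\<psi> C)) \<le> (\<Sum>C\<in>#M. Cost I C (restrict \<phi> C))"
  proof (rule sum_mset_mono)
    fix D assume "D \<in># M"
    then have D: "D \<in># Constraints I" by (simp add: M)
    note sub = constraint_subset[OF D]
    show "Cost I D (restrict ?\<psi> D) \<le> Cost I D (restrict \<phi> D)"
      using \<phi> \<psi> sub
      by (intro constraint_mono[OF D]) (auto simp: wfuns_def wle_def PiE_iff wvalues_def)
  qed
  moreover have "restrict ?\<psi> C = (restrict \<phi> C)(v := None)" using v by auto
  moreover have "wnorm (Vars I) ?\<psi> \<le> Suc (wnorm (Vars I) \<phi>)"
  proof -
    have "{x \<in> Vars I. ?\<psi> x = None} \<subseteq> insert v {x \<in> Vars I. \<phi> x = None}" by auto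
    then have "wnorm (Vars I) ?\<psi> \<le> card (insert v {x \<in> Vars I. \<phi> x = None})"
      unfolding wnorm_def by (intro card_mono) auto
    also have "\<dots> \<le> Suc (wnorm (Vars I) \<phi>)"
      unfolding wnorm_def by (simp add: card_insert_if)
    finally show ?thesis .
  qed
  ultimately show ?thesis using less by (simp add: total_cost_def M)
qed

lemma scan_children:
  assumes C: "C \<in># Constraints I" and a: "valid a"
    and s: "scan a C (size_of C) = (c0, True, ks)"
  shows "\<And>b. b \<in> set ks \<Longrightarrow> valid b \<and> free b = free a - C"
    and "free a \<inter> C \<noteq> {}"
    and "length ks < (q + 1) ^ card (free a \<inter> C)"
    and "\<And>\<phi>. \<phi> \<in> wfuns q (Vars I) \<Longrightarrow> extends a \<phi> \<Longrightarrow>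
       \<exists>b\<in>set ks. \<exists>\<psi>\<in>wfuns q (Vars I). extends b \<psi> \<and> total_cost I \<psi> \<le> total_cost I \<phi>"
proof -
  obtain x v where x: "x < size_of C" "consistent a C x"
    and ks: "ks = map (refine a C) (filter (\<lambda>e. consistent a C e \<and> e \<noteq> x) [0..<size_of C])"
    and v: "v \<in> C" "a v = q + 1" and less: "Cost I C ((entry C x)(v := None)) < Cost I C (entry C x)"
    using scan_branch[OF assms] .
  have sub: "C \<subseteq> Vars I" using constraint_subset[OF C] .
  show "valid b \<and> free b = free a - C" if "b \<in> set ks" for b
    using that refine_valid[OF C _ a] free_refine[OF C] by (auto simp: ks)
  show "free a \<inter> C \<noteq> {}" using v sub by (auto simp: free_def)
  have "length ks = card (set (filter (\<lambda>e. consistent a C e \<and> e \<noteq> x) [0..<size_of C]))"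
    by (simp only: ks length_map, subst distinct_card) simp_all
  also have "\<dots> < card {e. e < size_of C \<and> consistent a C e}"
    using x by (intro psubset_card_mono) auto
  finally show "length ks < (q + 1) ^ card (free a \<inter> C)" using card_consistent[OF C a] by simp
  \<comment> \<open>An extension that avoids the discarded entry survives in the child that refines
    the node by its own restriction to \<open>C\<close>.\<close>
  have kid: "\<exists>b\<in>set ks. extends b \<psi>"
    if \<psi>: "\<psi> \<in> wfuns q (Vars I)" "extends a \<psi>" "restrict \<psi> C \<noteq> entry C x" for \<psi>
  proof -
    have "restrict \<psi> C \<in> wfuns q C" using \<psi> sub by (auto simp: wfuns_def PiE_iff)
    then obtain e where e: "e < size_of C" "entry C e = restrict \<psi> C" using entry_surj[OF C] by metis
    have "consistent a C e" using \<psi> sub e by (auto simp: consistent_def extends_def)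
    moreover have "e \<noteq> x" using e \<psi> by auto
    moreover have "extends (refine a C e) \<psi>" using \<psi>(2) e by (auto simp: extends_def refine_def)
    ultimately show ?thesis using e by (auto simp: ks)
  qed
  show "\<exists>b\<in>set ks. \<exists>\<psi>\<in>wfuns q (Vars I). extends b \<psi> \<and> total_cost I \<psi> \<le> total_cost I \<phi>"
    if \<phi>: "\<phi> \<in> wfuns q (Vars I)" "extends a \<phi>" for \<phi>
  proof (cases "restrict \<phi> C = entry C x")
    case False
    then show ?thesis using kid[OF \<phi>] \<phi> by blast
  next
    case True
    let ?\<psi> = "\<phi>(v := None)"
    have "?\<psi> \<in> wfuns q (Vars I)"
      using \<phi> v sub by (auto simp: wfuns_def wvalues_def PiE_iff extensional_def)
    \<comment> \<open>The variable \<open>v\<close> is free in \<open>a\<close>, so changing its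
      value keeps an extension of the node.\<close>
    moreover have "extends a ?\<psi>" using \<phi> v by (auto simp: extends_def)
    moreover have "restrict ?\<psi> C \<noteq> entry C x"
    proof
      assume "restrict ?\<psi> C = entry C x"
      then have "(entry C x)(v := None) = entry C x" using v by (metis fun_upd_idem fun_upd_same restrict_apply')
      then show False using less by simp
    qed
    moreover have "total_cost I ?\<psi> \<le> total_cost I \<phi>"
      by (rule total_cost_wildcard_le[OF C \<phi>(1) v(1)]) (simp add: True less)
    ultimately show ?thesis using kid[of ?\<psi>] by blast
  qed
qed

section \<open>Expanding a node and the cost of a leaf\<close>

lemma cs_constraint: "j < length cs \<Longrightarrow> cs ! j \<in># Constraints I"
  using set_cs nth_mem by blast

text \<open>The right-hand side mentions \<open>\<phi>\<close>, the left-hand side does not: at a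
  leaf all extensions pay the same for the constraints and can differ only in their number of
  wildcards.\<close>

lemma expand_leaf:
  assumes a: "valid a" and "j \<le> length cs" "expand a j = (acc, False, ks)"
    and \<phi>: "\<phi> \<in> wfuns q (Vars I)" "extends a \<phi>"
  shows "acc = (\<Sum>i<j. count (Constraints I) (cs ! i) * Cost I (cs ! i) (restrict \<phi> (cs ! i)))"
  using assms(2,3)
proof (induction j arbitrary: acc ks)
  case 0
  then show ?case by simp
next
  case (Suc j)
  obtain acc' fd' ks' where e: "expand a j = (acc', fd', ks')" by (cases "expand a j") auto
  obtain c0 fd ks'' where s: "scan a (cs ! j) (size_of (cs ! j)) = (c0, fd, ks'')"
    by (cases "scan a (cs ! j) (size_of (cs ! j))") auto
  have C: "cs ! j \<in># Constraints I" using Suc.prems by (intro cs_constraint) simp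
  note sub = constraint_subset[OF C]
  have fd: "\<not> fd'" "\<not> fd" and acc: "acc = acc' + count (Constraints I) (cs ! j) * (c0 - 1)"
    using Suc.prems(2) by (auto simp: e s split: if_splits)
  have "Suc (Cost I (cs ! j) (restrict \<phi> (cs ! j))) = c0"
    using s fd \<phi> sub by (intro scan_trivial[OF C a]) (auto simp: wfuns_def PiE_iff extends_def)
  moreover have "acc' = (\<Sum>i<j. count (Constraints I) (cs ! i) * Cost I (cs ! i) (restrict \<phi> (cs ! i)))"
    using Suc.IH[of acc' ks'] Suc_leD[OF Suc.prems(1)] e fd(1) by (simp del: restrict_apply)
  ultimately show ?case using acc by (auto simp del: restrict_apply)
qed

lemma expand_branch:
  assumes "expand a j = (acc, True, ks)" "j \<le> length cs"
  shows "\<exists>C c0. C \<in># Constraints I \<and> scan a C (size_of C) = (c0, True, ks)"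
  using assms
proof (induction j arbitrary: acc ks)
  case 0
  then show ?case by simp
next
  case (Suc j)
  obtain acc' fd' ks' where e: "expand a j = (acc', fd', ks')" by (cases "expand a j") auto
  show ?case
  proof (cases fd')
    case True
    then show ?thesis using Suc e by simp
  next
    case False
    then show ?thesis using Suc.prems e cs_constraint[of j]
      by (auto split: prod.splits if_splits)
  qed
qed

lemma total_cost_eq:
  "total_cost I \<phi> = wnorm (Vars I) \<phi> +
     (\<Sum>i<length cs. count (Constraints I) (cs ! i) * Cost I (cs ! i) (restrict \<phi> (cs ! i)))"
proof -
  have "(\<Sum>C\<in>set cs. count (Constraints I) C * Cost I C (restrict \<phi> C)) =
    (\<Sum>i<length cs. count (Constraints I) (cs ! i) * Cost I (cs ! i) (restrict \<phi> (cs ! i)))"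
    using sum.reindex_bij_betw[OF bij_betw_nth[OF distinct_cs refl refl],
        of "\<lambda>C. count (Constraints I) C * Cost I C (restrict \<phi> C)"] by simp
  then show ?thesis by (simp add: total_cost_def sum_mset_eq_sum_count set_cs)
qed

definition fill :: "(nat \<Rightarrow> nat) \<Rightarrow> nat \<Rightarrow> nat option" where
  "fill a = (\<lambda>v\<in>Vars I. if a v = q + 1 then Some 1 else if a v = 0 then None else Some (a v))"

lemma fill_wfuns: "valid a \<Longrightarrow> fill a \<in> wfuns q (Vars I)"
proof -
  assume "valid a"
  then have le: "a v = q + 1 \<or> a v \<le> q" if "v \<in> Vars I" for v
    using that by (auto simp: valid_def le_Suc_eq)
  have "fill a v \<in> wvalues q" if "v \<in> Vars I" for v
    using that le[OF that] decode_wvalues[of "a v" q] decode_wvalues[of 1 q] q_pos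
    unfolding fill_def by (cases "a v = q + 1") simp_all
  then show ?thesis by (simp add: wfuns_def PiE_iff fill_def)
qed

lemma extends_fill: "extends a (fill a)"
  by (auto simp: fill_def extends_def)

text \<open>With the constraint costs constant, only wildcards count. Those already fixed in
  \<open>a\<close> occur in every extension, and \<open>fill\<close> adds none to them.\<close>

lemma leaf_cost:
  assumes "valid a" "expand a (length cs) = (acc, False, ks)"
  shows "total_cost I (fill a) = acc + card {v \<in> Vars I. a v = 0}"
    and "\<And>\<phi>. \<phi> \<in> wfuns q (Vars I) \<Longrightarrow> extends a \<phi> \<Longrightarrow> total_cost I (fill a) \<le> total_cost I \<phi>"
proof -
  have n: "wnorm (Vars I) (fill a) = card {v \<in> Vars I. a v = 0}"
    unfolding wnorm_def by (rule arg_cong[of _ _ card]) (auto simp: fill_def)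
  show *: "total_cost I (fill a) = acc + card {v \<in> Vars I. a v = 0}"
    using expand_leaf[OF assms(1) le_refl assms(2) fill_wfuns[OF assms(1)] extends_fill]
    by (simp add: total_cost_eq n)
  show "total_cost I (fill a) \<le> total_cost I \<phi>"
    if \<phi>: "\<phi> \<in> wfuns q (Vars I)" "extends a \<phi>" for \<phi>
  proof -
    have "{v \<in> Vars I. a v = 0} \<subseteq> {v \<in> Vars I. \<phi> v = None}"
    proof
      fix v assume v: "v \<in> {v \<in> Vars I. a v = 0}"
      then have "cell_value (\<phi> v) = 0" "\<phi> v \<in> wvalues q" using \<phi> by (auto simp: extends_def wfuns_def)
      then show "v \<in> {v \<in> Vars I. \<phi> v = None}" using v by (auto simp: wvalues_def)
    qed
    then have "card {v \<in> Vars I. a v = 0} \<le> wnorm (Vars I) \<phi>"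
      unfolding wnorm_def by (intro card_mono) auto
    then show ?thesis
      unfolding * using expand_leaf[OF assms(1) le_refl assms(2) \<phi>] by (simp add: total_cost_eq)
  qed
qed

section \<open>The invariant of the depth-first search\<close>

text \<open>\<open>bc\<close> is one more than the cost of the best known assignment \<open>b\<close>, or 0 if none is known yet. The
  bound on the position of a node in the stack limits the memory that is used.\<close>

definition search_inv :: "(nat \<Rightarrow> nat) list \<Rightarrow> nat \<Rightarrow> (nat \<Rightarrow> nat) \<Rightarrow> bool" where
  "search_inv st bc b \<longleftrightarrow>
     (\<forall>a\<in>set st. valid a) \<and>
     (\<forall>i<length st. i + card (free (st ! i)) * (q + 1) ^ r \<le> length vs * (q + 1) ^ r) \<and>
     (\<forall>\<phi>\<in>wfuns q (Vars I). bc \<noteq> 0 \<and> bc \<le> Suc (total_cost I \<phi>) \<or>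
        (\<exists>a\<in>set st. \<exists>\<psi>\<in>wfuns q (Vars I). extends a \<psi> \<and> total_cost I \<psi> \<le> total_cost I \<phi>)) \<and>
     (bc \<noteq> 0 \<longrightarrow> valid b \<and> bc = Suc (total_cost I (fill b)))"

lemma length_vs: "length vs = card (Vars I)"
  using distinct_card[OF distinct_vs] by (simp add: set_vs)

lemma card_free_le: "card (free a) \<le> length vs"
  unfolding length_vs free_def by (intro card_mono) auto

lemma search_inv_init:
  assumes "\<And>v. v \<in> Vars I \<Longrightarrow> a v = q + 1"
  shows "search_inv [a] 0 b"
  using assms card_free_le[of a] by (auto simp: search_inv_def valid_def extends_def)

lemma search_inv_final:
  assumes "search_inv [] bc b"
  shows "bc \<noteq> 0" "valid b" "optimal q I (fill b)"
proof -
  \<comment> \<open>The all-wildcard assignment is always available. As an empty stack cannot cover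
    it, some leaf must have been recorded.\<close>
  have "(\<lambda>v\<in>Vars I. None) \<in> wfuns q (Vars I)" by (simp add: wfuns_def wvalues_def)
  with assms show bc: "bc \<noteq> 0" by (auto simp: search_inv_def)
  then show v: "valid b" using assms by (simp add: search_inv_def)
  show "optimal q I (fill b)"
    using assms bc fill_wfuns[OF v] by (auto simp: search_inv_def optimal_def)
qed

lemma search_inv_leaf:
  assumes inv: "search_inv (st @ [a]) bc b" and ex: "expand a (length cs) = (acc, False, ks)"
  defines "c \<equiv> acc + card {v \<in> Vars I. a v = 0}"
  shows "if bc = 0 \<or> Suc c < bc then search_inv st (Suc c) a else search_inv st bc b"
proof -
  have a: "valid a" using inv by (simp add: search_inv_def)
  have c: "c = total_cost I (fill a)" using leaf_cost(1)[OF a ex] by (simp add: c_def)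
  note le = leaf_cost(2)[OF a ex, folded c]
  have pos: "\<forall>i<length st. i + card (free (st ! i)) * (q + 1) ^ r \<le> length vs * (q + 1) ^ r"
  proof (intro allI impI)
    fix i assume "i < length st"
    then show "i + card (free (st ! i)) * (q + 1) ^ r \<le> length vs * (q + 1) ^ r"
      using inv unfolding search_inv_def by (auto simp: nth_append dest!: spec[of _ i])
  qed
  have val: "\<forall>a\<in>set st. valid a" using inv by (simp add: search_inv_def)
  \<comment> \<open>Whatever was covered by the leaf \<open>a\<close> itself costs at least
    \<open>c\<close>. Both outcomes of the comparison with \<open>bc\<close> follow from this weaker
    form of coverage.\<close>
  have cover: "bc \<noteq> 0 \<and> bc \<le> Suc (total_cost I \<phi>) \<or> c \<le> total_cost I \<phi> \<or>
      (\<exists>a\<in>set st. \<exists>\<psi>\<in>wfuns q (Vars I). extends a \<psi> \<and> total_cost I \<psi> \<le> total_cost I \<phi>)"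
    if "\<phi> \<in> wfuns q (Vars I)" for \<phi>
  proof -
    from inv that have "bc \<noteq> 0 \<and> bc \<le> Suc (total_cost I \<phi>) \<or>
        (\<exists>a\<in>set (st @ [a]). \<exists>\<psi>\<in>wfuns q (Vars I). extends a \<psi> \<and> total_cost I \<psi> \<le> total_cost I \<phi>)"
      unfolding search_inv_def by blast
    then show ?thesis using le by (auto intro: order_trans)
  qed
  show ?thesis
  proof (cases "bc = 0 \<or> Suc c < bc")
    case True
    have "Suc c \<noteq> 0 \<and> Suc c \<le> Suc (total_cost I \<phi>) \<or>
      (\<exists>a\<in>set st. \<exists>\<psi>\<in>wfuns q (Vars I). extends a \<psi> \<and> total_cost I \<psi> \<le> total_cost I \<phi>)"
      if "\<phi> \<in> wfuns q (Vars I)" for \<phi> using cover[OF that] True by linarith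
    then show ?thesis using True pos val a c by (simp add: search_inv_def)
  next
    case False
    have "bc \<noteq> 0 \<and> bc \<le> Suc (total_cost I \<phi>) \<or>
      (\<exists>a\<in>set st. \<exists>\<psi>\<in>wfuns q (Vars I). extends a \<psi> \<and> total_cost I \<psi> \<le> total_cost I \<phi>)"
      if "\<phi> \<in> wfuns q (Vars I)" for \<phi> using cover[OF that] False by linarith
    moreover have "bc \<noteq> 0 \<longrightarrow> valid b \<and> bc = Suc (total_cost I (fill b))"
      using inv unfolding search_inv_def by blast
    ultimately show ?thesis using False pos val by (simp add: search_inv_def)
  qed
qed

text \<open>The position bound survives because each child has at least one free variable less than
  its parent. This releases \<open>(q + 1)^r\<close> positions, more than the number of children
  pushed. The second claim provides the data from which the potential is shown to decrease.\<close>

lemma search_inv_branch: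
  assumes inv: "search_inv (st @ [a]) bc b" and ex: "expand a (length cs) = (acc, True, ks)"
  shows "search_inv (st @ ks) bc b"
    and "\<exists>u\<ge>1. u \<le> r \<and> u \<le> card (free a) \<and> length ks < (q + 1) ^ u \<and>
           (\<forall>k\<in>set ks. card (free k) = card (free a) - u)"
proof -
  obtain C c0 where C: "C \<in># Constraints I" and s: "scan a C (size_of C) = (c0, True, ks)"
    using expand_branch[OF ex] by blast
  have a: "valid a" using inv by (simp add: search_inv_def)
  note ch = scan_children[OF C a s]
  define u where "u = card (free a \<inter> C)"
  have fin: "finite C" using constraint_subset[OF C] finite_subset finite_Vars by blast
  have u1: "u \<ge> 1" using ch(2) by (simp add: u_def Suc_le_eq card_gt_0_iff)
  have ur: "u \<le> r" using card_mono[OF fin, of "free a \<inter> C"] constraint_card[OF C] by (simp add: u_def)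
  have ua: "u \<le> card (free a)" unfolding u_def by (intro card_mono) auto
  have fk: "card (free k) = card (free a) - u" if "k \<in> set ks" for k
    using ch(1)[OF that] by (simp add: u_def card_Diff_subset_Int)
  have len: "length ks < (q + 1) ^ u" using ch(3) by (simp add: u_def)
  also have "\<dots> \<le> (q + 1) ^ r" using ur by (intro power_increasing) auto
  finally have lenD: "length ks < (q + 1) ^ r" .
  show "\<exists>u\<ge>1. u \<le> r \<and> u \<le> card (free a) \<and> length ks < (q + 1) ^ u \<and>
      (\<forall>k\<in>set ks. card (free k) = card (free a) - u)"
    using u1 ur ua len fk by blast
  have pos: "i + card (free ((st @ ks) ! i)) * (q + 1) ^ r \<le> length vs * (q + 1) ^ r"
    if i: "i < length (st @ ks)" for i
  proof (cases "i < length st")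
    case True
    then show ?thesis
      using inv unfolding search_inv_def by (auto simp: nth_append dest!: spec[of _ i])
  next
    case False
    then have "(st @ ks) ! i \<in> set ks" using i by (simp add: nth_append)
    then have "card (free ((st @ ks) ! i)) + 1 \<le> card (free a)" using fk u1 ua by auto
    then have "card (free ((st @ ks) ! i)) * (q + 1) ^ r + (q + 1) ^ r \<le> card (free a) * (q + 1) ^ r"
      by (metis add_mult_distrib mult_1 mult_le_mono1)
    moreover have "length st + card (free a) * (q + 1) ^ r \<le> length vs * (q + 1) ^ r"
      using inv unfolding search_inv_def by (auto dest!: spec[of _ "length st"])
    moreover have "i \<le> length st + (q + 1) ^ r" using i lenD by simp
    ultimately show ?thesis by linarith
  qed
  have cover: "bc \<noteq> 0 \<and> bc \<le> Suc (total_cost I \<phi>) \<or>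
      (\<exists>a\<in>set (st @ ks). \<exists>\<psi>\<in>wfuns q (Vars I). extends a \<psi> \<and> total_cost I \<psi> \<le> total_cost I \<phi>)"
    if "\<phi> \<in> wfuns q (Vars I)" for \<phi>
  proof -
    from inv that have "bc \<noteq> 0 \<and> bc \<le> Suc (total_cost I \<phi>) \<or>
        (\<exists>a\<in>set (st @ [a]). \<exists>\<psi>\<in>wfuns q (Vars I). extends a \<psi> \<and> total_cost I \<psi> \<le> total_cost I \<phi>)"
      unfolding search_inv_def by blast
    then consider "bc \<noteq> 0 \<and> bc \<le> Suc (total_cost I \<phi>)"
      | "\<exists>a\<in>set st. \<exists>\<psi>\<in>wfuns q (Vars I). extends a \<psi> \<and> total_cost I \<psi> \<le> total_cost I \<phi>"
      | \<psi> where "\<psi> \<in> wfuns q (Vars I)" "extends a \<psi>" "total_cost I \<psi> \<le> total_cost I \<phi>"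
      by auto
    then show ?thesis
    proof cases
      case 3
      from ch(4)[OF 3(1,2)] obtain k \<chi> where "k \<in> set ks" "\<chi> \<in> wfuns q (Vars I)" "extends k \<chi>"
        "total_cost I \<chi> \<le> total_cost I \<psi>" by blast
      with 3(3) show ?thesis by (intro disjI2 bexI[of _ k] bexI[of _ \<chi>]) auto
    qed auto
  qed
  show "search_inv (st @ ks) bc b"
    using inv pos cover ch(1) unfolding search_inv_def by auto
qed

end

section \<open>The base of the exponential bound\<close>

definition branch_base :: "nat \<Rightarrow> nat \<Rightarrow> real" where
  "branch_base q r = ((real q + 1) ^ r - 1) powr (1 / real r)"

lemma branch_base_ge_1:
  assumes "q \<ge> 1" "r \<ge> 1"
  shows "branch_base q r \<ge> 1"
proof -
  have "(real q + 1) ^ 1 \<le> (real q + 1) ^ r" using assms by (intro power_increasing) auto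
  then have "1 \<le> (real q + 1) ^ r - 1" using assms by simp
  then show ?thesis unfolding branch_base_def by (intro ge_one_powr_ge_zero) auto
qed

lemma branch_base_power:
  assumes "q \<ge> 1" "r \<ge> 1"
  shows "branch_base q r ^ k = ((real q + 1) ^ r - 1) powr (real k / real r)"
proof -
  have "branch_base q r > 0" using branch_base_ge_1[OF assms] by simp
  then have "branch_base q r ^ k = branch_base q r powr real k" by (simp add: powr_realpow)
  then show ?thesis by (simp add: branch_base_def powr_powr)
qed

text \<open>With \<open>a = q + 1\<close> this is \<open>(1 - a\<^sup>-\<^sup>u)\<^sup>r \<le> (1 - a\<^sup>-\<^sup>r)\<^sup>r \<le> (1 - a\<^sup>-\<^sup>r)\<^sup>u\<close>, so a branching on fewer than \<open>r\<close>
  free variables is at least as good as one on \<open>r\<close> of them.\<close>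

lemma branches_le_base_power:
  assumes "q \<ge> 1" "1 \<le> u" "u \<le> r"
  shows "(real q + 1) ^ u - 1 \<le> branch_base q r ^ u"
proof -
  let ?a = "real q + 1"
  have a: "?a > 1" using assms by simp
  have one: "1 \<le> ?a ^ k" for k using a by simp
  have split: "?a ^ k - 1 = ?a ^ k * (1 - (1 / ?a) ^ k)" for k
    using a by (simp add: right_diff_distrib power_one_over)
  have nn: "0 \<le> 1 - (1 / ?a) ^ k" for k
    using one[of k] by (simp add: power_one_over)
  have "(1 / ?a) ^ r \<le> (1 / ?a) ^ u" using a assms by (intro power_decreasing) auto
  then have "(1 - (1 / ?a) ^ u) ^ r \<le> (1 - (1 / ?a) ^ r) ^ r"
    using nn[of u] by (intro power_mono) auto
  also have "\<dots> \<le> (1 - (1 / ?a) ^ r) ^ u"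
    using nn[of r] a assms by (intro power_decreasing) auto
  finally have "?a ^ (u * r) * (1 - (1 / ?a) ^ u) ^ r \<le> ?a ^ (u * r) * (1 - (1 / ?a) ^ r) ^ u"
    using a by (intro mult_left_mono) simp_all
  then have "(?a ^ u) ^ r * (1 - (1 / ?a) ^ u) ^ r \<le> (?a ^ r) ^ u * (1 - (1 / ?a) ^ r) ^ u"
    by (metis power_mult mult.commute)
  then have "(?a ^ u - 1) ^ r \<le> (?a ^ r - 1) ^ u"
    unfolding split[of u] split[of r] power_mult_distrib .
  moreover have "(branch_base q r ^ u) ^ r = (?a ^ r - 1) ^ u"
  proof -
    have "branch_base q r ^ r = ?a ^ r - 1"
      using assms one[of r] a by (subst branch_base_power) (auto simp: powr_one)
    then show ?thesis by (metis power_mult mult.commute)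
  qed
  ultimately have "(?a ^ u - 1) ^ r \<le> (branch_base q r ^ u) ^ r" by simp
  moreover have "0 \<le> branch_base q r ^ u" using branch_base_ge_1[of q r] assms by simp
  moreover have "0 \<le> ?a ^ u - 1" "r > 0" using one[of u] assms by simp_all
  \<comment> \<open>Both sides are nonnegative and \<open>r > 0\<close>, so it suffices to have
    compared their r-th powers.\<close>
  ultimately show ?thesis by (subst (asm) power_mono_iff)
qed

section \<open>Running times of word RAM programs\<close>

text \<open>A total-correctness triple with an upper bound on the time, so that, unlike the exact
  time in \<open>exec\<close>, it can be weakened.\<close>

definition runs :: "nat \<Rightarrow> prog \<Rightarrow> ram \<Rightarrow> nat \<Rightarrow> (ram \<Rightarrow> bool) \<Rightarrow> bool" where
  "runs W p s T Q \<longleftrightarrow> (\<exists>t s'. exec W p s t s' \<and> t \<le> T \<and> Q s')"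

lemma runs_conseq:
  "runs W p s T Q \<Longrightarrow> T \<le> T' \<Longrightarrow> (\<And>s'. Q s' \<Longrightarrow> Q' s') \<Longrightarrow> runs W p s T' Q'"
  unfolding runs_def by (meson order_trans)

lemma runs_Skip: "1 \<le> T \<Longrightarrow> Q s \<Longrightarrow> runs W Skip s T Q"
  unfolding runs_def using exec.Skip by blast

lemma runs_Assign:
  "eval W s e = Some v \<Longrightarrow> 1 + etime e \<le> T \<Longrightarrow> Q (s\<lparr>regs := (regs s)(x := v)\<rparr>) \<Longrightarrow>
     runs W (Assign x e) s T Q"
  unfolding runs_def using exec.Assign by blast

lemma runs_Store:
  "eval W s e1 = Some a \<Longrightarrow> eval W s e2 = Some v \<Longrightarrow> 1 + etime e1 + etime e2 \<le> T \<Longrightarrow>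
     Q (s\<lparr>mem := (mem s)(a := v)\<rparr>) \<Longrightarrow> runs W (Store e1 e2) s T Q"
  unfolding runs_def using exec.Store by blast

text \<open>The rest of the program appears inside the postcondition of the first part. Proofs thus
  follow the execution forwards and never name intermediate assertions.\<close>

lemma runs_Seq:
  assumes "runs W p1 s Ta (\<lambda>s'. runs W p2 s' Tb Q)" "1 + Ta + Tb \<le> T"
  shows "runs W (Seq p1 p2) s T Q"
proof -
  from assms(1) obtain t1 s1 t2 s2 where
    "exec W p1 s t1 s1" "t1 \<le> Ta" "exec W p2 s1 t2 s2" "t2 \<le> Tb" "Q s2"
    unfolding runs_def by blast
  then show ?thesis
    unfolding runs_def using assms(2) exec.Seq[of W p1 s t1 s1 p2 t2 s2]
    by (intro exI[of _ "1 + t1 + t2"] exI[of _ s2]) auto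
qed

lemma runs_Cond:
  assumes "eval W s e = Some v" "1 + etime e \<le> T"
    and "v \<noteq> 0 \<Longrightarrow> runs W p1 s (T - (1 + etime e)) Q" "v = 0 \<Longrightarrow> runs W p2 s (T - (1 + etime e)) Q"
  shows "runs W (Cond e p1 p2) s T Q"
proof (cases "v = 0")
  case True
  with assms(4) obtain t s' where t: "exec W p2 s t s'" "t \<le> T - (1 + etime e)" "Q s'"
    unfolding runs_def by blast
  then show ?thesis
    unfolding runs_def using exec.CondFalse[of W s e p2 t s' p1] assms(1,2) True
    by (intro exI[of _ "1 + etime e + t"] exI[of _ s']) auto
next
  case False
  with assms(3) obtain t s' where t: "exec W p1 s t s'" "t \<le> T - (1 + etime e)" "Q s'"
    unfolding runs_def by blast
  then show ?thesis
    unfolding runs_def using exec.CondTrue[of W s e v p1 t s' p2] assms(1,2) False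
    by (intro exI[of _ "1 + etime e + t"] exI[of _ s']) auto
qed

lemma runs_Assign_Seq:
  "eval W s e = Some v \<Longrightarrow> 2 + etime e \<le> T \<Longrightarrow>
     runs W p (s\<lparr>regs := (regs s)(x := v)\<rparr>) (T - (2 + etime e)) Q \<Longrightarrow> runs W (Seq (Assign x e) p) s T Q"
  by (rule runs_Seq[where Ta = "1 + etime e" and Tb = "T - (2 + etime e)"]) (auto intro: runs_Assign)

lemma runs_Store_Seq:
  "eval W s e1 = Some a \<Longrightarrow> eval W s e2 = Some v \<Longrightarrow> 2 + etime e1 + etime e2 \<le> T \<Longrightarrow>
     runs W p (s\<lparr>mem := (mem s)(a := v)\<rparr>) (T - (2 + etime e1 + etime e2)) Q \<Longrightarrow>
     runs W (Seq (Store e1 e2) p) s T Q"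
  by (rule runs_Seq[where Ta = "1 + etime e1 + etime e2" and Tb = "T - (2 + etime e1 + etime e2)"])
    (auto intro: runs_Store)

text \<open>The invariant is indexed by a ghost value \<open>g\<close>, the abstract state that the
  memory represents. A potential that drops by 1 per round bounds the number of rounds; it is
  real-valued because node weights are powers of a root.\<close>

lemma runs_While:
  fixes pot :: "'g \<Rightarrow> real"
  assumes "Inv g s" "pot g < real k"
    and nonneg: "\<And>g s. Inv g s \<Longrightarrow> 0 \<le> pot g"
    and test: "\<And>g s. Inv g s \<Longrightarrow> \<exists>v. eval W s e = Some v \<and> (v = 0 \<longrightarrow> Q s) \<and>
      (v \<noteq> 0 \<longrightarrow> runs W p s T (\<lambda>s'. \<exists>g'. Inv g' s' \<and> pot g' + 1 \<le> pot g))"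
  shows "runs W (While e p) s (k * (1 + etime e + T)) Q"
  using assms(1,2)
proof (induction k arbitrary: g s)
  case 0
  then show ?case using nonneg[of g s] by simp
next
  case (Suc k)
  from test[OF Suc.prems(1)] obtain v where v: "eval W s e = Some v" "v = 0 \<longrightarrow> Q s"
    "v \<noteq> 0 \<longrightarrow> runs W p s T (\<lambda>s'. \<exists>g'. Inv g' s' \<and> pot g' + 1 \<le> pot g)" by blast
  show ?case
  proof (cases "v = 0")
    case True
    then show ?thesis
      unfolding runs_def using v exec.WhileFalse[of W s e p]
      by (intro exI[of _ "1 + etime e"] exI[of _ s]) auto
  next
    case False
    with v obtain t1 s1 g1 where 1: "exec W p s t1 s1" "t1 \<le> T" "Inv g1 s1" "pot g1 + 1 \<le> pot g"
      unfolding runs_def by blast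
    then have "pot g1 < real k" using Suc.prems by simp
    from Suc.IH[OF 1(3) this] obtain t2 s2 where
      2: "exec W (While e p) s1 t2 s2" "t2 \<le> k * (1 + etime e + T)" "Q s2"
      unfolding runs_def by blast
    show ?thesis
      unfolding runs_def using exec.WhileTrue[OF v(1) False 1(1) 2(1)] 1 2
      by (intro exI[of _ "1 + etime e + t1 + t2"] exI[of _ s2]) auto
  qed
qed

definition For :: "nat \<Rightarrow> expr \<Rightarrow> prog \<Rightarrow> prog" where
  "For x bnd body = Seq (Assign x (Num 0))
     (While (Op Monus bnd (Reg x)) (Seq body (Assign x (Op Plus (Reg x) (Num 1)))))"

lemma word_Some [simp]: "k < W \<Longrightarrow> word W k = Some k"
  by (simp add: word_def)

text \<open>The bound expression is evaluated anew in each round, so the invariant has to preserve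
  its value; \<open>k < W\<close> keeps the counter from overflowing. A round costs 8 units besides
  \<open>bnd\<close> and the body, and the slack up to 12 pays for the initialization.\<close>

lemma runs_For:
  assumes init: "Inv 0 (s\<lparr>regs := (regs s)(x := 0)\<rparr>)"
    and inv: "\<And>i s. i \<le> k \<Longrightarrow> Inv i s \<Longrightarrow> regs s x = i \<and> eval W s bnd = Some k"
    and body: "\<And>i s. i < k \<Longrightarrow> Inv i s \<Longrightarrow> runs W body s T
      (\<lambda>s'. regs s' x = i \<and> Inv (Suc i) (s'\<lparr>regs := (regs s')(x := Suc i)\<rparr>))"
    and final: "\<And>s. Inv k s \<Longrightarrow> Q s"
    and k: "k < W" and T': "(k + 1) * (T + etime bnd + 12) \<le> T'"
  shows "runs W (For x bnd body) s T' Q"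
  unfolding For_def
proof (rule runs_Seq[where Ta = 2 and Tb = "(k + 1) * (T + etime bnd + 8)"])
  show "1 + 2 + (k + 1) * (T + etime bnd + 8) \<le> T'"
    using T' by (simp add: algebra_simps)
  let ?e = "Op Monus bnd (Reg x)" let ?inc = "Assign x (Op Plus (Reg x) (Num 1))"
  have "runs W (While ?e (Seq body ?inc)) (s\<lparr>regs := (regs s)(x := 0)\<rparr>)
      ((k + 1) * (1 + etime ?e + (T + 5))) Q"
  proof (rule runs_While[where Inv = "\<lambda>i s. i \<le> k \<and> Inv i s" and g = 0 and pot = "\<lambda>i. real k - real i"])
    fix i s assume i: "i \<le> k \<and> Inv i s"
    then have r: "regs s x = i" "eval W s bnd = Some k" using inv by auto
    have step: "runs W (Seq body ?inc) s (T + 5)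
        (\<lambda>s'. \<exists>i'. (i' \<le> k \<and> Inv i' s') \<and> real k - real i' + 1 \<le> real k - real i)" if "i < k"
    proof (rule runs_Seq[where Ta = T and Tb = 4])
      show "runs W body s T (\<lambda>s'. runs W ?inc s' 4
          (\<lambda>s'. \<exists>i'. (i' \<le> k \<and> Inv i' s') \<and> real k - real i' + 1 \<le> real k - real i))"
      proof (rule runs_conseq[OF body[OF that]])
        fix s' assume s': "regs s' x = i \<and> Inv (Suc i) (s'\<lparr>regs := (regs s')(x := Suc i)\<rparr>)"
        show "runs W ?inc s' 4
          (\<lambda>s'. \<exists>i'. (i' \<le> k \<and> Inv i' s') \<and> real k - real i' + 1 \<le> real k - real i)"
        proof (rule runs_Assign)
          show "eval W s' (Op Plus (Reg x) (Num 1)) = Some (Suc i)"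
            using s' that k by simp
        qed (use s' that in \<open>auto intro!: exI[of _ "Suc i"]\<close>)
      qed (use i in auto)
    qed simp
    show "\<exists>v. eval W s ?e = Some v \<and> (v = 0 \<longrightarrow> Q s) \<and> (v \<noteq> 0 \<longrightarrow> runs W (Seq body ?inc) s (T + 5)
        (\<lambda>s'. \<exists>i'. (i' \<le> k \<and> Inv i' s') \<and> real k - real i' + 1 \<le> real k - real i))"
      using r i k step final by (intro exI[of _ "k - i"]) auto
  qed (use init in auto)
  moreover have "1 + etime ?e + (T + 5) = T + etime bnd + 8" by simp
  ultimately have *: "runs W (While ?e (Seq body ?inc)) (s\<lparr>regs := (regs s)(x := 0)\<rparr>)
      ((k + 1) * (T + etime bnd + 8)) Q" by metis
  show "runs W (Assign x (Num 0)) s 2 (\<lambda>s'. runs W (While ?e (Seq body ?inc)) s'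
      ((k + 1) * (T + etime bnd + 8)) Q)"
    using * k by (intro runs_Assign[where v = 0]) auto
qed

section \<open>The program\<close>

text \<open>Registers are numbered such that every subprogram changes only registers from some number on.\<close>

abbreviation (input) "rn \<equiv> 0 :: nat"
abbreviation (input) "rm \<equiv> 1 :: nat"
abbreviation (input) "rR \<equiv> 2 :: nat"
abbreviation (input) "rB \<equiv> 3 :: nat"
abbreviation (input) "rbest \<equiv> 4 :: nat"
abbreviation (input) "rj \<equiv> 5 :: nat"
abbreviation (input) "rp \<equiv> 6 :: nat"
abbreviation (input) "racc \<equiv> 7 :: nat"
abbreviation (input) "rs \<equiv> 8 :: nat"
abbreviation (input) "rN \<equiv> 9 :: nat"
abbreviation (input) "rh0 \<equiv> 10 :: nat"
abbreviation (input) "rh \<equiv> 11 :: nat"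
abbreviation (input) "rfd \<equiv> 12 :: nat"
abbreviation (input) "rc0 \<equiv> 13 :: nat"
abbreviation (input) "re \<equiv> 14 :: nat"
abbreviation (input) "rok \<equiv> 15 :: nat"
abbreviation (input) "rx \<equiv> 16 :: nat"
abbreviation (input) "rt \<equiv> 17 :: nat"
abbreviation (input) "ri \<equiv> 18 :: nat"
abbreviation (input) "rd \<equiv> 19 :: nat"
abbreviation (input) "rv \<equiv> 20 :: nat"
abbreviation (input) "rc \<equiv> 21 :: nat"

text \<open>Behind the input, the memory is a matrix whose column for the variable named \<open>v\<close> starts at
  \<open>B + v * R\<close>; thus no table of variable names is needed. Row 0 is the current node, row 1 the best
  leaf, and the stack of nodes starts at row 2.\<close>

definition Addr :: "expr \<Rightarrow> expr \<Rightarrow> expr" where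
  "Addr v l = Op Plus (Op Plus (Reg rB) (Op Times v (Reg rR))) l"

definition VarName :: expr where
  "VarName = Mem (Op Plus (Num 2) (Reg ri))"

text \<open>As the stack starts at row 2, this is the first row above it. Right after
  \<open>rh\<close> is decremented it is the row of the popped node.\<close>

abbreviation (input) Top :: expr where
  "Top \<equiv> Op Plus (Reg rh) (Num 2)"

text \<open>With truncated subtraction this is the absolute difference, which is nonzero exactly if
  the operands differ.\<close>

abbreviation (input) Differ :: "expr \<Rightarrow> expr \<Rightarrow> expr" where
  "Differ a b \<equiv> Op Plus (Op Monus a b) (Op Monus b a)"

definition copy_row :: "expr \<Rightarrow> expr \<Rightarrow> prog" where
  "copy_row dst src = For ri (Reg rn) (Store (Addr VarName dst) (Mem (Addr VarName src)))"

notation Seq (infixr ";;" 60)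

text \<open>Writes the refinement of the current node by entry \<open>re\<close> above the top of the stack, whether or not
  it is consistent.\<close>

definition try_entry :: "nat \<Rightarrow> prog" where
  "try_entry q =
     copy_row Top (Num 0) ;;
     Assign rok (Num 1) ;;
     Assign rx (Reg re) ;;
     For rt (Reg rs)
      (Assign rd (Op Monus (Reg rx) (Op Times (Op Quot (Reg rx) (Num (q + 1))) (Num (q + 1)))) ;;
       Assign rx (Op Quot (Reg rx) (Num (q + 1))) ;;
       Assign rv (Mem (Op Monus (Op Plus (Reg rp) (Op Plus (Reg rs) (Num 1))) (Reg rt))) ;;
       Store (Addr (Reg rv) Top) (Reg rd) ;;
       Cond (Op Times (Op Monus (Num (q + 1)) (Mem (Addr (Reg rv) (Num 0))))
                      (Differ (Mem (Addr (Reg rv) (Num 0))) (Reg rd)))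
         (Assign rok (Num 0)) Skip)"

text \<open>Mirrors \<open>scan_step\<close>, with a product as conjunction and
  \<open>1 - rfd\<close> as negation. The tentative row is kept by raising \<open>rh\<close>;
  otherwise the next entry overwrites it.\<close>

definition scan_entry :: "nat \<Rightarrow> prog" where
  "scan_entry q =
     try_entry q ;;
     Assign rc (Op Plus (Mem (Op Plus (Reg rp) (Op Plus (Op Plus (Num 2) (Reg rs)) (Reg re)))) (Num 1)) ;;
     Cond (Reg rok)
      (Cond (Op Times (Op Times (Reg rc0) (Op Monus (Num 1) (Reg rfd))) (Differ (Reg rc) (Reg rc0)))
        (Assign rfd (Num 1))
        (Assign rh (Op Plus (Reg rh) (Num 1)) ;;
         Cond (Reg rc0) Skip (Assign rc0 (Reg rc))))
      Skip"

text \<open>Children are pushed while the constraint is scanned; if no entry is discarded, the stack is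
  reset to its old height.\<close>

definition scan_constraint :: "nat \<Rightarrow> prog" where
  "scan_constraint q =
     Assign rs (Mem (Reg rp)) ;;
     Assign rN (Num 1) ;;
     For rt (Reg rs) (Assign rN (Op Times (Reg rN) (Num (q + 1)))) ;;
     Assign rh0 (Reg rh) ;;
     Assign rc0 (Num 0) ;;
     For re (Reg rN) (scan_entry q) ;;
     Cond (Reg rfd) Skip
      (Assign rh (Reg rh0) ;;
       Assign racc (Op Plus (Reg racc)
         (Op Times (Mem (Op Plus (Reg rp) (Num 1))) (Op Monus (Reg rc0) (Num 1)))) ;;
       Assign rp (Op Plus (Op Plus (Reg rp) (Num 2)) (Op Plus (Reg rs) (Reg rN))))"

text \<open>The popped node is copied to row 0 because its own row is reused for its first child.
  The final test is nonzero exactly if no leaf is known yet or the new one is strictly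
  cheaper.\<close>

definition process_node :: "nat \<Rightarrow> prog" where
  "process_node q =
     Assign rh (Op Monus (Reg rh) (Num 1)) ;;
     copy_row (Num 0) Top ;;
     Assign racc (Num 0) ;;
     Assign rfd (Num 0) ;;
     Assign rp (Op Plus (Num 2) (Reg rn)) ;;
     For rj (Reg rm) (Cond (Reg rfd) Skip (scan_constraint q)) ;;
     Cond (Reg rfd) Skip
      (For ri (Reg rn) (Cond (Mem (Addr VarName (Num 0))) Skip
         (Assign racc (Op Plus (Reg racc) (Num 1)))) ;;
       Assign rc (Op Plus (Reg racc) (Num 1)) ;;
       Cond (Op Plus (Op Monus (Num 1) (Reg rbest)) (Op Monus (Reg rbest) (Reg rc)))
        (Assign rbest (Reg rc) ;; copy_row (Num 1) (Num 0))
        Skip)"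

text \<open>A popped node has position at most \<open>n * (q + 1)^r\<close>, and expanding it uses
  at most \<open>(q + 1)^r\<close> rows from its own row on. With rows 0 and 1 this fits into
  \<open>rR\<close> rows. The start \<open>rB\<close> of the matrix is an upper bound on the input
  length, obtained without parsing the input: a constraint takes at most
  \<open>2 + r + (q + 1)^r\<close> words. The last loop turns the marker \<open>q + 1\<close> of
  free variables into the value 1.\<close>

definition wcsp_solver :: "nat \<Rightarrow> nat \<Rightarrow> prog" where
  "wcsp_solver q r =
     Assign rn (Mem (Num 0)) ;;
     Assign rm (Mem (Num 1)) ;;
     Assign rR (Op Plus (Op Times (Reg rn) (Num ((q + 1) ^ r))) (Num ((q + 1) ^ r + 3))) ;;
     Assign rB (Op Plus (Op Plus (Num 2) (Reg rn)) (Op Times (Reg rm) (Num (2 + r + (q + 1) ^ r)))) ;;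
     For ri (Reg rn) (Store (Addr VarName (Num 2)) (Num (q + 1))) ;;
     Assign rh (Num 1) ;;
     While (Reg rh) (process_node q) ;;
     For ri (Reg rn) (Cond (Op Monus (Num (q + 1)) (Mem (Addr VarName (Num 1))))
       (Store (Reg ri) (Mem (Addr VarName (Num 1))))
       (Store (Reg ri) (Num 1)))"

section \<open>Correctness and running time\<close>

lemma nth_concat_map_offset:
  "j < length L \<Longrightarrow> k < length (f (L ! j)) \<Longrightarrow>
     concat (map f L) ! ((\<Sum>i<j. length (f (L ! i))) + k) = f (L ! j) ! k"
proof (induction L arbitrary: j)
  case Nil
  then show ?case by simp
next
  case (Cons y L)
  show ?case
  proof (cases j)
    case 0
    then show ?thesis using Cons.prems by (simp add: nth_append)
  next
    case (Suc j')
    then have "(\<Sum>i<j. length (f ((y # L) ! i))) = length (f y) + (\<Sum>i<j'. length (f (L ! i)))"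
      by (simp add: sum.lessThan_Suc_shift del: sum.lessThan_Suc)
    then show ?thesis using Cons.prems Cons.IH[of j'] Suc by (simp add: nth_append)
  qed
qed

lemma length_concat_map: "length (concat (map f L)) = (\<Sum>i<length L. length (f (L ! i)))"
  by (simp add: length_concat comp_def sum_list_sum_nth atLeast0LessThan)

text \<open>A set of at most \<open>r\<close> elements is the set of proper entries of a list of
  length exactly \<open>r\<close> over \<open>V\<close> and a padding symbol, here
  \<open>None\<close>.\<close>

lemma card_small_subsets_le:
  assumes "finite V" "S \<subseteq> {C. C \<subseteq> V \<and> card C \<le> r}"
  shows "card S \<le> (card V + 1) ^ r"
proof -
  let ?L = "{l. set l \<subseteq> insert None (Some ` V) \<and> length l = r}"
  let ?g = "\<lambda>l. {v. Some v \<in> set l}"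
  have fin: "finite ?L" using assms by (intro finite_lists_length_eq) auto
  have "S \<subseteq> ?g ` ?L"
  proof
    fix C assume "C \<in> S"
    then have C: "C \<subseteq> V" "card C \<le> r" using assms by auto
    then have "finite C" using assms(1) by (blast intro: finite_subset)
    then obtain l where "set l = C" "distinct l" using finite_distinct_list by blast
    then have l: "set l = C" "length l = card C" using distinct_card[of l] by simp_all
    have "map Some l @ replicate (r - card C) None \<in> ?L" using C l by auto
    moreover have "?g (map Some l @ replicate (r - card C) None) = C" using l by auto
    ultimately show "C \<in> ?g ` ?L" by blast
  qed
  then have "card S \<le> card (?g ` ?L)" using fin by (intro card_mono) auto
  also have "\<dots> \<le> card ?L" by (rule card_image_le[OF fin])
  also have "\<dots> = card (insert None (Some ` V)) ^ r"
    using assms by (intro card_lists_length_eq) auto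
  also have "card (insert None (Some ` V)) = card V + 1"
    using assms by (simp add: card_insert_if card_image)
  finally show ?thesis .
qed

lemma less_power_of_ge_2:
  fixes x k :: nat
  assumes "x \<ge> 2"
  shows "k < x ^ k"
  using less_le_trans[OF less_exp[of k] power_mono[OF assms, of k]] by simp

text \<open>\<open>W_addr\<close> bounds the matrix addresses, as columns are selected by variable
  names up to \<open>M\<close>. The first part of \<open>W_cost\<close> bounds accumulated costs,
  each constraint adding at most multiplicity times cost; the second part bounds the product tested
  in \<open>scan_entry\<close>. \<open>W_const\<close> covers the constants of the program and the
  product tested in \<open>try_entry\<close>.\<close>

locale wcsp_ram = wcsp_input +
  fixes W M :: nat
  assumes r_pos: "r \<ge> 1"
    and input_le: "\<And>x. x \<in> set (encode q I vs cs) \<Longrightarrow> x \<le> M"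
    and W_addr: "2 + length vs + length cs * (2 + r + (q + 1) ^ r) +
      (M + 1) * (length vs * (q + 1) ^ r + (q + 1) ^ r + 3) < W"
    and W_cost: "length cs * (M * M) + length vs + 2 < W" "(M + 1) * (M + 1) + 1 < W"
    and W_const: "(q + 1) * (q + 1) + (q + 1) ^ r + r + 5 < W"
begin

section \<open>Layout of the input and of the memory\<close>

definition D :: nat where "D = (q + 1) ^ r"
definition n :: nat where "n = length vs"
definition m :: nat where "m = length cs"
definition R :: nat where "R = n * D + D + 3"
definition B :: nat where "B = 2 + n + m * (2 + r + D)"
definition input :: "nat list" where "input = encode q I vs cs"

definition addr :: "nat \<Rightarrow> nat \<Rightarrow> nat" where "addr v l = B + v * R + l"

text \<open>Describes the whole memory: the input, a gap of zeros up to \<open>B\<close>, and the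
  matrix with \<open>A l v\<close> in row \<open>l\<close> of column \<open>v\<close>. During the
  search a machine state is thus determined by its registers and \<open>A\<close>.\<close>

definition layout :: "(nat \<Rightarrow> nat \<Rightarrow> nat) \<Rightarrow> nat \<Rightarrow> nat" where
  "layout A a = (if a < B then if a < length input then input ! a else 0
                 else A ((a - B) mod R) ((a - B) div R))"

definition offset :: "nat \<Rightarrow> nat" where
  "offset j = 2 + n + (\<Sum>i<j. 2 + length (scope (cs ! i)) + size_of (cs ! i))"

lemma length_encode_constraint:
  "length (encode_constraint q I vs C) = 2 + length (scope C) + size_of C"
  by (simp add: encode_constraint_def Let_def scope_def[symmetric] length_assignments size_of_def)

lemma offset_eq:
  "offset j = length ([length vs, length cs] @ vs) + (\<Sum>i<j. length (encode_constraint q I vs (cs ! i)))"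
  by (simp add: offset_def n_def length_encode_constraint)

lemma length_input: "length input = offset m"
  by (simp add: input_def encode_def offset_eq length_concat_map m_def del: map_map)

lemma offset_Suc: "offset (Suc j) = offset j + 2 + (length (scope (cs ! j)) + size_of (cs ! j))"
  by (simp add: offset_def)

lemma offset_mono: "i \<le> j \<Longrightarrow> offset i \<le> offset j"
  unfolding offset_def by (intro add_left_mono sum_mono2) auto

lemma input_offset:
  assumes "j < m" "k < 2 + length (scope (cs ! j)) + size_of (cs ! j)"
  shows "input ! (offset j + k) = encode_constraint q I vs (cs ! j) ! k"
    and "offset j + k < length input"
proof -
  show "input ! (offset j + k) = encode_constraint q I vs (cs ! j) ! k"
    using nth_concat_map_offset[of j cs k "encode_constraint q I vs"] assms
    unfolding input_def encode_def offset_eq append_assoc[symmetric]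
    by (subst nth_append_right) (simp_all add: m_def length_encode_constraint)
  show "offset j + k < length input"
    using offset_mono[of "Suc j" m] assms unfolding length_input offset_Suc by simp
qed

lemma input_constraint:
  assumes j: "j < m" and C: "C = cs ! j"
  shows "input ! offset j = length (scope C)"
    and "input ! (offset j + 1) = count (Constraints I) C"
    and "\<And>i. i < length (scope C) \<Longrightarrow> input ! (offset j + (2 + i)) = scope C ! i"
    and "\<And>e. e < size_of C \<Longrightarrow> input ! (offset j + (2 + length (scope C) + e)) = Cost I C (entry C e)"
proof -
  have enc: "encode_constraint q I vs C =
      [length (scope C), count (Constraints I) C] @ scope C @ map (Cost I C) (assignments q (scope C))"
    by (simp add: encode_constraint_def Let_def scope_def)
  show "input ! offset j = length (scope C)"
    using input_offset(1)[OF j, of 0] by (simp add: enc C[symmetric])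
  show "input ! (offset j + 1) = count (Constraints I) C"
    using input_offset(1)[OF j, of 1] by (simp add: enc C[symmetric])
  show "input ! (offset j + (2 + i)) = scope C ! i" if "i < length (scope C)" for i
    using input_offset(1)[OF j, of "2 + i"] that by (simp add: enc C[symmetric] nth_append)
  show "input ! (offset j + (2 + length (scope C) + e)) = Cost I C (entry C e)" if "e < size_of C" for e
    using input_offset(1)[OF j, of "2 + length (scope C) + e"] that
    by (simp add: enc C[symmetric] nth_append length_assignments size_of_def entry_def)
qed

lemma size_of_le: "C \<in># Constraints I \<Longrightarrow> size_of C \<le> D"
  unfolding size_of_def D_def by (intro power_increasing length_scope_le) auto

lemma length_input_le: "length input \<le> B"
proof -
  have "(\<Sum>i<m. 2 + length (scope (cs ! i)) + size_of (cs ! i)) \<le> (\<Sum>i<m. 2 + r + D)"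
    using size_of_le length_scope_le cs_constraint
    by (intro sum_mono add_mono) (auto simp: m_def)
  then show ?thesis unfolding length_input offset_def B_def by simp
qed

lemma input_nth_le: "a < length input \<Longrightarrow> input ! a \<le> M"
  using input_le nth_mem by (auto simp: input_def)

lemma input_head: "input ! 0 = n" "input ! 1 = m" "Suc 0 < length input"
  "i < n \<Longrightarrow> input ! (2 + i) = vs ! i" "i < n \<Longrightarrow> 2 + i < length input"
  by (auto simp: input_def encode_def n_def m_def nth_append)

lemma R_pos: "R > 0" by (simp add: R_def)

lemma layout_input: "a < length input \<Longrightarrow> layout A a = input ! a"
  using length_input_le by (simp add: layout_def)

lemma layout_addr: "l < R \<Longrightarrow> layout A (addr v l) = A l v"
  by (simp add: layout_def addr_def)

text \<open>For \<open>l < R\<close>, quotient and remainder by \<open>R\<close> recover column and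
  row from an address, so a store changes just one matrix entry.\<close>

lemma layout_update:
  assumes "l < R"
  shows "(layout A)(addr v l := x) = layout (A(l := (A l)(v := x)))"
proof
  fix a
  show "((layout A)(addr v l := x)) a = layout (A(l := (A l)(v := x))) a"
  proof (cases "a < B")
    case True
    then show ?thesis by (auto simp: layout_def addr_def)
  next
    case False
    have "a = addr v l \<longleftrightarrow> (a - B) mod R = l \<and> (a - B) div R = v"
    proof
      assume "a = addr v l"
      then show "(a - B) mod R = l \<and> (a - B) div R = v" using assms by (simp add: addr_def)
    next
      assume "(a - B) mod R = l \<and> (a - B) div R = v"
      then have "a - B = v * R + l" using div_mult_mod_eq[of "a - B" R] by simp
      then show "a = addr v l" using False by (simp add: addr_def)
    qed
    then show ?thesis using False by (auto simp: layout_def)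
  qed
qed

definition st :: "(nat \<Rightarrow> nat) \<Rightarrow> (nat \<Rightarrow> nat \<Rightarrow> nat) \<Rightarrow> ram" where
  "st \<rho> A = \<lparr>regs = \<rho>, mem = layout A\<rparr>"

lemma st_simps [simp]:
  "regs (st \<rho> A) = \<rho>" "mem (st \<rho> A) = layout A"
  "(st \<rho> A)\<lparr>regs := \<rho>'\<rparr> = st \<rho>' A"
  by (simp_all add: st_def)

lemma st_store: "l < R \<Longrightarrow> (st \<rho> A)\<lparr>mem := (layout A)(addr v l := x)\<rparr> = st \<rho> (A(l := (A l)(v := x)))"
  by (simp add: st_def layout_update)

lemma W_addr': "B + (M + 1) * R < W"
  using W_addr by (simp add: B_def R_def n_def m_def D_def)

lemma addr_less: "v \<le> M \<Longrightarrow> l < R \<Longrightarrow> addr v l < W"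
proof -
  assume "v \<le> M" "l < R"
  then have "v * R + l \<le> M * R + R" by (intro add_mono mult_right_mono) auto
  then show ?thesis using W_addr' by (simp add: addr_def)
qed

lemma words: "B < W" "R < W" "M < W" "n < W" "m < W" "D < W" "q + 1 < W" "r + 5 < W" "2 < W" "M + 1 < W"
proof -
  have "R \<le> (M + 1) * R" "M + 1 \<le> (M + 1) * R"
    using R_pos mult_le_mono2[of 1 R "M + 1"] by simp_all
  then show "R < W" "M < W" "B < W" using W_addr' by linarith+
  then show "n < W" by (simp add: B_def)
  have "m \<le> m * (2 + r + D)" by simp
  then show "m < W" using \<open>B < W\<close> by (simp add: B_def)
  show "D < W" "r + 5 < W" "2 < W" using W_const by (simp_all add: D_def)
  have "q + 1 \<le> (q + 1) * (q + 1)" by simp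
  then show "q + 1 < W" using W_const by linarith
  have "M + 1 \<le> (M + 1) * (M + 1)" by simp
  then show "M + 1 < W" using W_cost by linarith
qed

lemma Vars_le: "v \<in> Vars I \<Longrightarrow> v \<le> M"
  unfolding set_vs[symmetric] by (rule input_le) (simp add: encode_def)

section \<open>Evaluating addresses and copying rows\<close>

lemma eval_Addr:
  assumes "regs s rR = R" "regs s rB = B" "eval W s ve = Some v" "eval W s le = Some l" "v \<le> M" "l < R"
  shows "eval W s (Addr ve le) = Some (addr v l)"
proof -
  have "B + v * R + l < W" using addr_less[OF assms(5,6)] by (simp add: addr_def)
  then show ?thesis using assms words by (simp add: Addr_def addr_def)
qed

lemma eval_Mem_Addr:
  assumes "\<rho> rR = R" "\<rho> rB = B" "eval W (st \<rho> A) ve = Some v" "eval W (st \<rho> A) le = Some l" "v \<le> M" "l < R"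
    and "A l v < W"
  shows "eval W (st \<rho> A) (Mem (Addr ve le)) = Some (A l v)"
  using eval_Addr[of "st \<rho> A" ve v le l] assms by (simp add: layout_addr)

lemma nth_vs: "i < n \<Longrightarrow> vs ! i \<in> Vars I" "i < n \<Longrightarrow> vs ! i \<le> M"
  using Vars_le nth_mem[of i vs] by (auto simp: set_vs n_def)

lemma eval_VarName:
  assumes "\<rho> ri = i" "i < n"
  shows "eval W (st \<rho> A) VarName = Some (vs ! i)"
proof -
  have "2 + i < B" using assms input_head(5)[of i] length_input_le by simp
  then have "2 + i < W" using words by simp
  then show ?thesis using assms words nth_vs[of i] input_head(4,5)[of i]
    by (simp add: VarName_def layout_input)
qed

lemma etime_Addr [simp]: "etime (Addr v l) = etime v + etime l + 5"
  by (simp add: Addr_def)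

lemma etime_VarName [simp]: "etime VarName = 4"
  by (simp add: VarName_def)

text \<open>Row numbers are given by arbitrary expressions. They must keep their values under any
  change of \<open>ri\<close> and of the matrix, since they are evaluated again in each
  round.\<close>

lemma runs_copy_row:
  assumes \<rho>: "\<rho> rn = n" "\<rho> rR = R" "\<rho> rB = B" and l: "l1 < R" "l2 < R" "l1 \<noteq> l2"
    and A: "\<And>v. v \<in> Vars I \<Longrightarrow> A l2 v \<le> q + 1"
    and dst: "\<And>\<rho>' A'. (\<And>y. y \<noteq> ri \<Longrightarrow> \<rho>' y = \<rho> y) \<Longrightarrow> eval W (st \<rho>' A') dst = Some l1"
    and src: "\<And>\<rho>' A'. (\<And>y. y \<noteq> ri \<Longrightarrow> \<rho>' y = \<rho> y) \<Longrightarrow> eval W (st \<rho>' A') src = Some l2"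
    and T: "(n + 1) * (etime dst + etime src + 33) \<le> T"
  shows "runs W (copy_row dst src) (st \<rho> A) T
    (\<lambda>s. s = st (\<rho>(ri := n)) (A(l1 := \<lambda>v. if v \<in> Vars I then A l2 v else A l1 v)))"
  unfolding copy_row_def
proof (rule runs_For[where Inv = "\<lambda>i s. s = st (\<rho>(ri := i))
      (A(l1 := \<lambda>v. if v \<in> set (take i vs) then A l2 v else A l1 v))" and k = n
      and T = "etime dst + etime src + 20"])
  fix i s assume i: "i < n" and s: "s = st (\<rho>(ri := i))
      (A(l1 := \<lambda>v. if v \<in> set (take i vs) then A l2 v else A l1 v))" (is "_ = st ?\<rho> ?A")
  have t: "set (take (Suc i) vs) = insert (vs ! i) (set (take i vs))"
    using i by (simp add: take_Suc_conv_app_nth n_def)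
  note vn = eval_VarName[of ?\<rho> i ?A] nth_vs[OF i]
  show "runs W (Store (Addr VarName dst) (Mem (Addr VarName src))) s (etime dst + etime src + 20)
      (\<lambda>s'. regs s' ri = i \<and> s'\<lparr>regs := (regs s')(ri := Suc i)\<rparr> = st (\<rho>(ri := Suc i))
        (A(l1 := \<lambda>v. if v \<in> set (take (Suc i) vs) then A l2 v else A l1 v)))"
    unfolding s
  proof (rule runs_Store)
    show "eval W (st ?\<rho> ?A) (Addr VarName dst) = Some (addr (vs ! i) l1)"
      using \<rho> i vn l by (intro eval_Addr dst) auto
    have "A l2 (vs ! i) < W" using A[OF nth_vs(1)[OF i]] words by linarith
    then have "eval W (st ?\<rho> ?A) (Mem (Addr VarName src)) = Some (?A l2 (vs ! i))"
      using \<rho> i vn l by (intro eval_Mem_Addr src) auto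
    then show "eval W (st ?\<rho> ?A) (Mem (Addr VarName src)) = Some (A l2 (vs ! i))" using l by simp
    show "regs ((st ?\<rho> ?A)\<lparr>mem := (mem (st ?\<rho> ?A))(addr (vs ! i) l1 := A l2 (vs ! i))\<rparr>) ri = i \<and>
      (st ?\<rho> ?A)\<lparr>mem := (mem (st ?\<rho> ?A))(addr (vs ! i) l1 := A l2 (vs ! i)),
        regs := (regs ((st ?\<rho> ?A)\<lparr>mem := (mem (st ?\<rho> ?A))(addr (vs ! i) l1 := A l2 (vs ! i))\<rparr>))(ri := Suc i)\<rparr> =
      st (\<rho>(ri := Suc i)) (A(l1 := \<lambda>v. if v \<in> set (take (Suc i) vs) then A l2 v else A l1 v))"
      using l(1) unfolding t by (simp add: st_store) (auto intro!: arg_cong[of _ _ "st _"] ext)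
  qed simp
qed (use \<rho> words T in \<open>auto simp: n_def set_vs intro: order_trans[rotated]\<close>)

section \<open>Writing and testing one table entry\<close>

lemma eval_Top: "\<rho> rh = h \<Longrightarrow> h + 2 < R \<Longrightarrow> eval W (st \<rho> A) Top = Some (h + 2)"
  using words by simp

text \<open>Division yields the least significant digit of \<open>e\<close> first, so the scope is
  traversed from its last variable to its first; \<open>seen t\<close> consists of the last
  \<open>t\<close> variables. Consistency is tested against row 0, because the tentative row is
  being overwritten.\<close>

lemma runs_try_entry:
  assumes j: "j < m" and C: "C = cs ! j" and e: "e < size_of C"
    and \<rho>: "\<rho> rn = n" "\<rho> rR = R" "\<rho> rB = B" "\<rho> rp = offset j" "\<rho> rs = length (scope C)" "\<rho> re = e"
      "\<rho> rh = h" and h: "h + 2 < R"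
    and a: "valid a" "\<And>v. v \<in> Vars I \<Longrightarrow> A 0 v = a v"
    and T: "(n + 1) * 37 + (r + 1) * 150 + 10 \<le> T"
  shows "runs W (try_entry q) (st \<rho> A) T (\<lambda>s. \<exists>\<rho>' b. s = st \<rho>' (A(h + 2 := b)) \<and>
    (\<forall>y<15. \<rho>' y = \<rho> y) \<and> \<rho>' rok = of_bool (consistent a C e) \<and>
    (\<forall>v\<in>Vars I. b v = refine a C e v))" (is "runs _ _ _ _ ?Q")
proof -
  let ?len = "length (scope C)"
  have CI: "C \<in># Constraints I" using j C by (simp add: m_def cs_constraint)
  have sub: "C \<subseteq> Vars I" using constraint_subset[OF CI] .
  have eW: "e < W" using e size_of_le[OF CI] words by simp
  have lenr: "?len \<le> r" using length_scope_le[OF CI] .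
  have av: "\<And>v. v \<in> Vars I \<Longrightarrow> a v \<le> q + 1" using a by (simp add: valid_def)
  define seen where "seen t = set (drop (?len - t) (scope C))" for t
  define Inv where "Inv t s \<longleftrightarrow> (\<exists>\<rho>' b. s = st \<rho>' (A(h + 2 := b)) \<and> (\<forall>y<15. \<rho>' y = \<rho> y) \<and>
      \<rho>' rt = t \<and> \<rho>' rx = e div (q + 1) ^ t \<and>
      \<rho>' rok = of_bool (\<forall>v\<in>seen t. a v = q + 1 \<or> a v = cell_value (entry C e v)) \<and>
      (\<forall>v\<in>Vars I. b v = (if v \<in> seen t then cell_value (entry C e v) else a v)))" for t s
  let ?body = "Assign rd (Op Monus (Reg rx) (Op Times (Op Quot (Reg rx) (Num (q + 1))) (Num (q + 1)))) ;;
       Assign rx (Op Quot (Reg rx) (Num (q + 1))) ;;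
       Assign rv (Mem (Op Monus (Op Plus (Reg rp) (Op Plus (Reg rs) (Num 1))) (Reg rt))) ;;
       Store (Addr (Reg rv) Top) (Reg rd) ;;
       Cond (Op Times (Op Monus (Num (q + 1)) (Mem (Addr (Reg rv) (Num 0))))
                      (Differ (Mem (Addr (Reg rv) (Num 0))) (Reg rd)))
         (Assign rok (Num 0)) Skip"
  have body: "runs W ?body s 120 (\<lambda>s'. regs s' rt = t \<and> Inv (Suc t) (s'\<lparr>regs := (regs s')(rt := Suc t)\<rparr>))"
    if t: "t < ?len" and inv: "Inv t s" for t s
  proof -
    obtain \<rho>' b where s: "s = st \<rho>' (A(h + 2 := b))" and r: "\<forall>y<15. \<rho>' y = \<rho> y" "\<rho>' rt = t"
      "\<rho>' rx = e div (q + 1) ^ t"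
      "\<rho>' rok = of_bool (\<forall>v\<in>seen t. a v = q + 1 \<or> a v = cell_value (entry C e v))"
      and b: "\<forall>v\<in>Vars I. b v = (if v \<in> seen t then cell_value (entry C e v) else a v)"
      using inv unfolding Inv_def by blast
    define i where "i = ?len - Suc t"
    define v where "v = scope C ! i"
    define x where "x = e div (q + 1) ^ t"
    define d where "d = cell_value (entry C e v)"
    have i: "i < ?len" using t by (simp add: i_def)
    have vC: "v \<in> C" using nth_mem[OF i] set_scope[OF CI] by (simp add: v_def)
    then have vI: "v \<in> Vars I" "v \<le> M" using sub Vars_le by auto
    have seen: "seen (Suc t) = insert v (seen t)"
      using Cons_nth_drop_Suc[OF i] t unfolding seen_def v_def i_def
      by (metis Suc_diff_Suc list.simps(15))
    have "?len - 1 - i = t" using t by (simp add: i_def)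
    then have dx: "d = x mod (q + 1)"
      using cell_value_nth_assignments[OF distinct_scope i, of e q] e
      by (simp add: d_def v_def entry_def x_def size_of_def)
    have dq: "d \<le> q" using entry_cell_value_le(2)[OF CI e vC] by (simp add: d_def)
    have rx: "\<rho>' rx = x" using r(3) by (simp add: x_def)
    have xe: "x \<le> e" by (simp add: x_def)
    have xW: "x < W" "x div (q + 1) < W" using xe eW div_le_dividend[of x "q + 1"] by linarith+
    have xb: "x div (q + 1) * (q + 1) \<le> x" by (rule div_times_less_eq_dividend)
    have input_v: "offset j + (2 + i) < length input" "input ! (offset j + (2 + i)) = v"
      using input_offset(2)[OF j, of "2 + i"] input_constraint(3)[OF j C i] i C by (auto simp: v_def)
    \<comment> \<open>The names of the scope start two cells after the start of the constraint, and
      the index to be read is \<open>?len - 1 - t\<close>. Adding \<open>?len + 1\<close> before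
      subtracting \<open>t\<close> avoids truncation.\<close>
    have off: "offset j + (?len + 1) - t = offset j + (2 + i)" using t by (simp add: i_def)
    have offW: "offset j + (?len + 1) < W"
      using input_offset(2)[OF j, of "?len + 1"] C length_input_le words e by simp
    have aW: "a v < W" "d < W" "v < W" using av[OF vI(1)] words dq vI by linarith+
    let ?A = "A(h + 2 := b)" let ?A' = "A(h + 2 := b(v := d))"
    let ?\<rho> = "\<rho>'(rd := d, rx := x div (q + 1), rv := v)"
    have ev_a: "eval W (st ?\<rho> ?A') (Mem (Addr (Reg rv) (Num 0))) = Some (a v)"
      using eval_Mem_Addr[of ?\<rho> ?A' "Reg rv" v "Num 0" 0] r \<rho> vI aW words R_pos a(2)[OF vI(1)] by simp
    \<comment> \<open>This product is the test of the program. As \<open>a v\<close> is at most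
      \<open>q + 1\<close>, it vanishes exactly if \<open>v\<close> is free or already has the value
      \<open>d\<close>.\<close>
    have prod: "(q + 1 - a v) * (a v - d + (d - a v)) < W"
    proof -
      have "(q + 1 - a v) * (a v - d + (d - a v)) \<le> (q + 1) * (q + 1)"
        using av[OF vI(1)] dq by (intro mult_mono) auto
      then show ?thesis using W_const by linarith
    qed
    have fin: "Inv (Suc t) (st \<rho>'' ?A')"
      if "\<forall>y<15. \<rho>'' y = \<rho> y" "\<rho>'' rt = Suc t" "\<rho>'' rx = x div (q + 1)"
        "\<rho>'' rok = of_bool (\<forall>v\<in>seen (Suc t). a v = q + 1 \<or> a v = cell_value (entry C e v))" for \<rho>''
      unfolding Inv_def
    proof (intro exI conjI)
      show "st \<rho>'' ?A' = st \<rho>'' ?A'" ..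
      show "\<forall>w\<in>Vars I. (b(v := d)) w = (if w \<in> seen (Suc t) then cell_value (entry C e w) else a w)"
        using b seen by (auto simp: d_def)
      show "\<rho>'' rx = e div (q + 1) ^ Suc t"
        using that(3) by (simp only: x_def div_mult2_eq[symmetric] power_Suc2)
    qed (use that in auto)
    show ?thesis unfolding s
    proof (rule runs_Assign_Seq[where v = d], goal_cases)
      case 1
      have "x - x div (q + 1) * (q + 1) = d" by (simp only: dx minus_div_mult_eq_mod)
      then show ?case using rx words xW xb by simp
    next
      case 3
      show ?case unfolding st_simps
      proof (rule runs_Assign_Seq[where v = "x div (q + 1)"], goal_cases)
        case 1
        show ?case using rx words xW by simp
      next
        case 3
        show ?case unfolding st_simps
        proof (rule runs_Assign_Seq[where v = v], goal_cases)
          case 1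
          have "eval W (st (\<rho>'(rd := d, rx := x div (q + 1))) ?A)
              (Op Monus (Op Plus (Reg rp) (Op Plus (Reg rs) (Num 1))) (Reg rt)) = Some (offset j + (2 + i))"
            using r \<rho> offW t words off by simp
          then show ?case using input_v layout_input aW by simp
        next
          case 3
          show ?case unfolding st_simps
          proof (rule runs_Store_Seq[where a = "addr v (h + 2)" and v = d], goal_cases)
            case 1
            show ?case using r \<rho> h vI aW words by (intro eval_Addr eval_Top) auto
          next
            case 2
            show ?case using aW by simp
          next
            case 4
            show ?case unfolding st_simps st_store[OF h]
            proof (rule runs_Cond[where v = "(q + 1 - a v) * (a v - d + (d - a v))"], goal_cases)
              case 1
              show ?case
                using ev_a prod aW words by (simp del: eval.simps(3))
            next
              case 3
              then have "\<not> (a v = q + 1 \<or> a v = d)" by auto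
              then have "\<not> (\<forall>v\<in>seen (Suc t). a v = q + 1 \<or> a v = cell_value (entry C e v))"
                using seen by (simp add: d_def)
              then show ?case using r words fin[of "?\<rho>(rok := 0, rt := Suc t)"]
                by (intro runs_Assign[where v = 0]) simp_all
            next
              case 4
              then have "a v = q + 1 \<or> a v = d" using av[OF vI(1)] by auto
              then have "(\<forall>v\<in>seen (Suc t). a v = q + 1 \<or> a v = cell_value (entry C e v)) =
                  (\<forall>v\<in>seen t. a v = q + 1 \<or> a v = cell_value (entry C e v))"
                using seen by (simp add: d_def)
              then show ?case using r fin[of "?\<rho>(rt := Suc t)"]
                by (intro runs_Skip) simp_all
            qed simp
          qed simp
        qed simp
      qed simp
    qed simp
  qed
  show ?thesis unfolding try_entry_def
  proof (rule runs_Seq[where Ta = "(n + 1) * 37" and Tb = "(r + 1) * 150 + 9"])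
    show "runs W (copy_row Top (Num 0)) (st \<rho> A) ((n + 1) * 37) (\<lambda>s'. runs W
      (Assign rok (Num 1) ;; Assign rx (Reg re) ;; For rt (Reg rs) ?body) s' ((r + 1) * 150 + 9) ?Q)"
    proof (rule runs_conseq[OF runs_copy_row[where ?l1.0 = "h + 2" and ?l2.0 = 0]], goal_cases)
      case (12 s)
      let ?b = "\<lambda>v. if v \<in> Vars I then A 0 v else A (h + 2) v"
      show ?case unfolding 12
      proof (rule runs_Assign_Seq[where v = 1], goal_cases)
        case 3
        show ?case unfolding st_simps
        proof (rule runs_Assign_Seq[where v = e], goal_cases)
          case 3
          show ?case unfolding st_simps
          proof (rule runs_For[where Inv = Inv and k = ?len and T = 120], goal_cases)
            case 1
            show ?case unfolding st_simps Inv_def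
              by (intro exI conjI, rule refl) (use a in \<open>auto simp: seen_def\<close>)
          next
            case (2 t s)
            then show ?case using lenr words \<rho> unfolding Inv_def by auto
          next
            case (3 t s)
            then show ?case by (rule body)
          next
            case (4 s)
            then obtain \<rho>' b where s: "s = st \<rho>' (A(h + 2 := b))" and r: "\<forall>y<15. \<rho>' y = \<rho> y"
              "\<rho>' rok = of_bool (\<forall>v\<in>seen ?len. a v = q + 1 \<or> a v = cell_value (entry C e v))"
              and b: "\<forall>v\<in>Vars I. b v = (if v \<in> seen ?len then cell_value (entry C e v) else a v)"
              unfolding Inv_def by blast
            have dn: "seen ?len = C" using set_scope[OF CI] by (simp add: seen_def)
            show ?case using s r b unfolding refine_def consistent_def dn by blast
          next
            case 5
            then show ?case using lenr words by simp
          next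
            case 6
            have "(?len + 1) * (120 + etime (Reg rs) + 12) \<le> (r + 1) * 150"
              using lenr by (intro mult_mono) auto
            then show ?case by simp
          qed
        qed (use \<rho> eW in auto)
      qed (use words in auto)
    qed (use \<rho> h R_pos words a av in auto)
  qed (use T in simp)
qed

section \<open>Scanning a constraint on the machine\<close>

lemma scan_length: "scan a C e = (c0, fd, ks) \<Longrightarrow> length ks \<le> e"
proof (induction e arbitrary: c0 fd ks)
  case (Suc e)
  obtain c0' fd' ks' where s: "scan a C e = (c0', fd', ks')" by (cases "scan a C e") auto
  show ?case using Suc.prems Suc.IH[OF s] by (auto simp: s split: if_splits)
qed simp

lemma cost_le:
  assumes "j < m" "C = cs ! j" "e < size_of C"
  shows "Cost I C (entry C e) \<le> M"
proof -
  have "2 + length (scope C) + e < 2 + length (scope (cs ! j)) + size_of (cs ! j)" using assms by simp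
  from input_offset(2)[OF assms(1) this] input_constraint(4)[OF assms]
  show ?thesis using input_nth_le by metis
qed

lemma scan_c0_le:
  assumes "j < m" "C = cs ! j" "e \<le> size_of C" "scan a C e = (c0, fd, ks)"
  shows "c0 \<le> M + 1"
  using assms(3,4)
proof (induction e arbitrary: c0 fd ks)
  case (Suc e)
  obtain c0' fd' ks' where s: "scan a C e = (c0', fd', ks')" by (cases "scan a C e") auto
  have "Cost I C (entry C e) \<le> M" using cost_le[OF assms(1,2)] Suc.prems by simp
  then show ?case using Suc.prems Suc.IH[OF _ s] by (auto simp: s split: if_splits)
qed simp

text \<open>Nothing is said about columns of other names or about rows outside the list, so rows
  left over from earlier pushes do no harm.\<close>

definition rows_hold :: "(nat \<Rightarrow> nat \<Rightarrow> nat) \<Rightarrow> nat \<Rightarrow> (nat \<Rightarrow> nat) list \<Rightarrow> bool" where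
  "rows_hold A k ks \<longleftrightarrow> (\<forall>i<length ks. \<forall>v\<in>Vars I. A (k + i) v = (ks ! i) v)"

lemma rows_hold_snoc:
  "rows_hold A k (ks @ [b]) \<longleftrightarrow> rows_hold A k ks \<and> (\<forall>v\<in>Vars I. A (k + length ks) v = b v)"
  by (auto simp: rows_hold_def nth_append less_Suc_eq)

lemma rows_hold_append:
  "rows_hold A k (ks @ ls) \<longleftrightarrow> rows_hold A k ks \<and> rows_hold A (k + length ks) ls"
proof (induction ls rule: rev_induct)
  case Nil
  then show ?case by (simp add: rows_hold_def)
next
  case (snoc l ls)
  then show ?case unfolding append_assoc[symmetric] rows_hold_snoc by (simp add: add.assoc)
qed

lemma rows_hold_cong:
  "(\<And>l. k \<le> l \<Longrightarrow> l < k + length ks \<Longrightarrow> A l = A' l) \<Longrightarrow> rows_hold A k ks \<longleftrightarrow> rows_hold A' k ks"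
  by (simp add: rows_hold_def)

definition time_try :: nat where "time_try = (n + 1) * 37 + (r + 1) * 150 + 10"

text \<open>The rows below \<open>h + 2\<close> are the current node, the best leaf and the
  remaining stack, so a scan must leave them unchanged. The children appear from row
  \<open>h + 2\<close> on.\<close>

definition scan_state :: "nat \<Rightarrow> (nat \<Rightarrow> nat) \<Rightarrow> nat \<Rightarrow> (nat \<Rightarrow> nat) \<Rightarrow> (nat \<Rightarrow> nat \<Rightarrow> nat) \<Rightarrow> nat \<Rightarrow> ram \<Rightarrow> bool" where
  "scan_state j a h \<rho>0 A0 e s \<longleftrightarrow> (\<exists>\<rho> A. s = st \<rho> A \<and> (\<forall>y<11. \<rho> y = \<rho>0 y) \<and> \<rho> re = e \<and>
     (\<forall>l<h + 2. A l = A0 l) \<and>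
     (case scan a (cs ! j) e of (c0, fd, ks) \<Rightarrow> \<rho> rc0 = c0 \<and> \<rho> rfd = of_bool fd \<and>
        \<rho> rh = h + length ks \<and> rows_hold A (h + 2) ks))"

lemma runs_scan_entry:
  assumes j: "j < m" and C: "C = cs ! j" and e: "e < size_of C"
    and \<rho>0: "\<rho>0 rn = n" "\<rho>0 rR = R" "\<rho>0 rB = B" "\<rho>0 rp = offset j" "\<rho>0 rs = length (scope C)"
    and h: "h + D + 2 < R"
    and a: "valid a" "\<And>v. v \<in> Vars I \<Longrightarrow> A0 0 v = a v"
    and inv: "scan_state j a h \<rho>0 A0 e s"
  shows "runs W (scan_entry q) s (time_try + 60)
    (\<lambda>s'. regs s' re = e \<and> scan_state j a h \<rho>0 A0 (Suc e) (s'\<lparr>regs := (regs s')(re := Suc e)\<rparr>))"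
    (is "runs _ _ _ _ ?Q")
proof -
  obtain c0 fd ks where sc: "scan a C e = (c0, fd, ks)" by (cases "scan a C e") auto
  obtain \<rho> A where s: "s = st \<rho> A" and r: "\<forall>y<11. \<rho> y = \<rho>0 y" "\<rho> re = e"
      "\<rho> rc0 = c0" "\<rho> rfd = of_bool fd" "\<rho> rh = h + length ks"
    and A: "\<forall>l<h + 2. A l = A0 l" "rows_hold A (h + 2) ks"
    using inv sc unfolding scan_state_def C by auto
  have CI: "C \<in># Constraints I" using j C by (simp add: m_def cs_constraint)
  have eD: "e < D" using e size_of_le[OF CI] by simp
  have len: "length ks \<le> e" using scan_length[OF sc] .
  have hR: "h + length ks + 2 < R" using h len eD by simp
  define c where "c = Suc (Cost I C (entry C e))"
  have cM: "c \<le> M + 1" using cost_le[OF j C e] by (simp add: c_def)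
  have c0M: "c0 \<le> M + 1" using scan_c0_le[OF j C _ sc] e by simp
  have prod: "c0 * (1 - of_bool fd) * (c - c0 + (c0 - c)) < W"
  proof -
    have "c0 * (1 - of_bool fd) * (c - c0 + (c0 - c)) \<le> ((M + 1) * 1) * (M + 1)"
      using cM c0M by (intro mult_mono) auto
    then show ?thesis using W_cost by simp
  qed
  \<comment> \<open>Identifies the arithmetic test of the program with the condition for discarding
    in \<open>scan_step\<close>.\<close>
  have prod0: "c0 * (1 - of_bool fd) * (c - c0 + (c0 - c)) = 0 \<longleftrightarrow> \<not> (c0 \<noteq> 0 \<and> \<not> fd \<and> c \<noteq> c0)"
    by auto
  have fin: "?Q (st \<rho>' A')"
    if "\<forall>y<11. \<rho>' y = \<rho> y" "\<rho>' re = e" "\<forall>l<h + 2. A' l = A l"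
      "scan a C (Suc e) = (c0', fd', ks')" "\<rho>' rc0 = c0'" "\<rho>' rfd = of_bool fd'"
      "\<rho>' rh = h + length ks'" "rows_hold A' (h + 2) ks'" for \<rho>' A' c0' fd' ks'
    using that A(1) r(1) unfolding scan_state_def C[symmetric]
    by (auto simp del: scan.simps intro!: exI[of _ "\<rho>'(re := Suc e)"] exI[of _ A'])
  show ?thesis unfolding scan_entry_def s
  proof (rule runs_Seq[where Ta = time_try and Tb = 55])
    show "runs W (try_entry q) (st \<rho> A) time_try (\<lambda>s'. runs W
      (Assign rc (Op Plus (Mem (Op Plus (Reg rp) (Op Plus (Op Plus (Num 2) (Reg rs)) (Reg re)))) (Num 1)) ;;
       Cond (Reg rok)
        (Cond (Op Times (Op Times (Reg rc0) (Op Monus (Num 1) (Reg rfd))) (Differ (Reg rc) (Reg rc0)))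
          (Assign rfd (Num 1))
          (Assign rh (Op Plus (Reg rh) (Num 1)) ;;
           Cond (Reg rc0) Skip (Assign rc0 (Reg rc))))
        Skip) s' 55 ?Q)"
    proof (rule runs_conseq[OF runs_try_entry[OF j C e, where a = a and h = "h + length ks"]], goal_cases)
      case (13 s')
      then obtain \<rho>' b where s': "s' = st \<rho>' (A(h + length ks + 2 := b))" and r': "\<forall>y<15. \<rho>' y = \<rho> y"
        "\<rho>' rok = of_bool (consistent a C e)" and b: "\<forall>v\<in>Vars I. b v = refine a C e v" by blast
      let ?A = "A(h + length ks + 2 := b)"
      have A': "\<forall>l<h + 2. ?A l = A l" "rows_hold ?A (h + 2) ks" "rows_hold ?A (h + 2) (ks @ [refine a C e])"
        using A(2) b rows_hold_cong[of "h + 2" ks ?A A] by (auto simp: rows_hold_snoc)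
      have off: "offset j + (2 + length (scope C) + e) < length input"
        using input_offset(2)[OF j, of "2 + length (scope C) + e"] e C by simp
      then have offW: "offset j + (2 + length (scope C) + e) < W"
        using length_input_le words by simp
      show ?case unfolding s'
      proof (rule runs_Assign_Seq[where v = c], goal_cases)
        case 1
        have "eval W (st \<rho>' ?A) (Op Plus (Reg rp) (Op Plus (Op Plus (Num 2) (Reg rs)) (Reg re))) =
            Some (offset j + (2 + length (scope C) + e))"
          using r' r \<rho>0 offW by simp
        then show ?case
          using layout_input[OF off, of ?A] input_constraint(4)[OF j C e] cM words
          by (simp add: c_def)
      next
        case 3
        let ?r = "\<rho>'(rc := c)"
        show ?case unfolding st_simps
        proof (rule runs_Cond[where v = "of_bool (consistent a C e)"], goal_cases)
          case 1
          show ?case using r' words by simp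
        next
          case 3
          then have con: "consistent a C e" by simp
          show ?case
          proof (rule runs_Cond[where v = "c0 * (1 - of_bool fd) * (c - c0 + (c0 - c))"], goal_cases)
            case 1
            have "c0 * (1 - of_bool fd) < W" using c0M words by (cases fd) auto
            moreover have "c - c0 + (c0 - c) < W" using c0M cM words by simp
            ultimately show ?case using r r' prod c0M cM words by simp
          next
            case 3
            then have "c0 \<noteq> 0 \<and> \<not> fd \<and> c \<noteq> c0" unfolding prod0 by simp
            then have "scan a C (Suc e) = (c0, True, ks)"
              using con by (simp add: sc c_def)
            then show ?case using r r' A' words fin[of "?r(rfd := 1)" ?A c0 True ks]
              by (intro runs_Assign[where v = 1]) (simp_all del: scan.simps)
          next
            case 4
            then have "\<not> (c0 \<noteq> 0 \<and> \<not> fd \<and> c \<noteq> c0)" unfolding prod0 .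
            then have sc': "scan a C (Suc e) = (if c0 = 0 then c else c0, fd, ks @ [refine a C e])"
              using con by (simp add: sc c_def)
            show ?case
            proof (rule runs_Assign_Seq[where v = "h + length (ks @ [refine a C e])"], goal_cases)
              case 1
              show ?case using r r' hR words by simp
            next
              case 3
              show ?case unfolding st_simps
              proof (rule runs_Cond[where v = c0], goal_cases)
                case 1
                show ?case using r r' c0M words by simp
              next
                case 3
                then show ?case
                  using r r' A' sc' fin[of "?r(rh := h + length (ks @ [refine a C e]))" ?A c0 fd "ks @ [refine a C e]"]
                  by (intro runs_Skip) (simp_all del: scan.simps)
              next
                case 4
                then show ?case
                  using r r' A' sc' cM words
                    fin[of "?r(rh := h + length (ks @ [refine a C e]), rc0 := c)" ?A c fd "ks @ [refine a C e]"]
                  by (intro runs_Assign[where v = c]) (simp_all del: scan.simps)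
              qed simp
            qed simp
          qed simp
        next
          case 4
          then have "scan a C (Suc e) = (c0, fd, ks)" by (simp add: sc)
          then show ?case using r r' A' fin[of ?r ?A c0 fd ks]
            by (intro runs_Skip) (simp_all del: scan.simps)
        qed simp
      qed simp
    qed (use r \<rho>0 hR a A in \<open>auto simp: time_try_def\<close>)
  qed simp
qed

definition time_constraint :: nat where
  "time_constraint = (D + 1) * (time_try + 80) + (r + 1) * 30 + 80"

text \<open>After a discard nothing is claimed about \<open>racc\<close> and \<open>rp\<close>,
  because the remaining constraints are skipped. Otherwise the tentative children are dropped by
  restoring the height, and \<open>rp\<close> moves on to the next constraint.\<close>

lemma runs_scan_constraint:
  assumes j: "j < m" and C: "C = cs ! j"
    and \<rho>: "\<rho> rn = n" "\<rho> rR = R" "\<rho> rB = B" "\<rho> rp = offset j" "\<rho> rh = h" "\<rho> rfd = 0" "\<rho> racc = acc"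
    and h: "h + D + 2 < R"
    and a: "valid a" "\<And>v. v \<in> Vars I \<Longrightarrow> A 0 v = a v"
    and acc: "acc + M * M < W"
    and sc: "scan a C (size_of C) = (c0, fd, ks)"
  shows "runs W (scan_constraint q) (st \<rho> A) time_constraint (\<lambda>s. \<exists>\<rho>' A'. s = st \<rho>' A' \<and>
    (\<forall>y<6. \<rho>' y = \<rho> y) \<and> (\<forall>l<h + 2. A' l = A l) \<and> \<rho>' rfd = of_bool fd \<and>
    (if fd then \<rho>' rh = h + length ks \<and> rows_hold A' (h + 2) ks
     else \<rho>' rh = h \<and> \<rho>' racc = acc + count (Constraints I) C * (c0 - 1) \<and> \<rho>' rp = offset (Suc j)))"
    (is "runs _ _ _ _ ?Q")
proof -
  let ?len = "length (scope C)"
  have CI: "C \<in># Constraints I" using j C by (simp add: m_def cs_constraint)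
  have ND: "size_of C \<le> D" using size_of_le[OF CI] .
  have lenr: "?len \<le> r" using length_scope_le[OF CI] .
  have off: "offset j < length input" "offset j + 1 < length input" "offset (Suc j) \<le> length input"
    using input_offset(2)[OF j, of 0] input_offset(2)[OF j, of 1] offset_mono[of "Suc j" m] j
    by (simp_all add: length_input)
  then have offW: "offset j < W" "offset j + 1 < W" "offset (Suc j) < W" using length_input_le words by simp_all
  have cnt: "count (Constraints I) C \<le> M"
    using input_nth_le[OF off(2)] input_constraint(2)[OF j C] by simp
  have c0M: "c0 \<le> M + 1" using scan_c0_le[OF j C order_refl sc] .
  have prod: "count (Constraints I) C * (c0 - 1) \<le> M * M" using cnt c0M by (intro mult_mono) auto
  let ?\<rho>1 = "\<rho>(rs := ?len, rN := 1)"
  let ?\<rho>2 = "?\<rho>1(rt := ?len, rN := size_of C)"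
  let ?\<rho>3 = "?\<rho>2(rh0 := h, rc0 := 0)"
  let ?fin = "Cond (Reg rfd) Skip
      (Assign rh (Reg rh0) ;;
       Assign racc (Op Plus (Reg racc)
         (Op Times (Mem (Op Plus (Reg rp) (Num 1))) (Op Monus (Reg rc0) (Num 1)))) ;;
       Assign rp (Op Plus (Op Plus (Reg rp) (Num 2)) (Op Plus (Reg rs) (Reg rN))))"
  have part3: "runs W ?fin s 40 ?Q" if inv: "scan_state j a h ?\<rho>3 A (size_of C) s" for s
  proof -
    obtain \<rho>' A' where s: "s = st \<rho>' A'" and r: "\<forall>y<11. \<rho>' y = ?\<rho>3 y" "\<rho>' rc0 = c0"
        "\<rho>' rfd = of_bool fd" "\<rho>' rh = h + length ks"
      and A': "\<forall>l<h + 2. A' l = A l" "rows_hold A' (h + 2) ks"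
      using inv sc unfolding scan_state_def C by auto
    show ?thesis unfolding s
    proof (rule runs_Cond[where v = "of_bool fd"], goal_cases)
      case 1
      show ?case using r words by simp
    next
      case 3
      then have fd by simp
      moreover have "\<forall>y<6. \<rho>' y = \<rho> y" using r by simp
      ultimately have "?Q (st \<rho>' A')" using r A' by (intro exI[of _ \<rho>'] exI[of _ A']) simp
      then show ?case by (intro runs_Skip) auto
    next
      case 4
      then have fd: "\<not> fd" by simp
      show ?case
      proof (rule runs_Assign_Seq[where v = h], goal_cases)
        case 1
        show ?case using r h words by simp
      next
        case 3
        show ?case unfolding st_simps
        proof (rule runs_Assign_Seq[where v = "acc + count (Constraints I) C * (c0 - 1)"], goal_cases)
          case 1
          have "count (Constraints I) C * (c0 - Suc 0) < W" using prod acc by simp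
          then show ?case using r \<rho> offW words layout_input[OF off(2), of A']
              input_constraint(2)[OF j C] cnt c0M prod acc by simp
        next
          case 3
          have e: "offset (Suc j) = offset j + 2 + (?len + size_of C)" by (simp add: offset_Suc C)
          let ?r = "\<rho>'(rh := h, racc := acc + count (Constraints I) C * (c0 - 1), rp := offset (Suc j))"
          have "?Q (st ?r A')" using r A' fd
            by (intro exI[of _ ?r] exI[of _ A']) simp
          then show ?case unfolding st_simps using r \<rho> offW(3)
            by (intro runs_Assign[where v = "offset (Suc j)"]) (simp_all add: e)
        qed simp
      qed simp
    qed simp
  qed
  have part2: "runs W (For re (Reg rN) (scan_entry q) ;; ?fin) (st ?\<rho>3 A) ((D + 1) * (time_try + 80) + 41) ?Q"
  proof (rule runs_Seq[where Ta = "(D + 1) * (time_try + 80)" and Tb = 40])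
    show "runs W (For re (Reg rN) (scan_entry q)) (st ?\<rho>3 A) ((D + 1) * (time_try + 80)) (\<lambda>s. runs W ?fin s 40 ?Q)"
    proof (rule runs_For[where Inv = "scan_state j a h ?\<rho>3 A" and k = "size_of C" and T = "time_try + 60"], goal_cases)
      case 1
      show ?case unfolding st_simps scan_state_def
        by (intro exI conjI, rule refl) (use \<rho> in \<open>auto simp: rows_hold_def\<close>)
    next
      case (2 e s)
      then show ?case using ND words unfolding scan_state_def by auto
    next
      case (3 e s)
      then show ?case by (intro runs_scan_entry[OF j C]) (use \<rho> h a in auto)
    next
      case (4 s)
      then show ?case by (rule part3)
    next
      case 5
      show ?case using ND words by simp
    next
      case 6
      show ?case using ND by (intro mult_mono) auto
    qed
  qed simp
  have part1: "runs W (For rt (Reg rs) (Assign rN (Op Times (Reg rN) (Num (q + 1))))) (st ?\<rho>1 A) ((r + 1) * 30)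
      (\<lambda>s. s = st ?\<rho>2 A)"
  proof (rule runs_For[where Inv = "\<lambda>t s. s = st (?\<rho>1(rt := t, rN := (q + 1) ^ t)) A" and k = ?len and T = 10], goal_cases)
    case 1
    show ?case by (simp add: fun_upd_twist)
  next
    case (2 t s)
    then show ?case using lenr words by simp
  next
    case (3 t s)
    have "(q + 1) ^ Suc t \<le> D" unfolding D_def using 3 lenr by (intro power_increasing) auto
    moreover have "(q + 1) ^ t \<le> (q + 1) ^ Suc t" by (intro power_increasing) auto
    ultimately have le: "(q + 1) ^ t < W" "(q + 1) ^ t * (q + 1) < W" using words by (simp_all add: mult.commute)
    show ?case unfolding 3(2)
    proof (rule runs_Assign[where v = "(q + 1) ^ Suc t"], goal_cases)
      case 1
      show ?case using le words by (simp add: mult.commute)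
    next
      case 3
      show ?case unfolding st_simps by (simp add: fun_upd_twist)
    qed simp
  next
    case (4 s)
    then show ?case by (simp add: size_of_def)
  next
    case 5
    show ?case using lenr words by simp
  next
    case 6
    show ?case using lenr by (intro mult_mono) auto
  qed
  show ?thesis unfolding scan_constraint_def
  proof (rule runs_Assign_Seq[where v = ?len], goal_cases)
    case 1
    show ?case using \<rho> offW layout_input[OF off(1), of A] input_constraint(1)[OF j C] lenr words by simp
  next
    case 3
    show ?case unfolding st_simps
    proof (rule runs_Assign_Seq[where v = 1], goal_cases)
      case 1
      show ?case using words by simp
    next
      case 3
      show ?case unfolding st_simps
      proof (rule runs_Seq[where Ta = "(r + 1) * 30" and Tb = "(D + 1) * (time_try + 80) + 60"], goal_cases)
        case 1
        show ?case
        proof (rule runs_conseq[OF part1 order_refl])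
          fix s assume s: "s = st ?\<rho>2 A"
          show "runs W (Assign rh0 (Reg rh) ;; Assign rc0 (Num 0) ;; For re (Reg rN) (scan_entry q) ;; ?fin) s
              ((D + 1) * (time_try + 80) + 60) ?Q" unfolding s
          proof (rule runs_Assign_Seq[where v = h], goal_cases)
            case 1
            show ?case using \<rho> h words by simp
          next
            case 3
            show ?case unfolding st_simps
            proof (rule runs_Assign_Seq[where v = 0], goal_cases)
              case 1
              show ?case using words by simp
            next
              case 3
              show ?case unfolding st_simps by (rule runs_conseq[OF part2]) simp_all
            qed simp
          qed simp
        qed
      next
        case 2
        show ?case by (simp add: time_constraint_def)
      qed
    qed (simp add: time_constraint_def)
  qed (simp add: time_constraint_def)
qed

section \<open>Expanding a node on the machine\<close>

definition time_expand :: nat where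
  "time_expand = (m + 1) * (time_constraint + 20)"

lemma expand_not_found: "expand a j = (acc, False, ks) \<Longrightarrow> ks = []"
  by (induction j arbitrary: acc ks) (auto split: prod.splits if_splits elim!: expand_step.elims)

lemma runs_expand:
  assumes \<rho>: "\<rho> rn = n" "\<rho> rm = m" "\<rho> rR = R" "\<rho> rB = B" "\<rho> rp = 2 + n" "\<rho> rh = h" "\<rho> rfd = 0" "\<rho> racc = 0"
    and h: "h + D + 2 < R"
    and a: "valid a" "\<And>v. v \<in> Vars I \<Longrightarrow> A 0 v = a v"
    and ex: "expand a m = (acc, fd, ks)"
  shows "runs W (For rj (Reg rm) (Cond (Reg rfd) Skip (scan_constraint q))) (st \<rho> A) time_expand
    (\<lambda>s. \<exists>\<rho>' A'. s = st \<rho>' A' \<and> (\<forall>y<5. \<rho>' y = \<rho> y) \<and> (\<forall>l<h + 2. A' l = A l) \<and>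
      \<rho>' rfd = of_bool fd \<and> \<rho>' rh = h + length ks \<and> rows_hold A' (h + 2) ks \<and>
      (\<not> fd \<longrightarrow> \<rho>' racc = acc \<and> acc \<le> m * (M * M)))"
proof -
  define Inv where "Inv j s \<longleftrightarrow> (\<exists>\<rho>' A'. s = st \<rho>' A' \<and> (\<forall>y<5. \<rho>' y = \<rho> y) \<and> (\<forall>l<h + 2. A' l = A l) \<and>
      \<rho>' rj = j \<and> (case expand a j of (acc, fd, ks) \<Rightarrow>
      \<rho>' rfd = of_bool fd \<and> \<rho>' rh = h + length ks \<and> rows_hold A' (h + 2) ks \<and>
      (\<not> fd \<longrightarrow> \<rho>' racc = acc \<and> \<rho>' rp = offset j \<and> acc \<le> j * (M * M))))" for j s
  show ?thesis
  proof (rule runs_For[where Inv = Inv and k = m and T = "time_constraint + 5"], goal_cases)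
    case 1
    show ?case unfolding Inv_def st_simps
      by (intro exI conjI, rule refl) (use \<rho> in \<open>auto simp: rows_hold_def offset_def\<close>)
  next
    case (2 j s)
    then show ?case using \<rho> words unfolding Inv_def by auto
  next
    case (3 j s)
    obtain acc fd ks where ex: "expand a j = (acc, fd, ks)" by (cases "expand a j") auto
    obtain \<rho>' A' where s: "s = st \<rho>' A'" and r: "\<forall>y<5. \<rho>' y = \<rho> y" "\<rho>' rj = j" "\<rho>' rfd = of_bool fd"
        "\<rho>' rh = h + length ks" "\<not> fd \<longrightarrow> \<rho>' racc = acc \<and> \<rho>' rp = offset j \<and> acc \<le> j * (M * M)"
      and A': "\<forall>l<h + 2. A' l = A l" "rows_hold A' (h + 2) ks"
      using 3(2) ex unfolding Inv_def by auto
    let ?Q = "\<lambda>s'. regs s' rj = j \<and> Inv (Suc j) (s'\<lparr>regs := (regs s')(rj := Suc j)\<rparr>)"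
    have fin: "?Q (st \<rho>'' A'')"
      if "\<forall>y<5. \<rho>'' y = \<rho> y" "\<rho>'' rj = j" "\<forall>l<h + 2. A'' l = A l"
        "expand a (Suc j) = (acc', fd', ks')" "\<rho>'' rfd = of_bool fd'" "\<rho>'' rh = h + length ks'"
        "rows_hold A'' (h + 2) ks'"
        "\<not> fd' \<longrightarrow> \<rho>'' racc = acc' \<and> \<rho>'' rp = offset (Suc j) \<and> acc' \<le> Suc j * (M * M)"
      for \<rho>'' A'' acc' fd' ks'
      using that unfolding Inv_def
      by (auto simp del: expand.simps mult_Suc intro!: exI[of _ "\<rho>''(rj := Suc j)"] exI[of _ A''])
    show ?case unfolding s
    proof (rule runs_Cond[where v = "of_bool fd"], goal_cases)
      case 1
      show ?case using r words by simp
    next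
      case 3
      then have fd by simp
      then have "expand a (Suc j) = (acc, True, ks)" using ex by simp
      from fin[OF r(1,2) A'(1) this] have "?Q (st \<rho>' A')" using r A' \<open>fd\<close> by simp
      then show ?case by (intro runs_Skip) (auto simp: time_constraint_def)
    next
      case 4
      then have fd: "\<not> fd" by simp
      \<comment> \<open>Hence the stack still has height \<open>h\<close>, and this scan starts
        pushing at the same row as all earlier ones.\<close>
      then have ks: "ks = []" using ex expand_not_found by simp
      obtain c0 fd' ks' where sc: "scan a (cs ! j) (size_of (cs ! j)) = (c0, fd', ks')"
        by (cases "scan a (cs ! j) (size_of (cs ! j))") auto
      have ex': "expand a (Suc j) =
          (if fd' then (acc, True, ks') else (acc + count (Constraints I) (cs ! j) * (c0 - 1), False, []))"
        using ex fd sc by simp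
      \<comment> \<open>Each constraint handled so far added at most \<open>M * M\<close> to the
        accumulator. This leaves room for one more summand of that size below the word
        bound.\<close>
      have "Suc j * (M * M) \<le> m * (M * M)" using 3 by (intro mult_right_mono) auto
      then have accW: "acc + M * M < W" using r(5) fd W_cost by (simp add: m_def)
      have off: "offset j + 1 < length input" using input_offset(2)[OF 3(1), of 1] by simp
      have "count (Constraints I) (cs ! j) \<le> M"
        using input_nth_le[OF off] input_constraint(2)[OF 3(1) refl] by simp
      then have le: "count (Constraints I) (cs ! j) * (c0 - 1) \<le> M * M"
        using scan_c0_le[OF 3(1) refl order_refl sc] by (intro mult_mono) auto
      show ?case
      proof (rule runs_conseq[OF runs_scan_constraint[OF 3(1) refl, where \<rho> = \<rho>' and A = A' and h = h and
            acc = acc and a = a and ?c0.0 = c0 and fd = fd' and ks = ks']], goal_cases)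
        case (14 s')
        then obtain \<rho>'' A'' where s': "s' = st \<rho>'' A''" "\<forall>y<6. \<rho>'' y = \<rho>' y" "\<forall>l<h + 2. A'' l = A' l"
            "\<rho>'' rfd = of_bool fd'"
          and if': "if fd' then \<rho>'' rh = h + length ks' \<and> rows_hold A'' (h + 2) ks'
            else \<rho>'' rh = h \<and> \<rho>'' racc = acc + count (Constraints I) (cs ! j) * (c0 - 1) \<and> \<rho>'' rp = offset (Suc j)"
          by blast
        have 1: "\<forall>y<5. \<rho>'' y = \<rho> y" "\<rho>'' rj = j" "\<forall>l<h + 2. A'' l = A l"
          using s' r A' by simp_all
        show ?case
        proof (cases fd')
          case True
          then show ?thesis using fin[OF 1 ex'[simplified True if_True]] if' s' by simp
        next
          case False
          have "acc + count (Constraints I) (cs ! j) * (c0 - 1) \<le> Suc j * (M * M)"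
            using le r(5) fd by simp
          then show ?thesis using fin[OF 1 ex'[simplified False if_False]] if' s' False
            by (simp add: rows_hold_def)
        qed
      qed (use \<rho> r h a A' fd ks accW sc in auto)
    qed simp
  next
    case (4 s)
    then show ?case unfolding Inv_def ex prod.case by blast
  next
    case 5
    show ?case using words by simp
  next
    case 6
    show ?case unfolding time_expand_def by (intro mult_mono) auto
  qed
qed

section \<open>The potential and the search loop\<close>

text \<open>The factor beyond \<open>b\<^sup>u\<close> accounts for the inner nodes of the search tree.\<close>

definition weight :: "(nat \<Rightarrow> nat) \<Rightarrow> real" where
  "weight a = branch_base q r ^ card (free a) * (real (card (free a)) + 1)"

definition potential :: "(nat \<Rightarrow> nat) list \<Rightarrow> real" where
  "potential stk = (\<Sum>a\<leftarrow>stk. weight a)"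

lemma weight_ge_1: "weight a \<ge> 1"
proof -
  have "1 * 1 \<le> branch_base q r ^ card (free a) * (real (card (free a)) + 1)"
    using branch_base_ge_1[OF q_pos r_pos] by (intro mult_mono one_le_power) auto
  then show ?thesis by (simp add: weight_def)
qed

lemma potential_nonneg: "potential stk \<ge> 0"
  unfolding potential_def by (intro sum_list_nonneg) (auto intro: order_trans[OF _ weight_ge_1])

text \<open>Let \<open>f\<close> be the number of free variables of \<open>a\<close>. There are at
  most b^u children, each of weight b^(f-u) * (f-u+1), so together they weigh at most b^f * (f+1) -
  b^f * u. The difference b^f * u is at least 1 and pays for visiting \<open>a\<close>.\<close>

lemma weight_branch:
  assumes "u \<ge> 1" "u \<le> r" "u \<le> card (free a)" "length ks < (q + 1) ^ u"
    and "\<forall>k\<in>set ks. card (free k) = card (free a) - u"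
  shows "potential ks + 1 \<le> weight a"
proof -
  let ?b = "branch_base q r" let ?f = "card (free a)"
  have b: "?b \<ge> 1" using branch_base_ge_1[OF q_pos r_pos] .
  have "potential ks = (\<Sum>k\<leftarrow>ks. ?b ^ (?f - u) * (real (?f - u) + 1))"
    unfolding potential_def weight_def using assms(5)
    by (intro arg_cong[of _ _ sum_list] map_cong) auto
  also have "\<dots> = real (length ks) * (?b ^ (?f - u) * (real (?f - u) + 1))"
    by (simp add: sum_list_triv)
  also have "\<dots> \<le> ?b ^ u * (?b ^ (?f - u) * (real (?f - u) + 1))"
  proof (intro mult_right_mono)
    have "real (length ks) + 1 \<le> real ((q + 1) ^ u)" using assms(4) by linarith
    then show "real (length ks) \<le> ?b ^ u"
      using branches_le_base_power[OF q_pos assms(1,2)] by (simp add: add.commute)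
  qed (use b in auto)
  also have "\<dots> = ?b ^ ?f * (real ?f - real u + 1)"
    using assms(3) by (simp add: power_add[symmetric] of_nat_diff)
  finally have 1: "potential ks \<le> ?b ^ ?f * (real ?f - real u + 1)" .
  have "1 * 1 \<le> ?b ^ ?f * real u" using b assms(1) by (intro mult_mono one_le_power) auto
  then show ?thesis using 1 unfolding weight_def by (simp add: algebra_simps)
qed

definition time_node :: nat where
  "time_node = time_expand + (n + 1) * 120 + 60"

text \<open>Relates the ghost triple of stack, best cost plus one and best leaf to the machine. Row
  1 is meaningful only once a leaf is known, and the bound on \<open>bc\<close> ensures that
  comparisons with it do not overflow.\<close>

fun node_state :: "(nat \<Rightarrow> nat) list \<times> nat \<times> (nat \<Rightarrow> nat) \<Rightarrow> ram \<Rightarrow> bool" where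
  "node_state (stk, bc, b) s \<longleftrightarrow> (\<exists>\<rho> A. s = st \<rho> A \<and>
     \<rho> rn = n \<and> \<rho> rm = m \<and> \<rho> rR = R \<and> \<rho> rB = B \<and> \<rho> rh = length stk \<and> \<rho> rbest = bc \<and>
     rows_hold A 2 stk \<and> (bc \<noteq> 0 \<longrightarrow> (\<forall>v\<in>Vars I. A 1 v = b v)) \<and>
     bc \<le> m * (M * M) + n + 1 \<and> search_inv stk bc b)"

lemma runs_count_wildcards:
  assumes \<rho>: "\<rho> rn = n" "\<rho> rR = R" "\<rho> rB = B" "\<rho> racc = acc"
    and a: "valid a" "\<And>v. v \<in> Vars I \<Longrightarrow> A 0 v = a v" and acc: "acc + n < W"
    and T: "(n + 1) * 40 \<le> T"
  shows "runs W (For ri (Reg rn) (Cond (Mem (Addr VarName (Num 0))) Skip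
      (Assign racc (Op Plus (Reg racc) (Num 1))))) (st \<rho> A) T
    (\<lambda>s. s = st (\<rho>(racc := acc + card {v \<in> Vars I. a v = 0}, ri := n)) A)"
proof -
  define cnt where "cnt i = card {v \<in> set (take i vs). a v = 0}" for i
  have cnt_le: "cnt i \<le> i" for i
  proof -
    have "cnt i \<le> card (set (take i vs))" unfolding cnt_def by (intro card_mono) auto
    also have "\<dots> \<le> i" using card_length[of "take i vs"] by simp
    finally show ?thesis .
  qed
  have cnt_Suc: "cnt (Suc i) = (if a (vs ! i) = 0 then Suc (cnt i) else cnt i)" if i: "i < n" for i
  proof -
    have t: "set (take (Suc i) vs) = insert (vs ! i) (set (take i vs))"
      using i by (simp add: take_Suc_conv_app_nth n_def)
    have nin: "vs ! i \<notin> set (take i vs)"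
      using distinct_vs i by (auto simp: in_set_conv_nth n_def nth_eq_iff_index_eq)
    have "{v \<in> set (take (Suc i) vs). a v = 0} =
        (if a (vs ! i) = 0 then insert (vs ! i) {v \<in> set (take i vs). a v = 0}
         else {v \<in> set (take i vs). a v = 0})" unfolding t by auto
    then show ?thesis unfolding cnt_def using nin by simp
  qed
  let ?r = "\<lambda>i. \<rho>(racc := acc + cnt i, ri := i)"
  show ?thesis
  proof (rule runs_For[where Inv = "\<lambda>i s. s = st (?r i) A" and k = n and T = 25], goal_cases)
    case 1
    show ?case using \<rho> by (auto simp: cnt_def fun_upd_idem)
  next
    case (2 i s)
    then show ?case using \<rho> words by simp
  next
    case (3 i s)
    have aW: "a (vs ! i) < W" using a(1) nth_vs(1)[OF 3(1)] words by (auto simp: valid_def intro: le_less_trans)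
    have accW: "Suc (acc + cnt i) < W" using acc cnt_le[of i] 3(1) by simp
    show ?case unfolding 3(2)
    proof (rule runs_Cond[where v = "a (vs ! i)"], goal_cases)
      case 1
      have "eval W (st (?r i) A) (Mem (Addr VarName (Num 0))) = Some (A 0 (vs ! i))"
        using \<rho> 3(1) nth_vs[OF 3(1)] words R_pos a(2) aW
        by (intro eval_Mem_Addr eval_VarName) auto
      then show ?case using a(2)[OF nth_vs(1)[OF 3(1)]] by simp
    next
      case 3
      then show ?case using cnt_Suc[OF \<open>i < n\<close>] by (intro runs_Skip) simp_all
    next
      case 4
      then show ?case using cnt_Suc[OF \<open>i < n\<close>] accW words
        by (intro runs_Assign[where v = "Suc (acc + cnt i)"]) (simp_all add: fun_upd_twist)
    qed simp
  next
    case (4 s)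
    have "cnt n = card {v \<in> Vars I. a v = 0}" by (simp add: cnt_def n_def set_vs)
    then show ?case using 4 by simp
  next
    case 5
    show ?case using words by simp
  next
    case 6
    show ?case using T by simp
  qed
qed

text \<open>The potential drops in both cases: a leaf disappears together with its weight, which is
  at least 1, and a branching is handled by \<open>weight_branch\<close>.\<close>

lemma runs_process_node:
  assumes inv: "node_state (stk @ [a], bc, b) s"
  shows "runs W (process_node q) s time_node
    (\<lambda>s'. \<exists>g. node_state g s' \<and> potential (fst g) + 1 \<le> potential (stk @ [a]))" (is "runs _ _ _ _ ?Q")
proof -
  obtain \<rho> A where s: "s = st \<rho> A" and \<rho>: "\<rho> rn = n" "\<rho> rm = m" "\<rho> rR = R" "\<rho> rB = B"
      "\<rho> rh = Suc (length stk)" "\<rho> rbest = bc"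
    and A: "rows_hold A 2 (stk @ [a])" "bc \<noteq> 0 \<longrightarrow> (\<forall>v\<in>Vars I. A 1 v = b v)"
    and bc: "bc \<le> m * (M * M) + n + 1" and si: "search_inv (stk @ [a]) bc b"
    using inv by auto
  define h where "h = length stk"
  have a: "valid a" using si by (simp add: search_inv_def)
  \<comment> \<open>This is the position clause of the search invariant for the popped node. It
    guarantees room for all its children.\<close>
  have "h \<le> n * D" using si unfolding search_inv_def
    by (auto simp: h_def n_def D_def dest!: spec[of _ "length stk"])
  then have hR: "h + D + 2 < R" "h + 2 < R" by (simp_all add: R_def)
  have Aa: "\<And>v. v \<in> Vars I \<Longrightarrow> A (h + 2) v = a v" using A(1) by (simp add: rows_hold_snoc h_def)
  have av: "\<And>v. v \<in> Vars I \<Longrightarrow> a v \<le> q + 1" using a by (simp add: valid_def)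
  obtain acc fd ks where ex: "expand a m = (acc, fd, ks)" by (cases "expand a m") auto
  let ?\<rho>1 = "\<rho>(rh := h, ri := n)"
  let ?A1 = "A(0 := \<lambda>v. if v \<in> Vars I then A (h + 2) v else A 0 v)"
  let ?\<rho>2 = "?\<rho>1(racc := 0, rfd := 0, rp := 2 + n)"
  let ?better = "Cond (Op Plus (Op Monus (Num 1) (Reg rbest)) (Op Monus (Reg rbest) (Reg rc)))
        (Assign rbest (Reg rc) ;; copy_row (Num 1) (Num 0)) Skip"
  let ?leaf = "Cond (Reg rfd) Skip
      (For ri (Reg rn) (Cond (Mem (Addr VarName (Num 0))) Skip
         (Assign racc (Op Plus (Reg racc) (Num 1)))) ;;
       Assign rc (Op Plus (Reg racc) (Num 1)) ;; ?better)"
  let ?loop = "For rj (Reg rm) (Cond (Reg rfd) Skip (scan_constraint q))"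
  have leaf: "runs W ?leaf (st \<rho>' A') ((n + 1) * 75 + 40) ?Q"
    if r: "\<forall>y<5. \<rho>' y = \<rho> y" "\<rho>' rfd = of_bool fd" "\<rho>' rh = h + length ks"
        "\<not> fd \<longrightarrow> \<rho>' racc = acc \<and> acc \<le> m * (M * M)"
      and A': "\<forall>l<h + 2. A' l = ?A1 l" "rows_hold A' (h + 2) ks" for \<rho>' A'
  proof -
    \<comment> \<open>The remaining stack occupies rows 2 to \<open>h + 1\<close>, which the
      expansion does not touch.\<close>
    have stk: "rows_hold A' 2 stk"
      using A(1) A'(1) rows_hold_cong[of 2 stk A' A] by (simp add: rows_hold_snoc h_def)
    have best: "A' 1 = A 1" "\<And>v. v \<in> Vars I \<Longrightarrow> A' 0 v = a v" using A'(1) Aa by auto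
    show ?thesis
    proof (rule runs_Cond[where v = "of_bool fd"], goal_cases)
      case 1
      show ?case using r words by simp
    next
      case 3
      then have fd: "fd" by simp
      have "expand a (length cs) = (acc, True, ks)" using ex fd by (simp add: m_def)
      note br = search_inv_branch[OF si this]
      have rows: "rows_hold A' 2 (stk @ ks)"
        using stk A'(2) by (simp add: rows_hold_append h_def add.commute)
      have "node_state (stk @ ks, bc, b) (st \<rho>' A')"
        unfolding node_state.simps
      proof (intro exI conjI)
        show "st \<rho>' A' = st \<rho>' A'" ..
      qed (use r \<rho> rows A best bc br(1) in \<open>simp_all add: h_def\<close>)
      moreover have "potential ks + 1 \<le> weight a" using br(2) weight_branch by blast
      then have "potential (fst (stk @ ks, bc, b)) + 1 \<le> potential (stk @ [a])"
        by (simp add: potential_def)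
      ultimately have "?Q (st \<rho>' A')" by blast
      then show ?case by (intro runs_Skip) simp_all
    next
      case 4
      then have fd: "\<not> fd" by simp
      define c where "c = acc + card {v \<in> Vars I. a v = 0}"
      have "card {v \<in> Vars I. a v = 0} \<le> n"
        unfolding n_def length_vs by (intro card_mono) auto
      then have cle: "c \<le> m * (M * M) + n" using r(4) fd by (simp add: c_def)
      have cW: "Suc c < W" "bc < W" using cle bc W_cost by (simp_all add: m_def n_def)
      have leafinv: "if bc = 0 \<or> Suc c < bc then search_inv stk (Suc c) a else search_inv stk bc b"
        unfolding c_def using ex fd by (intro search_inv_leaf[OF si, of acc ks]) (simp add: m_def)
      have pot: "potential (fst (stk, bc', b')) + 1 \<le> potential (stk @ [a])" for bc' :: nat and b' :: "nat \<Rightarrow> nat"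
        using weight_ge_1[of a] by (simp add: potential_def)
      have ks: "ks = []" using ex fd expand_not_found by simp
      let ?r1 = "\<rho>'(racc := c, ri := n)" let ?r2 = "?r1(rc := Suc c)" let ?r3 = "?r2(rbest := Suc c)"
      have b1: "runs W ?better (st ?r2 A') ((n + 1) * 35 + 20) ?Q"
      proof (rule runs_Cond[where v = "(1 - bc) + (bc - Suc c)"], goal_cases)
        case 1
        have "(1 - bc) + (bc - Suc c) < W" using cW words by simp
        then show ?case using r \<rho> cW words by simp
      next
        case 3
        then have better: "bc = 0 \<or> Suc c < bc" by auto
        show ?case
        proof (rule runs_Assign_Seq[where v = "Suc c"], goal_cases)
          case 1
          show ?case using cW by simp
        next
          case 3
          show ?case unfolding st_simps
          proof (rule runs_conseq[OF runs_copy_row[where ?l1.0 = 1 and ?l2.0 = 0]], goal_cases)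
            case (12 s')
            let ?A2 = "A'(1 := \<lambda>v. if v \<in> Vars I then A' 0 v else A' 1 v)"
            have "node_state (stk, Suc c, a) (st (?r3(ri := n)) ?A2)"
              unfolding node_state.simps
            proof (intro exI conjI)
              show "st (?r3(ri := n)) ?A2 = st (?r3(ri := n)) ?A2" ..
              show "rows_hold ?A2 2 stk" using stk rows_hold_cong[of 2 stk ?A2 A'] by simp
            qed (use r \<rho> best cle leafinv better ks in \<open>simp_all add: h_def\<close>)
            then show ?case unfolding 12 using pot by blast
          qed (use r \<rho> R_pos words best av hR in auto)
        qed simp
      next
        case 4
        then have "\<not> (bc = 0 \<or> Suc c < bc)" by auto
        then have si': "search_inv stk bc b" using leafinv by simp
        have "node_state (stk, bc, b) (st ?r2 A')"
          unfolding node_state.simps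
        proof (intro exI conjI)
          show "st ?r2 A' = st ?r2 A'" ..
        qed (use r \<rho> A best bc si' ks stk in \<open>simp_all add: h_def\<close>)
        then have "?Q (st ?r2 A')" using pot by blast
        then show ?case by (intro runs_Skip) simp_all
      qed simp
      show ?case
      proof (rule runs_Seq[where Ta = "(n + 1) * 40" and Tb = "(n + 1) * 35 + 25"], goal_cases)
        case 1
        show ?case
        proof (rule runs_conseq[OF runs_count_wildcards[where a = a and acc = acc]], goal_cases)
          case (10 s')
          show ?case unfolding 10 c_def[symmetric]
          proof (rule runs_Assign_Seq[where v = "Suc c"], goal_cases)
            case 1
            show ?case using cW words by simp
          next
            case 3
            show ?case unfolding st_simps by (rule runs_conseq[OF b1]) simp_all
          qed simp
        qed (use r \<rho> a best fd W_cost in \<open>auto simp: m_def n_def\<close>)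
      qed simp
    qed simp
  qed
  have main: "runs W (?loop ;; ?leaf) (st ?\<rho>2 ?A1) (time_expand + (n + 1) * 75 + 41) ?Q"
  proof (rule runs_Seq[where Ta = time_expand and Tb = "(n + 1) * 75 + 40"], goal_cases)
    case 1
    show ?case
    proof (rule runs_conseq[OF runs_expand[where a = a and h = h and acc = acc and fd = fd and ks = ks]], goal_cases)
      case (14 s')
      then obtain \<rho>' A' where s': "s' = st \<rho>' A'" and r: "\<forall>y<5. \<rho>' y = ?\<rho>2 y" "\<rho>' rfd = of_bool fd"
        "\<rho>' rh = h + length ks" "\<not> fd \<longrightarrow> \<rho>' racc = acc \<and> acc \<le> m * (M * M)"
        and A': "\<forall>l<h + 2. A' l = ?A1 l" "rows_hold A' (h + 2) ks" by blast
      have "\<forall>y<5. \<rho>' y = \<rho> y" using r(1) by simp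
      then show ?case unfolding s' by (rule leaf) (use r A' in auto)
    qed (use \<rho> hR a Aa ex in auto)
  qed simp
  show ?thesis unfolding process_node_def s
  proof (rule runs_Assign_Seq[where v = h], goal_cases)
    case 1
    show ?case using \<rho> hR words by (simp add: h_def)
  next
    case 3
    show ?case unfolding st_simps
    proof (rule runs_Seq[where Ta = "(n + 1) * 37" and Tb = "time_expand + (n + 1) * 75 + 52"], goal_cases)
      case 1
      show ?case
      proof (rule runs_conseq[OF runs_copy_row[where ?l1.0 = 0 and ?l2.0 = "h + 2"]], goal_cases)
        case (12 s')
        have nW: "n + 2 < W" using words by (simp add: B_def)
        show ?case unfolding 12
        proof (rule runs_Assign_Seq[where v = 0], goal_cases)
          case 3
          show ?case unfolding st_simps
          proof (rule runs_Assign_Seq[where v = 0], goal_cases)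
            case 3
            show ?case unfolding st_simps
            proof (rule runs_Assign_Seq[where v = "2 + n"], goal_cases)
              case 1
              show ?case using \<rho> nW words by simp
            next
              case 3
              show ?case unfolding st_simps by (rule runs_conseq[OF main]) simp_all
            qed simp
          qed (use words in simp_all)
        qed (use words in simp_all)
      qed (use \<rho> hR R_pos words Aa av in auto)
    qed (simp add: time_node_def)
  qed (simp add: time_node_def)
qed

section \<open>Output and the complete program\<close>

lemma initial_input: "initial input = st (\<lambda>_. 0) (\<lambda>_ _. 0)"
  using length_input_le by (auto simp: initial_def st_def layout_def)

text \<open>The output overwrites the beginning of the input, where the variable names are stored.
  Round \<open>i\<close> reads the name in cell \<open>2 + i\<close> and writes cell
  \<open>i\<close>, so no name is lost before its use, and \<open>i < B\<close> keeps the matrix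
  intact. Since the input area changes, the invariant speaks about cells directly.\<close>

lemma runs_output:
  assumes \<rho>: "\<rho> rn = n" "\<rho> rR = R" "\<rho> rB = B"
    and b: "valid b" "\<And>v. v \<in> Vars I \<Longrightarrow> A 1 v = b v"
  shows "runs W (For ri (Reg rn) (Cond (Op Monus (Num (q + 1)) (Mem (Addr VarName (Num 1))))
       (Store (Reg ri) (Mem (Addr VarName (Num 1))))
       (Store (Reg ri) (Num 1)))) (st \<rho> A) ((n + 1) * 60) (\<lambda>s. output_represents vs s (fill b))"
proof (rule runs_For[where k = n and T = 40 and Inv = "\<lambda>i s. regs s = \<rho>(ri := i) \<and>
    (\<forall>k<i. mem s k = cell_value (fill b (vs ! k))) \<and> (\<forall>k\<ge>i. mem s k = layout A k)"], goal_cases)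
  case 1
  show ?case by simp
next
  case (2 i s)
  then show ?case using \<rho> words by simp
next
  case (3 i s)
  define v where "v = vs ! i"
  have v: "v \<in> Vars I" "v \<le> M" using nth_vs[OF 3(1)] by (simp_all add: v_def)
  have bv: "b v \<le> q + 1" "b v < W" using b(1) v words by (auto simp: valid_def intro: le_less_trans)
  have i2: "2 + i < length input" using input_head(5)[OF 3(1)] .
  then have iW: "2 + i < W" "i < B" using length_input_le words by simp_all
  have "mem s (2 + i) = v"
    using 3(2) layout_input[OF i2, of A] input_head(4)[OF 3(1)] by (simp add: v_def)
  then have vn: "eval W s VarName = Some v"
    using 3(2) iW v words by (simp add: VarName_def)
  have R1: "1 < R" by (simp add: R_def)
  have "eval W s (Addr VarName (Num 1)) = Some (addr v 1)"
    using 3(2) \<rho> vn v words R1 by (intro eval_Addr) auto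
  moreover have "mem s (addr v 1) = b v"
    using 3(2) iW layout_addr[OF R1, of A v] b(2)[OF v(1)] by (simp add: addr_def)
  ultimately have ev: "eval W s (Mem (Addr VarName (Num 1))) = Some (b v)" using bv by simp
  note inv = 3(2)
  have fin: "regs (s\<lparr>mem := (mem s)(i := cell_value (fill b v))\<rparr>) ri = i \<and>
      (let s' = s\<lparr>mem := (mem s)(i := cell_value (fill b v)), regs := (\<rho>(ri := i))(ri := Suc i)\<rparr> in
       regs s' = \<rho>(ri := Suc i) \<and> (\<forall>k<Suc i. mem s' k = cell_value (fill b (vs ! k))) \<and>
       (\<forall>k\<ge>Suc i. mem s' k = layout A k))"
    using 3(2) by (auto simp: v_def less_Suc_eq)
  show ?case
  proof (rule runs_Cond[where v = "q + 1 - b v"], goal_cases)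
    case 1
    show ?case using ev bv words by simp
  next
    case 3
    then have "cell_value (fill b v) = b v" using v by (auto simp: fill_def)
    then show ?case using inv ev iW fin words
      by (intro runs_Store[where a = i and v = "b v"]) (auto simp: Let_def)
  next
    case 4
    then have "cell_value (fill b v) = 1" using v bv by (auto simp: fill_def)
    then show ?case using inv iW fin words
      by (intro runs_Store[where a = i and v = 1]) (auto simp: Let_def)
  qed simp
next
  case (4 s)
  then show ?case by (simp add: output_represents_def n_def cell_value_def)
next
  case 5
  show ?case using words by simp
next
  case 6
  show ?case by simp
qed

text \<open>Rounding down and adding 1 gives a natural number strictly above the initial potential,
  as \<open>runs_While\<close> demands.\<close>

definition steps :: nat where
  "steps = nat \<lfloor>branch_base q r ^ n * (real n + 1)\<rfloor> + 1"

lemma runs_search: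
  assumes "node_state ([a], 0, b) s"
  shows "runs W (While (Reg rh) (process_node q)) s (steps * (time_node + 2))
    (\<lambda>s. \<exists>\<rho> A b. s = st \<rho> A \<and> \<rho> rn = n \<and> \<rho> rR = R \<and> \<rho> rB = B \<and>
      valid b \<and> (\<forall>v\<in>Vars I. A 1 v = b v) \<and> optimal q I (fill b))" (is "runs _ _ _ _ ?Q")
proof -
  have "runs W (While (Reg rh) (process_node q)) s (steps * (1 + etime (Reg rh) + time_node)) ?Q"
  proof (rule runs_While[where Inv = node_state and g = "([a], 0, b)" and pot = "\<lambda>g. potential (fst g)"])
    have "weight a \<le> branch_base q r ^ n * (real n + 1)"
      unfolding weight_def using card_free_le[of a] branch_base_ge_1[OF q_pos r_pos]
      by (intro mult_mono power_increasing) (auto simp: n_def)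
    also have "\<dots> < real steps" unfolding steps_def by linarith
    finally show "potential (fst ([a], 0, b)) < real steps" by (simp add: potential_def)
  next
    fix g s assume inv: "node_state g s"
    obtain stk bc b where g: "g = (stk, bc, b)" by (cases g) auto
    obtain \<rho> A where s: "s = st \<rho> A" and \<rho>: "\<rho> rn = n" "\<rho> rR = R" "\<rho> rB = B" "\<rho> rh = length stk"
      and A: "bc \<noteq> 0 \<longrightarrow> (\<forall>v\<in>Vars I. A 1 v = b v)" and si: "search_inv stk bc b"
      using inv unfolding g by auto
    have hR: "length stk < W"
    proof (cases stk rule: rev_cases)
      case (snoc stk' a)
      then have "length stk' \<le> n * D" using si unfolding search_inv_def
        by (auto simp: n_def D_def dest!: spec[of _ "length stk'"])
      then have "length stk < R" using snoc by (simp add: R_def)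
      then show ?thesis using words by simp
    qed (use words in simp)
    have ev: "eval W s (Reg rh) = Some (length stk)" using \<rho> hR by (simp add: s)
    have final: "?Q s" if "stk = []"
    proof -
      have "bc \<noteq> 0" using search_inv_final(1)[of bc b] si that by simp
      then show ?thesis using search_inv_final(2,3)[of bc b] si that s \<rho> A by blast
    qed
    have step: "runs W (process_node q) s time_node (\<lambda>s'. \<exists>g'. node_state g' s' \<and>
        potential (fst g') + 1 \<le> potential (fst g))" if "stk \<noteq> []"
    proof -
      from that obtain stk' a where stk': "stk = stk' @ [a]" by (cases stk rule: rev_cases) auto
      show ?thesis using runs_process_node[of stk' a bc b s] inv unfolding g stk' by simp
    qed
    show "\<exists>v. eval W s (Reg rh) = Some v \<and> (v = 0 \<longrightarrow> ?Q s) \<and>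
        (v \<noteq> 0 \<longrightarrow> runs W (process_node q) s time_node (\<lambda>s'. \<exists>g'. node_state g' s' \<and>
        potential (fst g') + 1 \<le> potential (fst g)))"
      using ev final step by (intro exI[of _ "length stk"]) auto
  qed (use assms potential_nonneg in auto)
  then show ?thesis by (rule runs_conseq) simp_all
qed

lemma runs_solver:
  "runs W (wcsp_solver q r) (initial input) (steps * (time_node + 2) + (n + 1) * 200)
    (\<lambda>s. \<exists>\<phi>. optimal q I \<phi> \<and> output_represents vs s \<phi>)" (is "runs _ _ _ _ ?Q")
proof -
  let ?A = "\<lambda>_ _. 0 :: nat"
  let ?out = "For ri (Reg rn) (Cond (Op Monus (Num (q + 1)) (Mem (Addr VarName (Num 1))))
       (Store (Reg ri) (Mem (Addr VarName (Num 1))))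
       (Store (Reg ri) (Num 1)))"
  let ?search = "While (Reg rh) (process_node q) ;; ?out"
  let ?\<rho> = "(\<lambda>_. 0 :: nat)(rn := n, rm := m, rR := R, rB := B)"
  let ?A1 = "?A(2 := \<lambda>v. if v \<in> Vars I then q + 1 else 0)"
  let ?\<rho>1 = "?\<rho>(ri := n, rh := 1)"
  have search: "runs W ?search (st ?\<rho>1 ?A1) (steps * (time_node + 2) + (n + 1) * 60 + 1) ?Q"
  proof (rule runs_Seq[where Ta = "steps * (time_node + 2)" and Tb = "(n + 1) * 60"])
    have "node_state ([?A1 2], 0, ?A 0) (st ?\<rho>1 ?A1)"
      unfolding node_state.simps
    proof (intro exI conjI)
      show "st ?\<rho>1 ?A1 = st ?\<rho>1 ?A1" ..
      show "search_inv [?A1 2] 0 (?A 0)" by (rule search_inv_init) simp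
    qed (simp_all add: rows_hold_def)
    from runs_search[OF this] show "runs W (While (Reg rh) (process_node q)) (st ?\<rho>1 ?A1)
        (steps * (time_node + 2)) (\<lambda>s. runs W ?out s ((n + 1) * 60) ?Q)"
    proof (rule runs_conseq)
      fix s assume "\<exists>\<rho> A b. s = st \<rho> A \<and> \<rho> rn = n \<and> \<rho> rR = R \<and> \<rho> rB = B \<and>
        valid b \<and> (\<forall>v\<in>Vars I. A 1 v = b v) \<and> optimal q I (fill b)"
      then obtain \<rho> A b where s: "s = st \<rho> A" "\<rho> rn = n" "\<rho> rR = R" "\<rho> rB = B" "valid b"
        "\<forall>v\<in>Vars I. A 1 v = b v" "optimal q I (fill b)" by blast
      show "runs W ?out s ((n + 1) * 60) ?Q" unfolding s(1)
        by (rule runs_conseq[OF runs_output[of \<rho> b]]) (use s in auto)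
    qed simp
  qed simp
  have init: "runs W (For ri (Reg rn) (Store (Addr VarName (Num 2)) (Num (q + 1)))) (st ?\<rho> ?A) ((n + 1) * 40)
      (\<lambda>s. s = st (?\<rho>(ri := n)) ?A1)"
  proof (rule runs_For[where Inv = "\<lambda>i s. s = st (?\<rho>(ri := i))
      (?A(2 := \<lambda>v. if v \<in> set (take i vs) then q + 1 else 0))" and k = n and T = 20], goal_cases)
    case 1
    show ?case by (auto intro!: arg_cong[of _ _ "st _"])
  next
    case (2 i s)
    then show ?case using words by simp
  next
    case (3 i s)
    let ?B = "?A(2 := \<lambda>v. if v \<in> set (take i vs) then q + 1 else 0)"
    have t: "set (take (Suc i) vs) = insert (vs ! i) (set (take i vs))"
      using 3(1) by (simp add: take_Suc_conv_app_nth n_def)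
    have R2: "2 < R" by (simp add: R_def)
    show ?case unfolding 3(2)
    proof (rule runs_Store[where a = "addr (vs ! i) 2" and v = "q + 1"], goal_cases)
      case 1
      show ?case using 3(1) nth_vs[OF 3(1)] words R2 by (intro eval_Addr eval_VarName) auto
    next
      case 2
      show ?case using words by simp
    next
      case 4
      show ?case unfolding st_simps st_store[OF R2] t
        by (auto intro!: arg_cong[of _ _ "st _"] ext)
    qed simp
  next
    case (4 s)
    then show ?case by (simp add: n_def set_vs)
  next
    case 5
    show ?case using words by simp
  next
    case 6
    show ?case by simp
  qed
  have RB: "n * D < W" "D + 3 < W" "n * D + (D + 3) = R" "2 + n < W" "m * (2 + r + D) < W"
    "2 + n + m * (2 + r + D) = B" "2 + r + D < W"
    using words W_const by (simp_all add: R_def B_def D_def)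
  have in0: "0 < length input" using input_head(3) by linarith
  show ?thesis unfolding wcsp_solver_def initial_input D_def[symmetric]
  proof (rule runs_Assign_Seq[where v = n], goal_cases)
    case 1
    show ?case using layout_input[OF in0, of ?A] input_head(1) words by simp
  next
    case 3
    show ?case unfolding st_simps
    proof (rule runs_Assign_Seq[where v = m], goal_cases)
      case 1
      show ?case using layout_input[OF input_head(3), of ?A] input_head(2) words by simp
    next
      case 3
      show ?case unfolding st_simps
      proof (rule runs_Assign_Seq[where v = R], goal_cases)
        case 1
        show ?case using RB words by simp
      next
        case 3
        show ?case unfolding st_simps
        proof (rule runs_Assign_Seq[where v = B], goal_cases)
          case 1
          show ?case using RB words by simp
        next
          case 3
          show ?case unfolding st_simps
          proof (rule runs_Seq[where Ta = "(n + 1) * 40" and Tb = "steps * (time_node + 2) + (n + 1) * 60 + 10"], goal_cases)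
            case 1
            show ?case
            proof (rule runs_conseq[OF init order_refl])
              fix s assume s: "s = st (?\<rho>(ri := n)) ?A1"
              show "runs W (Assign rh (Num 1) ;; ?search) s (steps * (time_node + 2) + (n + 1) * 60 + 10) ?Q"
                unfolding s
              proof (rule runs_Assign_Seq[where v = 1], goal_cases)
                case 1
                show ?case using words by simp
              next
                case 3
                show ?case unfolding st_simps by (rule runs_conseq[OF search]) simp_all
              qed simp
            qed
          qed simp
        qed simp
      qed simp
    qed simp
  qed simp
qed

section \<open>The polynomial factor of the running time\<close>

lemma m_le: "m \<le> (n + 1) ^ r"
proof -
  \<comment> \<open>The list \<open>cs\<close> has no repetitions, so its length counts distinct
    sets of at most \<open>r\<close> variables, whatever the multiplicities.\<close>
  have "m = card (set cs)" using distinct_card[OF distinct_cs] by (simp add: m_def)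
  also have "\<dots> \<le> (card (Vars I) + 1) ^ r"
    using constraint_subset constraint_card by (intro card_small_subsets_le) (auto simp: set_cs)
  finally show ?thesis by (simp add: n_def length_vs)
qed

text \<open>Trying an entry copies one row and is linear in \<open>n\<close>; the number of entries
  per constraint is a constant. With \<open>m_le\<close> a node takes time of order
  (n+1)^(r+1).\<close>

lemma time_node_le:
  "time_node + 2 \<le> (n + 1) ^ (r + 1) * (2 * ((D + 1) * ((r + 1) * 150 + 127) + (r + 1) * 30 + 282))"
proof -
  let ?c1 = "(r + 1) * 150 + 47"
  let ?c2 = "(D + 1) * (?c1 + 80) + (r + 1) * 30 + 80"
  have n: "k \<le> (n + 1) * k" for k by simp
  have "time_try \<le> (n + 1) * ?c1"
    unfolding time_try_def using n[of "(r + 1) * 150 + 10"] by (simp add: algebra_simps)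
  then have "time_try + 80 \<le> (n + 1) * (?c1 + 80)"
    using n[of 80] by (simp add: algebra_simps)
  then have "(D + 1) * (time_try + 80) \<le> (D + 1) * ((n + 1) * (?c1 + 80))" by (rule mult_le_mono2)
  also have "\<dots> = (n + 1) * ((D + 1) * (?c1 + 80))" by (rule mult.left_commute)
  finally have "time_constraint \<le> (n + 1) * ((D + 1) * (?c1 + 80)) + ((r + 1) * 30 + 80)"
    unfolding time_constraint_def by simp
  also have "\<dots> \<le> (n + 1) * ((D + 1) * (?c1 + 80)) + (n + 1) * ((r + 1) * 30 + 80)"
    using n by (intro add_left_mono)
  also have "\<dots> = (n + 1) * ?c2" unfolding add_mult_distrib2[symmetric] by simp
  finally have "time_constraint + 20 \<le> (n + 1) * (?c2 + 20)"
    using n[of 20] unfolding add_mult_distrib2 by linarith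
  then have "time_expand \<le> (m + 1) * ((n + 1) * (?c2 + 20))"
    unfolding time_expand_def by (rule mult_le_mono2)
  moreover have "(n + 1) * 120 + 62 \<le> (m + 1) * ((n + 1) * 182)"
  proof -
    have "(n + 1) * 120 + 62 \<le> (n + 1) * 182" by simp
    also have "\<dots> \<le> (m + 1) * ((n + 1) * 182)" by simp
    finally show ?thesis .
  qed
  ultimately have "time_node + 2 \<le> (m + 1) * ((n + 1) * (?c2 + 20)) + (m + 1) * ((n + 1) * 182)"
    unfolding time_node_def by linarith
  also have "\<dots> = (m + 1) * ((n + 1) * (?c2 + 202))"
    unfolding add_mult_distrib2[symmetric] by simp
  also have "\<dots> \<le> (2 * (n + 1) ^ r) * ((n + 1) * (?c2 + 202))"
  proof (rule mult_le_mono1)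
    have "1 \<le> (n + 1) ^ r" by simp
    then show "m + 1 \<le> 2 * (n + 1) ^ r" using m_le by linarith
  qed
  also have "\<dots> = (n + 1) ^ (r + 1) * (2 * (?c2 + 202))"
    by (simp only: power_add power_one_right mult_ac)
  also have "?c2 + 202 = (D + 1) * ((r + 1) * 150 + 127) + (r + 1) * 30 + 282" by simp
  finally show ?thesis .
qed

text \<open>The weight of the root contributes one more factor \<open>n + 1\<close>. In
  \<open>c\<close>, the outer factor 2 absorbs the rounding in \<open>steps\<close>, and 200 covers
  the linear set-up and output.\<close>

lemma total_time_le:
  fixes c :: nat
  assumes "c = 2 * (2 * ((D + 1) * ((r + 1) * 150 + 127) + (r + 1) * 30 + 282)) + 200"
  shows "real (steps * (time_node + 2) + (n + 1) * 200) \<le>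
    branch_base q r ^ n * (real c * real (n + 1) ^ (r + 2))"
proof -
  let ?b = "branch_base q r ^ n" let ?N = "real (n + 1)"
  let ?k = "2 * ((D + 1) * ((r + 1) * 150 + 127) + (r + 1) * 30 + 282)"
  have b: "1 \<le> ?b" using branch_base_ge_1[OF q_pos r_pos] by (rule one_le_power)
  have bN: "1 \<le> ?b * ?N" using mult_mono[OF b, of 1 ?N] b by simp
  have "real steps \<le> ?b * ?N + 1" unfolding steps_def using b by (simp add: add.commute)
  also have "\<dots> \<le> 2 * (?b * ?N)" using bN by linarith
  finally have s: "real steps \<le> 2 * (?b * ?N)" .
  have "real (time_node + 2) \<le> real ((n + 1) ^ (r + 1) * ?k)" using time_node_le by (simp only: of_nat_le_iff)
  then have t: "real (time_node + 2) \<le> ?N ^ (r + 1) * real ?k" by (simp only: of_nat_mult of_nat_power)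
  have "real (steps * (time_node + 2)) \<le> (2 * (?b * ?N)) * (?N ^ (r + 1) * real ?k)"
    unfolding of_nat_mult using s t b by (intro mult_mono) auto
  also have "\<dots> = ?b * ?N ^ (r + 2) * (2 * real ?k)" by simp
  finally have 1: "real (steps * (time_node + 2)) \<le> ?b * ?N ^ (r + 2) * (2 * real ?k)" .
  have "?N ^ 1 \<le> ?N ^ (r + 2)" by (intro power_increasing) auto
  then have "1 * ?N \<le> ?b * ?N ^ (r + 2)" using b by (intro mult_mono) auto
  then have "?N * 200 \<le> ?b * ?N ^ (r + 2) * 200" by (intro mult_right_mono) simp_all
  then have 2: "real ((n + 1) * 200) \<le> ?b * ?N ^ (r + 2) * 200"
    by (simp only: of_nat_mult of_nat_numeral)
  have "real (steps * (time_node + 2) + (n + 1) * 200) =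
      real (steps * (time_node + 2)) + real ((n + 1) * 200)" by (rule of_nat_add)
  also have "\<dots> \<le> ?b * ?N ^ (r + 2) * (2 * real ?k) + ?b * ?N ^ (r + 2) * 200"
    using 1 2 by (rule add_mono)
  also have "\<dots> = ?b * ?N ^ (r + 2) * (2 * real ?k + 200)" by (rule distrib_left[symmetric])
  also have "2 * real ?k + 200 = real c" unfolding assms by simp
  finally show ?thesis by (simp add: mult_ac)
qed

end

text \<open>All requirements are compared with powers of \<open>X = M + 2\<close>. The lengths of
  \<open>vs\<close> and \<open>cs\<close> are themselves input words and hence at most
  \<open>M\<close>. Constants depending on \<open>q\<close> and \<open>r\<close> are absorbed by
  \<open>E < X ^ E\<close> and \<open>F < X ^ F\<close>, which explains the summands
  \<open>E\<close> and \<open>F\<close> of \<open>k\<close>; the summand 5 leaves room for the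
  powers of \<open>X\<close> in the address and cost bounds.\<close>

lemma wcsp_ram_word_bound:
  fixes q r :: nat
  assumes in': "wcsp_input q r I vs cs" and "r \<ge> 1"
    and k: "k = 5 + (((q + 1) ^ r + r + 5) + ((q + 1) * (q + 1) + (q + 1) ^ r + r + 5))"
    and xs: "xs = encode q I vs cs"
  shows "wcsp_ram q r I vs cs (word_bound k (card (Vars I)) xs) (Max (set xs))"
proof -
  define M where "M = Max (set xs)"
  define X where "X = M + 2"
  define D where "D = (q + 1) ^ r"
  define E where "E = D + r + 5"
  define F where "F = (q + 1) * (q + 1) + D + r + 5"
  define W where "W = word_bound k (card (Vars I)) xs"
  have le: "x \<le> M" if "x \<in> set xs" for x unfolding M_def using that by (intro Max_ge) auto
  have nM: "length vs \<le> M" and mM: "length cs \<le> M" by (intro le, simp add: xs encode_def)+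
  have X: "X \<ge> 2" by (simp add: X_def)
  have W: "X ^ j \<le> W" if "j \<le> k" for j
  proof -
    have "X ^ j \<le> X ^ k" using that X by (intro power_increasing) auto
    also have "\<dots> \<le> W" unfolding W_def word_bound_def X_def M_def
      using mult_le_mono1[of 1 "2 ^ card (Vars I)" "Max (set xs) + 2"] by (intro power_mono) simp_all
    finally show ?thesis .
  qed
  have kEF: "k = 5 + (E + F)" by (simp add: k E_def F_def D_def)
  have EX: "E < X ^ E" "F < X ^ F" using less_power_of_ge_2[OF X] by auto
  have "F < W" using EX(2) W[of F] kEF by simp
  have addr: "2 + length vs + length cs * (2 + r + D) + (M + 1) * (length vs * D + D + 3) < W"
  proof -
    have "length cs * (2 + r + D) \<le> X * E" using mM by (intro mult_mono) (auto simp: X_def E_def)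
    moreover have "length vs * D + D + 3 \<le> X * E"
    proof -
      have "length vs * D + D + 3 \<le> (length vs + 1) * (D + 3)" by (simp add: algebra_simps)
      also have "\<dots> \<le> X * E" using nM by (intro mult_mono) (auto simp: X_def E_def)
      finally show ?thesis .
    qed
    then have "(M + 1) * (length vs * D + D + 3) \<le> X * (X * E)"
      by (intro mult_mono) (auto simp: X_def)
    moreover have "2 + length vs \<le> X" using nM by (simp add: X_def)
    ultimately have "2 + length vs + length cs * (2 + r + D) + (M + 1) * (length vs * D + D + 3)
        \<le> X + X * E + X * (X * E)" by linarith
    \<comment> \<open>Each summand is at most \<open>X * (X * E)\<close>; the factor 3 is below
      \<open>X * X\<close>, and \<open>E\<close> is below \<open>X ^ E\<close>.\<close>
    also have "\<dots> < X ^ (4 + E)"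
    proof -
      have "X * E \<le> X * (X * E)" "X \<le> X * (X * E)" using X by (auto simp: E_def)
      then have "X + X * E + X * (X * E) \<le> 3 * (X * (X * E))" by linarith
      also have "\<dots> < (X * X) * (X * X * X ^ E)"
      proof -
        have "4 \<le> X * X" using mult_le_mono[OF X X] by simp
        then have "3 * (X * (X * E)) < (X * X) * (X * (X * E))"
          using X by (intro mult_strict_right_mono) (auto simp: E_def)
        also have "\<dots> \<le> (X * X) * (X * X * X ^ E)"
          using EX(1) by (simp add: mult.assoc)
        finally show ?thesis .
      qed
      also have "\<dots> = X ^ (4 + E)" by (simp add: power_add eval_nat_numeral)
      finally show ?thesis .
    qed
    also have "\<dots> \<le> W" by (rule W) (simp add: kEF)
    finally show ?thesis .
  qed
  have cost1: "length cs * (M * M) + length vs + 2 < W"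
  proof -
    have "length cs * (M * M) \<le> X * (X * X)" using mM by (intro mult_mono) (auto simp: X_def)
    moreover have "length vs + 2 \<le> X * (X * X)"
    proof -
      have "X \<le> X * (X * X)" using X by simp
      then show ?thesis using nM by (simp add: X_def)
    qed
    ultimately have "length cs * (M * M) + length vs + 2 \<le> 2 * (X * (X * X))" by linarith
    also have "\<dots> < (X * X) * (X * (X * X))"
    proof -
      have "2 < X * X" using mult_le_mono[OF X X] by simp
      then show ?thesis using X by (intro mult_strict_right_mono) auto
    qed
    also have "\<dots> = X ^ 5" by (simp add: eval_nat_numeral)
    also have "\<dots> \<le> W" by (rule W) (simp add: kEF)
    finally show ?thesis .
  qed
  have cost2: "(M + 1) * (M + 1) + 1 < W"
  proof -
    have "(M + 1) * (M + 1) + 1 < X ^ 2" by (simp add: X_def power2_eq_square)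
    also have "\<dots> \<le> W" by (rule W) (simp add: kEF)
    finally show ?thesis .
  qed
  show ?thesis
    unfolding wcsp_ram_def wcsp_ram_axioms_def W_def[symmetric] M_def[symmetric]
    using in' \<open>r \<ge> 1\<close> le addr cost1 cost2 \<open>F < W\<close>
    by (auto simp: xs D_def F_def)
qed

theorem theorem7p4:
  fixes q r :: nat
  assumes "q \<ge> 1" and "r \<ge> 1"
  shows "\<exists>p k c d. solves_wcsp_in_time p k q r
           (\<lambda>n. ((real q + 1) ^ r - 1) powr (real n / real r) * (real c * real (n + 1) ^ d))"
proof -
  \<comment> \<open>Both \<open>k\<close> and \<open>c\<close> depend on \<open>q\<close> and
    \<open>r\<close> only, so one program with one word bound and one polynomial serves all
    instances.\<close>
  define k where "k = 5 + (((q + 1) ^ r + r + 5) + ((q + 1) * (q + 1) + (q + 1) ^ r + r + 5))"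
  define c where "c = 2 * (2 * (((q + 1) ^ r + 1) * ((r + 1) * 150 + 127) + (r + 1) * 30 + 282)) + 200"
  have "solves_wcsp_in_time (wcsp_solver q r) k q r
      (\<lambda>n. ((real q + 1) ^ r - 1) powr (real n / real r) * (real c * real (n + 1) ^ (r + 2)))"
    unfolding solves_wcsp_in_time_def
  proof (intro allI impI, elim conjE)
    fix I vs xs assume inst: "wcsp_instance q r I" and enc: "input_encoding q I vs xs"
    obtain cs where cs: "distinct vs" "set vs = Vars I" "distinct cs" "set cs = set_mset (Constraints I)"
      and xs: "xs = encode q I vs cs"
      using enc unfolding input_encoding_def by blast
    have "wcsp_input q r I vs cs" using assms inst cs by unfold_locales
    from wcsp_ram_word_bound[OF this assms(2) k_def xs]
    interpret wcsp_ram q r I vs cs "word_bound k (card (Vars I)) xs" "Max (set xs)" .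
    have n: "n = card (Vars I)" by (simp add: n_def length_vs)
    have "c = 2 * (2 * ((D + 1) * ((r + 1) * 150 + 127) + (r + 1) * 30 + 282)) + 200"
      by (simp add: c_def D_def)
    note time = total_time_le[OF this, unfolded n branch_base_power[OF assms]]
    from runs_solver obtain t s \<phi> where "exec (word_bound k (card (Vars I)) xs) (wcsp_solver q r) (initial input) t s"
      "t \<le> steps * (time_node + 2) + (n + 1) * 200" "optimal q I \<phi>" "output_represents vs s \<phi>"
      unfolding runs_def by blast
    moreover from this time have "real t \<le> ((real q + 1) ^ r - 1) powr (real (card (Vars I)) / real r) *
        (real c * real (card (Vars I) + 1) ^ (r + 2))"
      unfolding n by (meson of_nat_mono order_trans)
    ultimately show "\<exists>t s \<phi>. exec (word_bound k (card (Vars I)) xs) (wcsp_solver q r) (initial xs) t s \<and>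
        real t \<le> ((real q + 1) ^ r - 1) powr (real (card (Vars I)) / real r) *
          (real c * real (card (Vars I) + 1) ^ (r + 2)) \<and>
        optimal q I \<phi> \<and> output_represents vs s \<phi>"
      unfolding input_def xs[symmetric] by blast
  qed
  then show ?thesis by blast
qed

end
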